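(* Let $n=[(2m+1)q]^2+4$ be a square-free integer, where $q$ is an odd prime and $m\geq 1$ is an integer. If the class number $h_n^+$ of $\mathbb{Q}(\zeta_n^+)$ is prime and $\phi(n)/4$ is relatively prime to the class number of $\mathbb{Q}(\sqrt{n})$, then $\mathbf{R}_{\mathbb{Q}(\zeta_n^+)/\mathbb{Q}}$ is non-trivial, i.e. $\mathbf{R}_{\mathbb{Q}(\zeta_n^+)/\mathbb{Q}}\neq\{1\}$.
   Context: Here $\mathbb{Q}(\zeta_n^+)$ denotes the maximal real subfield of the cyclotomic field $\mathbb{Q}(\zeta_n)$ ($\zeta_n$ a primitive $n$-th root of unity), $h_n^+$ its class number, and $\phi$ is Euler's totient function. For a Galois extension of number fields $L/K$, the residue degree of a prime ideal $\wp$ of $L$ above a prime $\mathfrak{p}$ of $K$ is $[\mathcal{O}_L/\wp:\mathcal{O}_K/\mathfrak{p}]$, and $$\mathbf{R}_{L/K}=\{f\in\mathbb{N}: \text{the class group of } L \text{ is generated by the classes of prime ideals of } L \text{ that are unramified over } K \text{ and have residue degree } f \text{ for } L/K\}.$$ One always has $1\in\mathbf{R}_{L/K}$; the set $\mathbf{R}_{L/K}$ is called trivial if it equals $\{1\}$ and non-trivial otherwise. *)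

theory Defs
  imports
    Complex_Main
    "HOL-Algebra.Generated_Fields"
    "HOL-Algebra.Embedded_Algebras"
    "HOL-Algebra.Ideal_Product"
    "HOL-Algebra.QuotRing"
    "HOL-Algebra.Algebraic_Closure_Type"
    "HOL-Computational_Algebra.Polynomial"
    "HOL-Computational_Algebra.Squarefree"
    "HOL-Number_Theory.Totient"
begin

text \<open>
  Number fields are represented by their carriers, as subfields of the complex numbers.
  The definitions below are meant for number fields \<open>K \<subseteq> L\<close>.
\<close>

abbreviation complex_ring :: "complex ring" where
  "complex_ring \<equiv> ring_of_type_algebra"

definition adjoin_Q :: "complex \<Rightarrow> complex set" where
  "adjoin_Q a = generate_field complex_ring (\<rat> \<union> {a})"

definition cyclotomic_field :: "nat \<Rightarrow> complex set" where
  "cyclotomic_field n = adjoin_Q (cis (2 * pi / real n))"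

definition max_real_cyclotomic_field :: "nat \<Rightarrow> complex set" where
  "max_real_cyclotomic_field n = cyclotomic_field n \<inter> \<real>"

definition integers_of :: "complex set \<Rightarrow> complex set" where
  "integers_of L = {x \<in> L. algebraic_int x}"

definition ring_of_integers :: "complex set \<Rightarrow> complex ring" where
  "ring_of_integers L = complex_ring\<lparr>carrier := integers_of L\<rparr>"

definition fractional_ideal :: "complex set \<Rightarrow> complex set \<Rightarrow> bool" where
  "fractional_ideal L I \<longleftrightarrow>
     I \<subseteq> L \<and> I \<noteq> {0} \<and> subgroup I (add_monoid complex_ring) \<and>
     (\<forall>a\<in>integers_of L. \<forall>x\<in>I. a * x \<in> I) \<and>
     (\<exists>d\<in>integers_of L - {0}. \<forall>x\<in>I. d * x \<in> integers_of L)"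

text \<open>
  Taken in the ring of complex numbers, \<^const>\<open>ideal_prod\<close> is the set of finite sums of
  products of elements, which is the product of fractional ideals.
\<close>

definition fractional_ideal_group :: "complex set \<Rightarrow> complex set monoid" where
  "fractional_ideal_group L =
     \<lparr>carrier = {I. fractional_ideal L I}, monoid.mult = ideal_prod complex_ring,
      one = integers_of L\<rparr>"

definition principal_fractional_ideals :: "complex set \<Rightarrow> complex set set" where
  "principal_fractional_ideals L = {(\<lambda>x. c * x) ` integers_of L | c. c \<in> L - {0}}"

definition class_group :: "complex set \<Rightarrow> complex set set monoid" where
  "class_group L = fractional_ideal_group L Mod principal_fractional_ideals L"

definition ideal_class :: "complex set \<Rightarrow> complex set \<Rightarrow> complex set set" where
  "ideal_class L I = principal_fractional_ideals L #>\<^bsub>fractional_ideal_group L\<^esub> I"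

definition class_number :: "complex set \<Rightarrow> nat" where
  "class_number L = Coset.order (class_group L)"

text \<open>
  In the next two definitions \<open>P\<close> is a nonzero prime ideal of the ring of integers of \<open>L\<close>,
  lying above the prime ideal \<open>P \<inter> integers_of K\<close> of \<open>K\<close>.
\<close>

definition ramification_index :: "complex set \<Rightarrow> complex set \<Rightarrow> complex set \<Rightarrow> nat" where
  "ramification_index K L P =
     (GREATEST e::nat. Idl\<^bsub>ring_of_integers L\<^esub> (P \<inter> integers_of K)
        \<subseteq> P [^]\<^bsub>fractional_ideal_group L\<^esub> e)"

text \<open>
  The residue field of \<open>K\<close> is taken as the image of the integers of \<open>K\<close> in the residue
  field of \<open>L\<close>, so that the residue degree is the dimension of the latter over a subfield.
\<close>

definition residue_degree :: "complex set \<Rightarrow> complex set \<Rightarrow> complex set \<Rightarrow> nat" where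
  "residue_degree K L P =
     (ring.dim (ring_of_integers L Quot P) over
       ((\<lambda>x. P +>\<^bsub>ring_of_integers L\<^esub> x) ` integers_of K))
       (carrier (ring_of_integers L Quot P))"

definition unramified_primes_of_degree ::
    "complex set \<Rightarrow> complex set \<Rightarrow> nat \<Rightarrow> complex set set" where
  "unramified_primes_of_degree K L f =
     {P. primeideal P (ring_of_integers L) \<and> P \<noteq> {0} \<and>
         ramification_index K L P = 1 \<and> residue_degree K L P = f}"

text \<open>
  The set \<open>R\<^bsub>L/K\<^esub>\<close>, with \<open>L/K\<close> Galois. For a trivial class group the empty set of
  classes generates it, so then every positive \<open>f\<close> belongs to the set.
\<close>

definition residue_degree_set :: "complex set \<Rightarrow> complex set \<Rightarrow> nat set" where
  "residue_degree_set K L =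
     {f. f \<ge> 1 \<and>
         generate (class_group L) (ideal_class L ` unramified_primes_of_degree K L f)
           = carrier (class_group L)}"

end

theory Submission
  imports Defs "Jordan_Normal_Form.Char_Poly" "HOL-Number_Theory.Residues"
begin

text \<open>
  Put \<open>s = (2m + 1) q\<close>, so that \<open>n = s\<^sup>2 + 4\<close>, and let \<open>L\<close> be the maximal real subfield of
  \<open>\<rat>(\<zeta>\<^sub>n)\<close>. It contains \<open>k = \<rat>(\<surd>n)\<close>, because the quadratic Gauss sum is real and
  has square \<open>n\<close>. The prime \<open>q\<close> splits in \<open>k\<close>, and the primes above it are not principal, as a
  descent along the fundamental unit \<open>(s + \<surd>n) / 2\<close> shows that \<open>a\<^sup>2 - n b\<^sup>2 = \<plusminus>4q\<close> has no
  solutions. The norm from \<open>L\<close> to \<open>k\<close> raises ideals of \<open>k\<close> to the power \<open>[L : k]\<close>, which divides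
  \<open>\<phi>(n)/4\<close> and is therefore prime to the class number of \<open>k\<close>; so a nonprincipal prime of \<open>k\<close>
  above \<open>q\<close> stays nonprincipal in \<open>L\<close>. An ideal of \<open>L\<close> that contains it and is maximal among
  the nonprincipal ideals is a nonprincipal prime ideal \<open>P\<close> above \<open>q\<close>. Its class generates the
  class group of prime order, it is unramified since \<open>q\<close> does not divide \<open>n\<close>, and its residue
  degree is not 1, since otherwise \<open>\<zeta>\<^sup>q + \<zeta>\<^sup>-\<^sup>q - \<zeta> - \<zeta>\<^sup>-\<^sup>1\<close>, a divisor of \<open>n\<^sup>2\<close>, would
  lie in \<open>P\<close>.

  The irreducibility of the cyclotomic polynomial is not needed: it suffices that the Galois
  group is a subgroup of the units modulo \<open>n\<close>. Finiteness of the class numbers replaces most of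
  the theory of Dedekind domains: two powers of an ideal lie in the same class, so the ideal is
  invertible.
\<close>

section \<open>Algebraic integers\<close>

text \<open>No ideal is factored into primes. Enlarging the nonprincipal ideal may lose the chosen
  prime of \<open>k\<close>, but the enlarged ideal still contains \<open>q\<close>, and that is all
  that the ramification index and residue degree over the rationals require.
  \<open>class_number\<close> is a cardinality, hence 0 for an infinite class group, so finiteness
  has to come from the hypotheses. For \<open>L\<close> it follows from primality. For
  \<open>k\<close> it follows from coprimality: a number coprime to 0 is 1, while
  \<open>\<phi>(n)/4 \<ge> 2\<close> because \<open>n \<ge> 85\<close>. The norm is applied to
  elements only: a power of the ideal of \<open>k\<close> is principal, and its generator is
  compared with a power of the hypothetical generator in \<open>L\<close>. The element
  \<open>\<zeta>^q + \<zeta>^-q - \<zeta> - \<zeta>^-1\<close> measures the action of Frobenius on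
  \<open>\<zeta> + \<zeta>^-1\<close>, which is trivial on a residue field with \<open>q\<close>
  elements. Times \<open>\<zeta>^q\<close> it equals
  \<open>(\<zeta>^(q+1) - 1) (\<zeta>^(q-1) - 1)\<close>, and both factors divide
  \<open>n\<close>.\<close>

interpretation int_module: Modules.module "\<lambda>(k::int) (x::complex). of_int k * x"
  by unfold_locales (auto simp: algebra_simps)

text \<open>Multiplication by \<open>x\<close> is described on the generators \<open>V\<close> by an
  integer matrix, and the vector of generators is a nonzero eigenvector for \<open>x\<close>; so
  \<open>x\<close> is a root of the monic characteristic polynomial.\<close>

lemma algebraic_int_if_stabilizes_span:
  assumes "finite V" "v0 \<in> V" "v0 \<noteq> 0"
    and stable: "\<And>v. v \<in> V \<Longrightarrow> x * v \<in> int_module.span V"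
  shows "algebraic_int x"
proof -
  obtain vs where vs: "set vs = V" "distinct vs" using finite_distinct_list[OF assms(1)] by blast
  define n where "n = length vs"
  have "\<exists>c. x * v = (\<Sum>w\<in>V. of_int (c w) * w)" if "v \<in> V" for v
    using stable[OF that] int_module.span_finite[OF assms(1)] by auto
  then obtain c where c: "x * v = (\<Sum>w\<in>V. of_int (c v w) * w)" if "v \<in> V" for v by metis
  define A :: "int mat" where "A = mat n n (\<lambda>(i,j). c (vs ! i) (vs ! j))"
  have A: "A \<in> carrier_mat n n" by (simp add: A_def)
  define v where "v = vec n (\<lambda>i. vs ! i)"
  have "map_mat complex_of_int A *\<^sub>v v = x \<cdot>\<^sub>v v"
  proof (rule eq_vecI)
    fix i assume i: "i < dim_vec (x \<cdot>\<^sub>v v)"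
    hence i: "i < n" by (simp add: v_def)
    hence mem: "vs ! i \<in> V" using vs n_def by auto
    have "(map_mat complex_of_int A *\<^sub>v v) $ i = (\<Sum>j<n. of_int (c (vs ! i) (vs ! j)) * vs ! j)"
      using i by (simp add: A_def v_def scalar_prod_def atLeast0LessThan)
    also have "\<dots> = (\<Sum>w\<in>V. of_int (c (vs ! i) w) * w)"
      using sum.reindex_bij_betw[OF bij_betw_nth[OF vs(2), of "{..<n}" V], of "\<lambda>w. of_int (c (vs ! i) w) * w"]
      vs(1) n_def by auto
    also have "\<dots> = x * vs ! i" using c[OF mem] by simp
    finally show "(map_mat complex_of_int A *\<^sub>v v) $ i = (x \<cdot>\<^sub>v v) $ i" using i by (simp add: v_def)
  qed (simp add: A_def v_def)
  moreover have "v \<noteq> 0\<^sub>v n"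
  proof
    assume v0: "v = 0\<^sub>v n"
    obtain i where "i < n" "vs ! i = v0" using assms(2) vs(1) n_def by (metis in_set_conv_nth)
    thus False using v0 assms(3) by (auto simp: v_def vec_eq_iff)
  qed
  moreover have Ac: "map_mat complex_of_int A \<in> carrier_mat n n" using A by simp
  ultimately have "eigenvalue (map_mat complex_of_int A) x"
    unfolding eigenvalue_def eigenvector_def by (intro exI[of _ v]) (auto simp: v_def A_def)
  hence "poly (char_poly (map_mat complex_of_int A)) x = 0"
    using eigenvalue_root_char_poly[OF Ac] by simp
  hence "poly (map_poly of_int (char_poly A)) x = 0"
    by (simp add: of_int_hom.char_poly_hom[OF A])
  moreover have "lead_coeff (char_poly A) = 1" using degree_monic_char_poly[OF A] by simp
  ultimately show ?thesis unfolding algebraic_int_altdef_ipoly by blast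
qed

lemma algebraic_int_power_in_span:
  assumes "algebraic_int x"
  obtains d where "d > 0" "x ^ d \<in> int_module.span ((\<lambda>i. x ^ i) ` {..<d})"
proof -
  obtain p where p: "poly (map_poly of_int p) x = 0" "lead_coeff p = 1"
    using assms unfolding algebraic_int_altdef_ipoly by blast
  define d where "d = Polynomial.degree p"
  have "d > 0"
  proof (rule ccontr)
    assume "\<not> d > 0"
    then obtain c where "p = [:c:]" by (metis d_def degree_eq_zeroE gr0I)
    thus False using p by simp
  qed
  have "0 = (\<Sum>i\<le>d. of_int (poly.coeff p i) * x ^ i)"
    using p(1) by (simp add: poly_altdef d_def)
  also have "\<dots> = (\<Sum>i<d. of_int (poly.coeff p i) * x ^ i) + x ^ d"
    using p(2) by (simp add: d_def flip: lessThan_Suc_atMost)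
  finally have "x ^ d = (\<Sum>i<d. of_int (- poly.coeff p i) * x ^ i)"
    by (simp add: sum_negf eq_neg_iff_add_eq_0 add.commute)
  also have "\<dots> \<in> int_module.span ((\<lambda>i. x ^ i) ` {..<d})"
    by (intro int_module.span_sum int_module.span_scale int_module.span_base) auto
  finally show ?thesis using that \<open>d > 0\<close> by blast
qed

lemma span_mult_stable:
  assumes "\<And>v. v \<in> V \<Longrightarrow> x * v \<in> int_module.span V" "u \<in> int_module.span V"
  shows "x * u \<in> int_module.span V"
  using assms(2)
proof (induction rule: int_module.span_induct_alt)
  case (step c v u)
  have "x * (of_int c * v + u) = of_int c * (x * v) + x * u" by (simp add: algebra_simps)
  thus ?case using step assms(1) by (auto intro: int_module.span_add int_module.span_scale)
qed (simp add: int_module.span_zero)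

text \<open>Raising the exponent of \<open>x\<close> leaves the generating set only at
  \<open>i = d - 1\<close>; there the relation for \<open>x ^ d\<close> rewrites the result by lower
  powers, all carrying the same factor \<open>y ^ j\<close>.\<close>

lemma mult_stabilizes_power_products:
  assumes "x ^ d \<in> int_module.span ((\<lambda>i. x ^ i) ` {..<d})"
    and "v \<in> (\<lambda>(i, j). x ^ i * y ^ j) ` ({..<d} \<times> {..<e})"
  shows "x * v \<in> int_module.span ((\<lambda>(i, j). x ^ i * y ^ j) ` ({..<d} \<times> {..<e}))"
proof -
  define V where "V = (\<lambda>(i, j). x ^ i * y ^ j) ` ({..<d} \<times> {..<e})"
  from assms(2) obtain i j where ij: "v = x ^ i * y ^ j" "i < d" "j < e" by auto
  have mem: "x ^ i * y ^ j \<in> V" if "i < d" for i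
    unfolding V_def using that ij(3) by (intro image_eqI[of _ _ "(i, j)"]) auto
  show ?thesis unfolding V_def[symmetric]
  proof (cases "Suc i < d")
    case True
    thus "x * v \<in> int_module.span V" using int_module.span_base[OF mem[of "Suc i"]] ij by (simp add: mult.assoc)
  next
    case False
    hence "Suc i = d" using ij by simp
    moreover have "y ^ j * u \<in> int_module.span V" if "u \<in> int_module.span ((\<lambda>i. x ^ i) ` {..<d})" for u
      using that
    proof (induction rule: int_module.span_induct_alt)
      case (step c v u)
      have "y ^ j * (of_int c * v + u) = of_int c * (v * y ^ j) + y ^ j * u" by (simp add: algebra_simps)
      moreover have "v * y ^ j \<in> V" using step(1) mem by auto
      ultimately show ?case using step(2)
        by (metis int_module.span_add int_module.span_scale int_module.span_base)
    qed (simp add: int_module.span_zero)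
    ultimately show "x * v \<in> int_module.span V" using assms(1) ij(1) by (metis mult.assoc mult.commute power_Suc)
  qed
qed

text \<open>The module generated by the products \<open>x ^ i * y ^ j\<close> with bounded exponents
  is stable under \<open>x\<close> and \<open>y\<close>, hence under their sum and product, and it
  contains 1.\<close>

lemma
  fixes x y :: complex
  assumes "algebraic_int x" "algebraic_int y"
  shows algebraic_int_add: "algebraic_int (x + y)" and algebraic_int_mult: "algebraic_int (x * y)"
proof -
  obtain d where d: "d > 0" "x ^ d \<in> int_module.span ((\<lambda>i. x ^ i) ` {..<d})"
    using algebraic_int_power_in_span[OF assms(1)] .
  obtain e where e: "e > 0" "y ^ e \<in> int_module.span ((\<lambda>i. y ^ i) ` {..<e})"
    using algebraic_int_power_in_span[OF assms(2)] .
  define V where "V = (\<lambda>(i, j). x ^ i * y ^ j) ` ({..<d} \<times> {..<e})"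
  have V': "V = (\<lambda>(j, i). y ^ j * x ^ i) ` ({..<e} \<times> {..<d})"
    unfolding V_def by (force simp: mult.commute)
  have V: "finite V" by (simp add: V_def)
  have 1: "1 \<in> V" unfolding V_def using d e by (intro image_eqI[of _ _ "(0, 0)"]) auto
  have x: "x * v \<in> int_module.span V" if "v \<in> V" for v
    using mult_stabilizes_power_products[OF d(2)] that unfolding V_def by blast
  have y: "y * v \<in> int_module.span V" if "v \<in> V" for v
    using mult_stabilizes_power_products[OF e(2)] that unfolding V' by blast
  show "algebraic_int (x + y)"
    using V 1 by (rule algebraic_int_if_stabilizes_span)
      (auto simp: distrib_right intro: int_module.span_add x y)
  show "algebraic_int (x * y)"
    using V 1 by (rule algebraic_int_if_stabilizes_span)
      (auto simp: mult.assoc intro: span_mult_stable x y)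
qed

lemma algebraic_int_sum: "(\<And>a. a \<in> A \<Longrightarrow> algebraic_int (f a)) \<Longrightarrow> algebraic_int (\<Sum>a\<in>A. f a :: complex)"
  by (induction A rule: infinite_finite_induct) (auto intro: algebraic_int_add)

lemma algebraic_int_prod: "(\<And>a. a \<in> A \<Longrightarrow> algebraic_int (f a)) \<Longrightarrow> algebraic_int (\<Prod>a\<in>A. f a :: complex)"
  by (induction A rule: infinite_finite_induct) (auto intro: algebraic_int_mult)

lemma algebraic_int_power: "algebraic_int x \<Longrightarrow> algebraic_int (x ^ k :: complex)"
  by (induction k) (auto intro: algebraic_int_mult)

lemma algebraic_int_if_power: 
  assumes "algebraic_int (x ^ k :: complex)" "k > 0" shows "algebraic_int x"
  by (rule algebraic_int_root[OF assms(1), of "Polynomial.monom 1 k"])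
    (use assms(2) in \<open>auto simp: poly_monom degree_monom_eq\<close>)

section \<open>Simple extensions of the rationals\<close>

interpretation of_rat_poly: map_poly_comm_ring_hom "of_rat :: rat \<Rightarrow> complex" ..

definition evq :: "rat poly \<Rightarrow> complex \<Rightarrow> complex" where
  "evq p z = poly (map_poly of_rat p) z"

lemma evq_simps [simp]:
  "evq 0 z = 0" "evq 1 z = 1" "evq (p + q) z = evq p z + evq q z"
  "evq (p - q) z = evq p z - evq q z" "evq (- p) z = - evq p z"
  "evq (p * q) z = evq p z * evq q z" "evq [:c:] z = of_rat c"
  "evq (Polynomial.monom c k) z = of_rat c * z ^ k" "evq (p ^ k) z = evq p z ^ k"
  "evq (p \<circ>\<^sub>p q) z = evq p (evq q z)" "evq (pCons c p) z = of_rat c + z * evq p z"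
  by (simp_all add: evq_def of_rat_hom.map_poly_pcompose poly_pcompose poly_monom hom_distribs of_rat_poly.hom_mult of_rat_poly.hom_minus of_rat_poly.hom_uminus of_rat_poly.hom_power)

lemma complex_ring_simps [simp]:
  "carrier complex_ring = UNIV" "monoid.mult complex_ring = (*)" "\<one>\<^bsub>complex_ring\<^esub> = 1"
  "\<zero>\<^bsub>complex_ring\<^esub> = 0" "add complex_ring = (+)"
  by (simp_all add: ring_of_type_algebra_def fun_eq_iff)

lemma field_complex_ring: "field complex_ring"
  by (rule field_from_type_algebra)

lemma complex_ring_inverses [simp]:
  "\<ominus>\<^bsub>complex_ring\<^esub> x = - x" "x \<noteq> 0 \<Longrightarrow> inv\<^bsub>complex_ring\<^esub> x = inverse x"
proof -
  interpret complex: cring complex_ring by (rule cring_from_type_algebra)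
  show "\<ominus>\<^bsub>complex_ring\<^esub> x = - x"
    using complex.minus_equality[of "-x" x] by simp
  show "inv\<^bsub>complex_ring\<^esub> x = inverse x" if "x \<noteq> 0"
    using complex.inv_unique'[of x "inverse x"] that by simp
qed

text \<open>Division with remainder shows that an annihilating polynomial \<open>f\<close> of least
  degree divides all others. For the last clause let \<open>g = gcd p f\<close>. If \<open>p\<close>
  does not vanish at \<open>z\<close>, then neither does \<open>g\<close>, so the cofactor of
  \<open>g\<close> in \<open>f\<close> does, and minimality makes \<open>g\<close> constant; Bezout
  yields the inverse.\<close>

lemma rational_minimal_polynomial:
  assumes "p0 \<noteq> 0" "evq p0 z = 0"
  obtains f where "f \<noteq> 0" "evq f z = 0" "\<And>p. evq p z = 0 \<Longrightarrow> f dvd p"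
    "\<And>p. evq p z \<noteq> 0 \<Longrightarrow> \<exists>r. evq r z * evq p z = 1"
proof -
  define f where "f = (ARG_MIN Polynomial.degree p. p \<noteq> 0 \<and> evq p z = 0)"
  have f: "f \<noteq> 0" "evq f z = 0" "p \<noteq> 0 \<Longrightarrow> evq p z = 0 \<Longrightarrow> Polynomial.degree f \<le> Polynomial.degree p" for p
    using arg_min_nat_lemma[of "\<lambda>p. p \<noteq> 0 \<and> evq p z = 0" p0 Polynomial.degree] assms
    unfolding f_def by auto
  have dvd: "f dvd p" if "evq p z = 0" for p
  proof -
    have "evq (p div f * f + p mod f) z = 0" using that by simp
    hence "evq (p mod f) z = 0" by (simp only: evq_simps f) simp
    hence "p mod f = 0" using f(3)[of "p mod f"] degree_mod_less'[of f p] f(1) by fastforce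
    thus ?thesis by (simp add: mod_eq_0_iff_dvd)
  qed
  have inv: "\<exists>r. evq r z * evq p z = 1" if p: "evq p z \<noteq> 0" for p
  proof -
    define g where "g = gcd p f"
    have "g dvd p" "g dvd f" by (auto simp: g_def)
    then obtain u v where uv: "p = g * u" "f = g * v" by (auto elim!: dvdE)
    have gz: "evq g z \<noteq> 0" using p uv by auto
    hence "evq v z = 0" using f(2) uv by auto
    moreover have "v \<noteq> 0" using uv f(1) by auto
    ultimately have "Polynomial.degree f \<le> Polynomial.degree v" using f(3) by auto
    hence "Polynomial.degree g = 0" using uv f(1) by (auto simp: degree_mult_eq)
    then obtain c where c: "g = [:c:]" using degree_eq_zeroE by blast
    hence c0: "of_rat c \<noteq> (0::complex)" using gz by simp
    have "evq (fst (bezout_coefficients p f) * p + snd (bezout_coefficients p f) * f) z = evq g z"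
      unfolding bezout_coefficients_fst_snd g_def ..
    hence "evq (fst (bezout_coefficients p f)) z * evq p z = of_rat c"
      by (simp only: evq_simps f c) simp
    hence "evq ([:inverse c:] * fst (bezout_coefficients p f)) z * evq p z = 1"
      using c0 by (simp only: evq_simps mult.assoc) (simp add: of_rat_inverse)
    thus ?thesis by blast
  qed
  show ?thesis using that[OF f(1,2) dvd inv] by blast
qed

text \<open>For algebraic \<open>z\<close> the polynomial values are already closed under inverses,
  so they exhaust the generated field.\<close>

lemma adjoin_Q_eq_range_evq:
  assumes "p0 \<noteq> 0" "evq p0 z = 0"
  shows "adjoin_Q z = range (\<lambda>p. evq p z)"
proof
  have f: "\<exists>r. evq r z * evq p z = 1" if "evq p z \<noteq> 0" for p
    by (rule rational_minimal_polynomial[OF assms]) (use that in blast)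
  show "adjoin_Q z \<subseteq> range (\<lambda>p. evq p z)"
  proof
    fix x assume "x \<in> adjoin_Q z"
    thus "x \<in> range (\<lambda>p. evq p z)"
      unfolding adjoin_Q_def
    proof (induction rule: generate_field.induct)
      case one
      show ?case using evq_simps(2) by (auto intro: range_eqI[of _ _ 1])
    next
      case (incl h)
      thus ?case
      proof
        assume "h \<in> \<rat>"
        then obtain c where "h = of_rat c" by (auto elim: Rats_cases)
        thus ?case by (intro range_eqI[of _ _ "[:c:]"]) simp
      next
        assume "h \<in> {z}"
        thus ?case by (intro range_eqI[of _ _ "[:0,1:]"]) simp
      qed
    next
      case (a_inv h)
      then obtain p where "h = evq p z" by auto
      thus ?case by (intro range_eqI[of _ _ "-p"]) simp
    next
      case (m_inv h)
      then obtain p where p: "h = evq p z" by auto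
      have h: "h \<noteq> 0" using m_inv by simp
      then obtain r where "evq r z * h = 1" using f p by blast
      thus ?case using h by (intro range_eqI[of _ _ r]) (simp add: field_simps)
    next
      case (eng_add h1 h2)
      then obtain p r where "h1 = evq p z" "h2 = evq r z" by auto
      thus ?case by (intro range_eqI[of _ _ "p + r"]) simp
    next
      case (eng_mult h1 h2)
      then obtain p r where "h1 = evq p z" "h2 = evq r z" by auto
      thus ?case by (intro range_eqI[of _ _ "p * r"]) simp
    qed
  qed
  have "evq p z \<in> adjoin_Q z" for p
  proof (induction p)
    case 0
    show ?case using field.zero_in_generate[OF field_complex_ring] by (simp add: adjoin_Q_def)
  next
    case (pCons a p)
    have 1: "of_rat a \<in> adjoin_Q z" "z \<in> adjoin_Q z"
      unfolding adjoin_Q_def by (auto intro: generate_field.incl)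
    have 2: "z * evq p z \<in> adjoin_Q z"
      using generate_field.eng_mult[OF 1(2)[unfolded adjoin_Q_def] pCons(2)[unfolded adjoin_Q_def]]
      by (simp add: adjoin_Q_def)
    show ?case
      using generate_field.eng_add[OF 1(1)[unfolded adjoin_Q_def] 2[unfolded adjoin_Q_def]]
      by (simp add: adjoin_Q_def)
  qed
  thus "range (\<lambda>p. evq p z) \<subseteq> adjoin_Q z" by auto
qed

lemma adjoin_Q_closed:
  shows "x \<in> adjoin_Q z \<Longrightarrow> y \<in> adjoin_Q z \<Longrightarrow> x + y \<in> adjoin_Q z"
    and "x \<in> adjoin_Q z \<Longrightarrow> y \<in> adjoin_Q z \<Longrightarrow> x * y \<in> adjoin_Q z"
    and "x \<in> adjoin_Q z \<Longrightarrow> - x \<in> adjoin_Q z"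
    and "x \<in> adjoin_Q z \<Longrightarrow> inverse x \<in> adjoin_Q z"
    and "x \<in> \<rat> \<Longrightarrow> x \<in> adjoin_Q z"
    and "z \<in> adjoin_Q z"
proof -
  show "x \<in> adjoin_Q z \<Longrightarrow> y \<in> adjoin_Q z \<Longrightarrow> x + y \<in> adjoin_Q z"
    unfolding adjoin_Q_def by (drule (1) generate_field.eng_add) simp
  show "x \<in> adjoin_Q z \<Longrightarrow> y \<in> adjoin_Q z \<Longrightarrow> x * y \<in> adjoin_Q z"
    unfolding adjoin_Q_def by (drule (1) generate_field.eng_mult) simp
  show "x \<in> adjoin_Q z \<Longrightarrow> - x \<in> adjoin_Q z"
    unfolding adjoin_Q_def by (drule generate_field.a_inv) simp
  show "x \<in> adjoin_Q z \<Longrightarrow> inverse x \<in> adjoin_Q z"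
    unfolding adjoin_Q_def by (cases "x = 0") (auto dest: generate_field.m_inv)
  show "x \<in> \<rat> \<Longrightarrow> x \<in> adjoin_Q z" "z \<in> adjoin_Q z"
    unfolding adjoin_Q_def by (auto intro: generate_field.incl)
qed

section \<open>Galois theory of cyclotomic fields\<close>

locale cyclotomic =
  fixes n :: nat
  assumes n_gt_2: "n > 2"
begin

definition \<zeta> :: complex where "\<zeta> = cis (2 * pi / real n)"

definition K :: "complex set" where "K = cyclotomic_field n"

text \<open>The Galois group is represented by the exponents \<open>a\<close> for which \<open>\<zeta> \<mapsto> \<zeta>\<^sup>a\<close> extends to an
  automorphism \<open>gal a\<close> of \<open>K\<close>. Outside \<open>K\<close> the function \<open>gal a\<close> has no meaning.\<close>

definition G :: "nat set" where "G = {a. a < n \<and> (\<forall>p. evq p \<zeta> = 0 \<longrightarrow> evq p (\<zeta> ^ a) = 0)}"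

definition gal :: "nat \<Rightarrow> complex \<Rightarrow> complex" where "gal a x = evq (SOME p. evq p \<zeta> = x) (\<zeta> ^ a)"

lemma \<zeta>_power: "\<zeta> ^ k = cis (2 * pi * real k / real n)"
  by (simp add: \<zeta>_def DeMoivre field_simps)

lemma \<zeta>_power_n [simp]: "\<zeta> ^ n = 1"
  using n_gt_2 by (simp add: \<zeta>_power)

lemma \<zeta>_power_mod [simp]: "\<zeta> ^ (k mod n) = \<zeta> ^ k"
proof -
  have "\<zeta> ^ k = \<zeta> ^ (n * (k div n) + k mod n)" by simp
  also have "\<dots> = \<zeta> ^ (k mod n)" by (simp only: power_add power_mult) simp
  finally show ?thesis by simp
qed

lemma \<zeta>_power_eq_iff: "\<zeta> ^ a = \<zeta> ^ b \<longleftrightarrow> a mod n = b mod n"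
proof
  assume "\<zeta> ^ a = \<zeta> ^ b"
  hence "\<zeta> ^ (a mod n) = \<zeta> ^ (b mod n)" by simp
  moreover have "inj_on (\<lambda>k. \<zeta> ^ k) {..<n}"
    using bij_betw_roots_unity[of n] n_gt_2 by (simp add: \<zeta>_power bij_betw_def)
  ultimately show "a mod n = b mod n" using n_gt_2 by (elim inj_onD) auto
next
  assume "a mod n = b mod n"
  thus "\<zeta> ^ a = \<zeta> ^ b" using \<zeta>_power_mod by metis
qed

lemma roots_of_unity: "w ^ n = 1 \<Longrightarrow> \<exists>a<n. w = \<zeta> ^ a"
  using bij_betw_roots_unity[of n] n_gt_2 by (auto simp: \<zeta>_power bij_betw_def)

lemma \<zeta>_nonzero [simp]: "\<zeta> \<noteq> 0" by (simp add: \<zeta>_def)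

lemma algebraic_int_\<zeta>: "algebraic_int \<zeta>"
  by (rule algebraic_int_if_power[of _ n]) (use n_gt_2 in auto)

lemma \<zeta>_annihilated: "Polynomial.monom 1 n - 1 \<noteq> (0 :: rat poly)" "evq (Polynomial.monom 1 n - 1) \<zeta> = 0"
proof -
  have "poly.coeff (Polynomial.monom 1 n - 1 :: rat poly) n = 1" using n_gt_2 by simp
  thus "Polynomial.monom 1 n - 1 \<noteq> (0 :: rat poly)" by (metis coeff_0 zero_neq_one)
qed simp

lemma K_eq: "K = range (\<lambda>p. evq p \<zeta>)"
  unfolding K_def cyclotomic_field_def \<zeta>_def[symmetric] 
  by (rule adjoin_Q_eq_range_evq[OF \<zeta>_annihilated])

lemma K_closed:
  "x \<in> K \<Longrightarrow> y \<in> K \<Longrightarrow> x + y \<in> K" "x \<in> K \<Longrightarrow> y \<in> K \<Longrightarrow> x * y \<in> K" "x \<in> K \<Longrightarrow> - x \<in> K"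
  "x \<in> K \<Longrightarrow> inverse x \<in> K" "x \<in> \<rat> \<Longrightarrow> x \<in> K" "\<zeta> \<in> K"
  unfolding K_def cyclotomic_field_def \<zeta>_def by (rule adjoin_Q_closed; assumption)+

lemma K_closed': "x \<in> K \<Longrightarrow> y \<in> K \<Longrightarrow> x - y \<in> K" "x \<in> K \<Longrightarrow> x ^ k \<in> K"
  "(\<And>i. i \<in> A \<Longrightarrow> f i \<in> K) \<Longrightarrow> sum f A \<in> K" "(\<And>i. i \<in> A \<Longrightarrow> f i \<in> K) \<Longrightarrow> prod f A \<in> K"
proof -
  show "x \<in> K \<Longrightarrow> y \<in> K \<Longrightarrow> x - y \<in> K" using K_closed(1)[of x "-y"] K_closed(3) by simp
  show "x \<in> K \<Longrightarrow> x ^ k \<in> K" by (induction k) (auto intro: K_closed)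
  show "(\<And>i. i \<in> A \<Longrightarrow> f i \<in> K) \<Longrightarrow> sum f A \<in> K"
    by (induction A rule: infinite_finite_induct) (auto intro: K_closed)
  show "(\<And>i. i \<in> A \<Longrightarrow> f i \<in> K) \<Longrightarrow> prod f A \<in> K"
    by (induction A rule: infinite_finite_induct) (auto intro: K_closed)
qed

lemma finite_G: "finite G" by (simp add: G_def)

lemma one_in_G: "1 \<in> G" using n_gt_2 by (simp add: G_def)

lemma gal_evq: 
  assumes "a \<in> G" shows "gal a (evq p \<zeta>) = evq p (\<zeta> ^ a)"
proof -
  define r where "r = (SOME r. evq r \<zeta> = evq p \<zeta>)"
  have "evq r \<zeta> = evq p \<zeta>" unfolding r_def by (rule someI) simp
  hence "evq (r - p) \<zeta> = 0" by simp
  hence "evq (r - p) (\<zeta> ^ a) = 0" using assms G_def by blast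
  thus ?thesis by (simp add: gal_def r_def)
qed

lemma
  assumes "a \<in> G" "x \<in> K"
  shows gal_closed: "gal a x \<in> K" and gal_minus: "gal a (- x) = - gal a x"
    and gal_power: "gal a (x ^ k) = gal a x ^ k"
    and gal_add: "y \<in> K \<Longrightarrow> gal a (x + y) = gal a x + gal a y"
    and gal_mult: "y \<in> K \<Longrightarrow> gal a (x * y) = gal a x * gal a y"
proof -
  obtain p where p: "x = evq p \<zeta>" using assms K_eq by auto
  have "evq p (\<zeta> ^ a) = evq (p \<circ>\<^sub>p Polynomial.monom 1 a) \<zeta>" by simp
  thus "gal a x \<in> K" unfolding p gal_evq[OF assms(1)] K_eq by (metis rangeI)
  show "gal a (- x) = - gal a x" using gal_evq[OF assms(1), of "-p"] gal_evq[OF assms(1), of p] p by simp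
  show "gal a (x ^ k) = gal a x ^ k" using gal_evq[OF assms(1), of "p^k"] gal_evq[OF assms(1), of p] p by simp
  show "gal a (x + y) = gal a x + gal a y" if "y \<in> K"
  proof -
    obtain r where "y = evq r \<zeta>" using \<open>y \<in> K\<close> unfolding K_eq by blast
    thus ?thesis using gal_evq[OF assms(1), of "p+r"] gal_evq[OF assms(1), of p] gal_evq[OF assms(1), of r] p by simp
  qed
  show "gal a (x * y) = gal a x * gal a y" if "y \<in> K"
  proof -
    obtain r where "y = evq r \<zeta>" using \<open>y \<in> K\<close> unfolding K_eq by blast
    thus ?thesis using gal_evq[OF assms(1), of "p*r"] gal_evq[OF assms(1), of p] gal_evq[OF assms(1), of r] p by simp
  qed
qed

lemma gal_rat: "a \<in> G \<Longrightarrow> x \<in> \<rat> \<Longrightarrow> gal a x = x"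
  using gal_evq[of a "[:_:]"] by (auto elim!: Rats_cases)

lemma gal_\<zeta>: "a \<in> G \<Longrightarrow> gal a \<zeta> = \<zeta> ^ a"
  using gal_evq[of a "[:0,1:]"] by simp

lemma gal_diff: "a \<in> G \<Longrightarrow> x \<in> K \<Longrightarrow> y \<in> K \<Longrightarrow> gal a (x - y) = gal a x - gal a y"
  using gal_add[of a x "-y"] gal_minus[of a y] K_closed(3) by simp

lemma gal_sum: "a \<in> G \<Longrightarrow> (\<And>i. i \<in> A \<Longrightarrow> f i \<in> K) \<Longrightarrow> gal a (sum f A) = (\<Sum>i\<in>A. gal a (f i))"
  by (induction A rule: infinite_finite_induct) (simp_all add: gal_rat gal_add K_closed'(3))

lemma gal_prod: "a \<in> G \<Longrightarrow> (\<And>i. i \<in> A \<Longrightarrow> f i \<in> K) \<Longrightarrow> gal a (prod f A) = (\<Prod>i\<in>A. gal a (f i))"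
  by (induction A rule: infinite_finite_induct) (simp_all add: gal_rat gal_mult K_closed'(4))

lemma gal_one: "x \<in> K \<Longrightarrow> gal 1 x = x"
  using gal_evq[OF one_in_G] by (auto simp: K_eq)

lemma gal_eq_0_iff: 
  assumes "a \<in> G" "x \<in> K" shows "gal a x = 0 \<longleftrightarrow> x = 0"
proof
  assume "gal a x = 0"
  hence "gal a (x * inverse x) = 0" using gal_mult K_closed assms by simp
  thus "x = 0" using gal_rat[OF assms(1), of 1] by (cases "x = 0") auto
qed (use gal_rat assms in auto)

lemma gal_inj: "a \<in> G \<Longrightarrow> x \<in> K \<Longrightarrow> y \<in> K \<Longrightarrow> gal a x = gal a y \<Longrightarrow> x = y"
  using gal_eq_0_iff[of a "x - y"] gal_diff[of a x y] K_closed'(1) by simp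

lemma gal_inverse: "a \<in> G \<Longrightarrow> x \<in> K \<Longrightarrow> gal a (inverse x) = inverse (gal a x)"
proof (cases "x = 0")
  case False
  assume a: "a \<in> G" "x \<in> K"
  hence "gal a x * gal a (inverse x) = 1"
    using gal_mult[of a x "inverse x"] gal_rat[of a 1] False K_closed by simp
  thus ?thesis by (simp add: inverse_unique)
qed (simp add: gal_rat)

lemma gal_algebraic_int:
  assumes "a \<in> G" "x \<in> K" "algebraic_int x" shows "algebraic_int (gal a x)"
proof -
  obtain p where p: "poly (map_poly of_int p) x = 0" "lead_coeff p = 1"
    using assms(3) unfolding algebraic_int_altdef_ipoly by blast
  have "poly (map_poly of_int p) (gal a x) = gal a (poly (map_poly of_int p) x)"
    by (simp add: poly_altdef gal_sum gal_mult gal_power gal_rat assms K_closed K_closed')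
  thus ?thesis using p gal_rat[OF assms(1)] unfolding algebraic_int_altdef_ipoly by auto
qed

lemma G_mult: "a \<in> G \<Longrightarrow> b \<in> G \<Longrightarrow> a * b mod n \<in> G"
proof -
  assume ab: "a \<in> G" "b \<in> G"
  have "evq p (\<zeta> ^ (a * b mod n)) = 0" if "evq p \<zeta> = 0" for p
  proof -
    have "evq (p \<circ>\<^sub>p Polynomial.monom 1 b) \<zeta> = 0" using ab that by (simp add: G_def)
    hence "evq (p \<circ>\<^sub>p Polynomial.monom 1 b) (\<zeta> ^ a) = 0" using ab(1) unfolding G_def by blast
    thus ?thesis by (simp add: power_mult)
  qed
  thus ?thesis using n_gt_2 by (simp add: G_def)
qed

lemma gal_gal: 
  assumes "a \<in> G" "b \<in> G" "x \<in> K" shows "gal a (gal b x) = gal (a * b mod n) x"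
proof -
  obtain p where p: "x = evq p \<zeta>" using assms K_eq by auto
  have "gal b x = evq (p \<circ>\<^sub>p Polynomial.monom 1 b) \<zeta>" using gal_evq[OF assms(2)] p by simp
  hence "gal a (gal b x) = evq p (\<zeta> ^ (a * b))" using gal_evq[OF assms(1), of "p \<circ>\<^sub>p Polynomial.monom 1 b"]
    by (simp add: power_mult)
  thus ?thesis using gal_evq[OF G_mult[OF assms(1,2)]] p by simp
qed

text \<open>Injectivity comes from that of \<open>gal b\<close> on the powers of
  \<open>\<zeta>\<close>, surjectivity from finiteness. This supplies inverses in \<open>G\<close>
  and reindexes sums and products over \<open>G\<close>.\<close>

lemma bij_betw_G: 
  assumes "b \<in> G" shows "bij_betw (\<lambda>a. a * b mod n) G G"
proof -
  have inj: "inj_on (\<lambda>a. a * b mod n) G"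
  proof (rule inj_onI)
    fix x y assume xy: "x \<in> G" "y \<in> G" "x * b mod n = y * b mod n"
    hence "gal b (\<zeta> ^ x) = gal b (\<zeta> ^ y)"
      using gal_power[OF assms K_closed(6)] by (simp add: gal_\<zeta> assms \<zeta>_power_eq_iff mult.commute flip: power_mult)
    hence "\<zeta> ^ x = \<zeta> ^ y" 
      by (rule gal_inj[OF assms K_closed'(2)[OF K_closed(6)] K_closed'(2)[OF K_closed(6)]])
    thus "x = y" using xy(1,2) by (simp add: \<zeta>_power_eq_iff G_def)
  qed
  have "(\<lambda>a. a * b mod n) ` G = G"
    by (rule endo_inj_surj[OF finite_G _ inj]) (blast intro: G_mult assms)
  thus ?thesis using inj by (simp add: bij_betw_def)
qed

lemma cnj_\<zeta>: "cnj \<zeta> = \<zeta> ^ (n - 1)"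
proof -
  have "\<zeta> * cnj \<zeta> = 1" by (simp add: \<zeta>_def cis_cnj cis_mult)
  moreover have "\<zeta> * \<zeta> ^ (n - 1) = 1" using n_gt_2 by (metis \<zeta>_power_n power_minus_mult mult.commute less_trans zero_less_numeral)
  ultimately show ?thesis by (metis \<zeta>_nonzero mult_cancel_left)
qed

lemma cnj_evq: "cnj (evq p z) = evq p (cnj z)"
proof (induction p)
  case (pCons c p)
  have "cnj (complex_of_rat c) = complex_of_rat c" by (cases c) (simp add: of_rat_rat)
  thus ?case using pCons by simp
qed simp

lemma minus_one_in_G: "n - 1 \<in> G"
  using n_gt_2 unfolding G_def by (auto simp: cnj_\<zeta>[symmetric] cnj_evq[symmetric] simp del: One_nat_def)

lemma gal_minus_one: "x \<in> K \<Longrightarrow> gal (n - 1) x = cnj x"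
  using gal_evq[OF minus_one_in_G] by (auto simp: K_eq cnj_\<zeta> cnj_evq)

text \<open>The minimal polynomial of \<open>\<zeta>\<close> divides \<open>X^n - 1\<close>, so it
  has as many distinct roots as its degree, and all of them are powers \<open>\<zeta> ^ a\<close>
  with \<open>a \<in> G\<close>. Write \<open>x\<close> as the value at \<open>\<zeta>\<close> of a
  polynomial \<open>r\<close> of smaller degree. Then \<open>r - x\<close> vanishes at all these
  roots, hence is zero, and \<open>x\<close> is the constant coefficient of
  \<open>r\<close>.\<close>

lemma fixed_field:
  assumes "x \<in> K" "\<And>a. a \<in> G \<Longrightarrow> gal a x = x"
  shows "x \<in> \<rat>"
proof -
  obtain f where f: "f \<noteq> 0" "evq f \<zeta> = 0" "\<And>p. evq p \<zeta> = 0 \<Longrightarrow> f dvd p"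
    using rational_minimal_polynomial[OF \<zeta>_annihilated] by metis
  define F where "F = map_poly complex_of_rat f"
  have F0: "F \<noteq> 0" using f by (simp add: F_def)
  obtain h where h: "Polynomial.monom 1 n - 1 = f * h" using f(3)[OF \<zeta>_annihilated(2)] by (auto elim: dvdE)
  have "map_poly complex_of_rat (Polynomial.monom 1 n - 1) = F * map_poly complex_of_rat h"
    unfolding h F_def by (rule of_rat_poly.hom_mult)
  hence FH: "Polynomial.monom 1 n - 1 = F * map_poly complex_of_rat h"
    by (simp add: of_rat_poly.hom_minus)
  \<comment> \<open>A double root of the factor \<open>F\<close> would be a common root of
    \<open>X^n - 1\<close> and its derivative.\<close>
  have "rsquarefree F"
    unfolding rsquarefree_roots
  proof (intro allI notI, elim conjE)
    fix a assume a: "poly F a = 0" "poly (pderiv F) a = 0"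
    have "poly (Polynomial.monom 1 n - 1) a = 0" unfolding FH using a by simp
    moreover have "poly (pderiv (Polynomial.monom 1 n - 1)) a = 0"
      unfolding FH using a by (simp add: pderiv_mult)
    ultimately show False using n_gt_2 by (auto simp: pderiv_diff pderiv_monom poly_monom power_0_left)
  qed
  hence card: "card {w. poly F w = 0} = Polynomial.degree F" using rsquarefree_card_degree[OF F0] by simp
  have roots: "{w. poly F w = 0} \<subseteq> (\<lambda>a. \<zeta> ^ a) ` G"
  proof
    fix w assume "w \<in> {w. poly F w = 0}"
    hence w: "evq f w = 0" by (simp add: evq_def F_def)
    hence "evq (f * h) w = 0" by simp
    hence "w ^ n = 1" by (simp flip: h)
    then obtain a where a: "a < n" "w = \<zeta> ^ a" using roots_of_unity by blast
    have "evq p w = 0" if p: "evq p \<zeta> = 0" for p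
    proof -
      obtain k where "p = f * k" using f(3)[OF p] by (auto elim: dvdE)
      thus ?thesis using w by simp
    qed
    thus "w \<in> (\<lambda>a. \<zeta> ^ a) ` G" using a by (auto simp: G_def)
  qed
  obtain p where p: "x = evq p \<zeta>" using assms K_eq by auto
  define r where "r = p mod f"
  have "evq (p div f * f + p mod f) \<zeta> = x" using p by simp
  hence r: "evq r \<zeta> = x" unfolding r_def by (simp only: evq_simps f) simp
  have "Polynomial.degree f > 0"
  proof (rule ccontr)
    assume "\<not> ?thesis"
    then obtain c where "f = [:c:]" using degree_eq_zeroE by blast
    thus False using f by simp
  qed
  hence deg: "Polynomial.degree r < Polynomial.degree f"
    using degree_mod_less'[of f p] f(1) by (cases "p mod f = 0") (auto simp: r_def)
  define R where "R = map_poly complex_of_rat r - [:x:]"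
  have R: "poly R w = 0" if "w \<in> (\<lambda>a. \<zeta> ^ a) ` G" for w
    using that assms(2) r gal_evq[of _ r] by (auto simp: R_def evq_def)
  have "R = 0"
  proof (rule ccontr)
    assume R0: "R \<noteq> 0"
    have "Polynomial.degree R \<le> Polynomial.degree r" unfolding R_def 
      by (rule order.trans[OF degree_diff_le_max]) simp
    moreover have "card {w. poly F w = 0} \<le> card {w. poly R w = 0}"
      using R roots by (intro card_mono poly_roots_finite R0) auto
    moreover have "card {w. poly R w = 0} \<le> Polynomial.degree R" using card_poly_roots_bound[OF R0] .
    ultimately show False using card deg by (simp add: F_def)
  qed
  hence "poly.coeff (map_poly complex_of_rat r) 0 = x" by (simp add: R_def)
  thus ?thesis by (simp add: coeff_map_poly) (metis Rats_of_rat)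
qed

end


section \<open>Divisibility of algebraic integers by natural numbers, and subgroups of the units
  modulo n\<close>

text \<open>The inner binomial coefficients are divisible by \<open>q\<close>, which settles two
  summands; the rest is induction. Congruence modulo \<open>q\<close> is stated as integrality of a
  quotient, so that no ring has to be fixed.\<close>

lemma algebraic_int_freshman_dream:
  fixes f :: "'a \<Rightarrow> complex"
  assumes "Factorial_Ring.prime q" "\<And>a. a \<in> A \<Longrightarrow> algebraic_int (f a)"
  shows "algebraic_int (((\<Sum>a\<in>A. f a) ^ q - (\<Sum>a\<in>A. f a ^ q)) / of_nat q)"
proof -
  have q: "q > 0" using assms(1) prime_gt_0_nat by blast
  have two: "algebraic_int (((x + y) ^ q - x ^ q - y ^ q) / of_nat q)"
    if "algebraic_int x" "algebraic_int y" for x y :: complex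
  proof -
    have "(x + y) ^ q = (\<Sum>k\<le>q. of_nat (q choose k) * x ^ k * y ^ (q - k))"
      by (rule binomial_ring)
    also have "{..q} = insert 0 (insert q {0<..<q})" using q by auto
    also have "(\<Sum>k\<in>insert 0 (insert q {0<..<q}). of_nat (q choose k) * x ^ k * y ^ (q - k)) =
        y ^ q + x ^ q + (\<Sum>k\<in>{0<..<q}. of_nat (q choose k) * x ^ k * y ^ (q - k))"
      using q by simp
    also have "(\<Sum>k\<in>{0<..<q}. of_nat (q choose k) * x ^ k * y ^ (q - k)) =
        (\<Sum>k\<in>{0<..<q}. of_nat q * (of_nat ((q choose k) div q) * x ^ k * y ^ (q - k)))"
    proof (rule sum.cong)
      fix k assume "k \<in> {0<..<q}"
      hence "q dvd (q choose k)" using assms(1) by (auto intro!: dvd_choose_prime)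
      hence "(of_nat (q choose k) :: complex) = of_nat q * of_nat ((q choose k) div q)"
        by (metis dvd_mult_div_cancel of_nat_mult)
      thus "of_nat (q choose k) * x ^ k * y ^ (q - k) = of_nat q * (of_nat ((q choose k) div q) * x ^ k * y ^ (q - k))"
        by simp
    qed simp
    finally have "((x + y) ^ q - x ^ q - y ^ q) / of_nat q =
      (\<Sum>k\<in>{0<..<q}. of_nat ((q choose k) div q) * x ^ k * y ^ (q - k))"
      using q by (simp flip: sum_distrib_left)
    thus ?thesis using that
      by (auto intro!: algebraic_int_sum algebraic_int_mult algebraic_int_power)
  qed
  show ?thesis using assms(2)
  proof (induction A rule: infinite_finite_induct)
    case (insert a A)
    have "algebraic_int (((f a + sum f A) ^ q - f a ^ q - sum f A ^ q) / of_nat q)"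
      by (rule two) (use insert in \<open>auto intro: algebraic_int_sum\<close>)
    moreover have "algebraic_int ((sum f A ^ q - (\<Sum>a\<in>A. f a ^ q)) / of_nat q)"
      using insert by auto
    moreover have "((\<Sum>a\<in>insert a A. f a) ^ q - (\<Sum>a\<in>insert a A. f a ^ q)) / of_nat q =
      ((f a + sum f A) ^ q - f a ^ q - sum f A ^ q) / of_nat q + (sum f A ^ q - (\<Sum>a\<in>A. f a ^ q)) / of_nat q"
      using insert by (simp add: diff_divide_distrib add_divide_distrib)
    ultimately show ?case by (metis algebraic_int_add)
  qed (use q in \<open>auto simp: power_0_left\<close>)
qed

text \<open>By Bezout, \<open>x / l\<close> is an integral combination of \<open>k * x / l\<close>
  and \<open>x\<close>.\<close>

lemma algebraic_int_dividend_coprime: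
  assumes "coprime k l" "algebraic_int x" "algebraic_int (of_nat k * x / of_nat l)" "l > 0"
  shows "algebraic_int (x / of_nat l :: complex)"
proof -
  obtain u v where uv: "u * int k + v * int l = 1"
    using assms(1) by (metis bezout_int coprime_iff_gcd_eq_1 gcd_int_int_eq of_nat_1)
  have "x / of_nat l = of_int (u * int k + v * int l) * x / of_nat l" unfolding uv by simp
  also have "\<dots> = of_int u * (of_nat k * x / of_nat l) + of_int v * x"
    using assms(4) by (simp add: field_simps)
  finally have eq: "x / of_nat l = of_int u * (of_nat k * x / of_nat l) + of_int v * x" .
  show ?thesis unfolding eq
    by (intro algebraic_int_add algebraic_int_mult assms algebraic_int_of_int)
qed

text \<open>Lagrange's theorem in the unit group modulo \<open>n\<close>; the inverses inside
  \<open>G\<close> are what make its elements units.\<close>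

lemma card_dvd_totient:
  assumes n_gt_2: "n > 2" and G: "G \<subseteq> {..<n}" "1 \<in> G" "\<And>a b. a \<in> G \<Longrightarrow> b \<in> G \<Longrightarrow> a * b mod n \<in> G"
    and inverse: "\<And>a. a \<in> G \<Longrightarrow> \<exists>b\<in>G. b * a mod n = 1"
  shows "card G dvd totient n"
proof -
  define R where "R = residue_ring (int n)"
  interpret residues "int n" R by unfold_locales (use n_gt_2 in \<open>auto simp: R_def\<close>)
  interpret U: Group.group "units_of R" by (rule units_group)
  have unit: "int a \<in> Units R" if a: "a \<in> G" for a
  proof -
    obtain b where "b \<in> G" "b * a mod n = 1" using inverse[OF a] by blast
    hence "coprime a n"
      by (metis coprime_iff_invertible_nat Cong.cong_def mult.commute n_gt_2 mod_less One_nat_def less_trans one_less_numeral_iff semiring_norm(76))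
    moreover have "a > 0" using a \<open>b * a mod n = 1\<close> by (cases a) auto
    ultimately show ?thesis using a G(1) by (auto simp: res_units_eq)
  qed
  have "subgroup (int ` G) (units_of R)"
  proof (rule U.subgroupI)
    show "int ` G \<subseteq> carrier (units_of R)" using unit by (auto simp: units_of_carrier)
    show "int ` G \<noteq> {}" using G(2) by auto
    have mult: "int a \<otimes>\<^bsub>units_of R\<^esub> int b = int (a * b mod n)" for a b
      by (simp add: units_of_mult res_mult_eq zmod_int)
    show "x \<otimes>\<^bsub>units_of R\<^esub> y \<in> int ` G" if "x \<in> int ` G" "y \<in> int ` G" for x y
      using that G(3) by (auto simp: mult)
    show "inv\<^bsub>units_of R\<^esub> x \<in> int ` G" if x: "x \<in> int ` G" for x
    proof -
      obtain a where a: "a \<in> G" "x = int a" using x by auto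
      obtain b where b: "b \<in> G" "b * a mod n = 1" using inverse[OF a(1)] by blast
      have "int b \<otimes>\<^bsub>units_of R\<^esub> int a = \<one>\<^bsub>units_of R\<^esub>"
        using b by (simp add: mult units_of_one res_one_eq)
      hence "inv\<^bsub>units_of R\<^esub> x = int b"
        using U.inv_equality unit a b by (simp add: units_of_carrier)
      thus ?thesis using b by simp
    qed
  qed
  hence "card (int ` G) dvd Coset.order (units_of R)" by (metis U.lagrange dvd_triv_right)
  thus ?thesis
    using totient_eq by (simp add: Coset.order_def units_of_carrier card_image)
qed

section \<open>Traces, residues modulo natural numbers, and the Gauss sum\<close>

context cyclotomic
begin

lemma K_simps [simp]:
  "x \<in> K \<Longrightarrow> y \<in> K \<Longrightarrow> x + y \<in> K" "x \<in> K \<Longrightarrow> y \<in> K \<Longrightarrow> x - y \<in> K"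
  "x \<in> K \<Longrightarrow> y \<in> K \<Longrightarrow> x * y \<in> K" "x \<in> K \<Longrightarrow> y \<in> K \<Longrightarrow> x / y \<in> K" "x \<in> K \<Longrightarrow> - x \<in> K"
  "x \<in> K \<Longrightarrow> inverse x \<in> K" "x \<in> K \<Longrightarrow> x ^ k \<in> K" "\<zeta> \<in> K"
  unfolding divide_inverse
  by (rule K_closed(1) K_closed'(1) K_closed(2) K_closed(2)[OF _ K_closed(4)] K_closed(3) K_closed(4)
      K_closed'(2) K_closed(6), assumption?, assumption?)+

lemma K_simps' [simp]: "0 \<in> K" "1 \<in> K" "of_nat k \<in> K" "of_int i \<in> K"
  by (rule K_closed(5), simp)+

definition tr :: "complex \<Rightarrow> complex" where "tr x = (\<Sum>a\<in>G. gal a x)"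

lemma gal_tr: "b \<in> G \<Longrightarrow> x \<in> K \<Longrightarrow> gal b (tr x) = tr x"
proof -
  assume b: "b \<in> G" and x: "x \<in> K"
  have "gal b (tr x) = (\<Sum>a\<in>G. gal (a * b mod n) x)"
    unfolding tr_def using b x by (simp add: gal_sum gal_closed gal_gal mult.commute)
  also have "\<dots> = tr x" unfolding tr_def by (rule sum.reindex_bij_betw[OF bij_betw_G[OF b]])
  finally show ?thesis .
qed

lemma tr_in_Rats: "x \<in> K \<Longrightarrow> tr x \<in> \<rat>"
  by (rule fixed_field) (auto simp: gal_tr, auto simp: tr_def intro!: K_closed' gal_closed)

lemma tr_in_Ints: "x \<in> K \<Longrightarrow> algebraic_int x \<Longrightarrow> tr x \<in> \<int>"
  by (rule rational_algebraic_int_is_int[OF _ tr_in_Rats])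
    (auto simp: tr_def intro: algebraic_int_sum gal_algebraic_int)

lemma geometric_sum_root_of_unity: "w ^ n = 1 \<Longrightarrow> (\<Sum>j<n. w ^ j) = (if w = 1 then of_nat n else 0 :: complex)"
  by (auto simp: geometric_sum)

lemma power_n_root: "(\<zeta> ^ k) ^ n = 1"
  by (metis \<zeta>_power_n mult.commute power_mult power_one)

text \<open>Summing over \<open>j\<close> first, all summands of the traces vanish except the one of the identity.
  Hence \<open>n\<close> times an algebraic integer is an integral combination of powers of \<open>\<zeta>\<close>.\<close>

lemma trace_expansion:
  assumes "x \<in> K"
  shows "of_nat n * x = (\<Sum>j<n. tr (x * \<zeta> ^ ((n - 1) * j)) * \<zeta> ^ j)"
proof -
  \<comment> \<open>The exponent \<open>n - 1\<close> stands for -1, so the base is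
    \<open>\<zeta>\<close> to the power \<open>1 - a\<close>, which is 1 only for
    \<open>a = 1\<close>.\<close>
  have inner: "(\<Sum>j<n. (\<zeta> ^ ((n - 1) * a + 1)) ^ j) = (if a = 1 then of_nat n else 0)" if "a \<in> G" for a
  proof -
    have "(n - 1) * a + 1 + a = n * a + 1" using n_gt_2 by (cases n) auto
    hence "\<zeta> ^ ((n - 1) * a + 1) * \<zeta> ^ a = \<zeta> ^ (n * a + 1)"
      by (simp only: power_add[symmetric])
    also have "\<dots> = \<zeta> ^ 1" by (simp add: power_mult)
    finally have "\<zeta> ^ ((n - 1) * a + 1) = 1 \<longleftrightarrow> \<zeta> ^ a = \<zeta> ^ 1"
      by (metis \<zeta>_nonzero mult.right_neutral mult.commute mult_cancel_right power_eq_0_iff)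
    also have "\<dots> \<longleftrightarrow> a = 1" using that n_gt_2 unfolding \<zeta>_power_eq_iff by (simp add: G_def)
    finally show ?thesis
      using geometric_sum_root_of_unity[of "\<zeta> ^ ((n - 1) * a + 1)"] power_n_root by presburger
  qed
  have "(\<Sum>j<n. tr (x * \<zeta> ^ ((n - 1) * j)) * \<zeta> ^ j) =
      (\<Sum>j<n. \<Sum>a\<in>G. gal a x * (\<zeta> ^ ((n - 1) * a + 1)) ^ j)"
  proof (intro sum.cong refl)
    fix j
    have "tr (x * \<zeta> ^ ((n - 1) * j)) * \<zeta> ^ j = (\<Sum>a\<in>G. gal a (x * \<zeta> ^ ((n - 1) * j)) * \<zeta> ^ j)"
      by (simp add: tr_def sum_distrib_right)
    also have "\<dots> = (\<Sum>a\<in>G. gal a x * (\<zeta> ^ ((n - 1) * a + 1)) ^ j)"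
    proof (intro sum.cong refl)
      fix a assume a: "a \<in> G"
      have "gal a (x * \<zeta> ^ ((n - 1) * j)) = gal a x * (\<zeta> ^ a) ^ ((n - 1) * j)"
        using a assms by (simp add: gal_mult gal_power gal_\<zeta>)
      moreover have "(\<zeta> ^ a) ^ ((n - 1) * j) * \<zeta> ^ j = (\<zeta> ^ ((n - 1) * a + 1)) ^ j"
      proof -
        have "a * ((n - 1) * j) + j = ((n - 1) * a + 1) * j" by (simp add: algebra_simps)
        thus ?thesis by (simp only: power_mult[symmetric] power_add[symmetric])
      qed
      ultimately show "gal a (x * \<zeta> ^ ((n - 1) * j)) * \<zeta> ^ j = gal a x * (\<zeta> ^ ((n - 1) * a + 1)) ^ j"
        by (simp only: mult.assoc)
    qed
    finally show "tr (x * \<zeta> ^ ((n - 1) * j)) * \<zeta> ^ j = (\<Sum>a\<in>G. gal a x * (\<zeta> ^ ((n - 1) * a + 1)) ^ j)" .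
  qed
  also have "\<dots> = (\<Sum>a\<in>G. gal a x * (\<Sum>j<n. (\<zeta> ^ ((n - 1) * a + 1)) ^ j))"
    by (subst sum.swap) (simp add: sum_distrib_left)
  also have "\<dots> = (\<Sum>a\<in>G. if a = 1 then gal 1 x * of_nat n else 0)"
    using inner by (intro sum.cong refl) auto
  also have "\<dots> = of_nat n * x"
    using finite_G one_in_G assms gal_one by simp
  finally show ?thesis by simp
qed

text \<open>The integer vector of the traces \<open>tr (x * \<zeta> ^ ((n - 1) * j))\<close> modulo
  \<open>n * N\<close> takes finitely many values, and \<open>S\<close> picks one element for each.
  If two vectors agree, the factor \<open>n\<close> of the modulus cancels against that of the trace
  expansion, and the difference of the elements is \<open>N\<close> times an algebraic integer
  \<open>z\<close>. As a rational multiple of a difference, \<open>z\<close> lies in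
  \<open>M\<close>.\<close>

lemma finite_residues:
  assumes M: "M \<subseteq> K" "\<And>x y. x \<in> M \<Longrightarrow> y \<in> M \<Longrightarrow> x - y \<in> M" "\<And>x c. x \<in> M \<Longrightarrow> c \<in> \<rat> \<Longrightarrow> x * c \<in> M"
    and N: "N > 0"
  obtains S where "finite S" "S \<subseteq> integers_of M"
    "\<And>x. x \<in> integers_of M \<Longrightarrow> \<exists>s\<in>S. \<exists>z\<in>integers_of M. x = s + of_nat N * z"
proof -
  define T where "T x j = (SOME t. tr (x * \<zeta> ^ ((n - 1) * j)) = of_int t)" for x j
  have T: "tr (x * \<zeta> ^ ((n - 1) * j)) = of_int (T x j)" if "x \<in> integers_of M" for x j
  proof -
    have "tr (x * \<zeta> ^ ((n - 1) * j)) \<in> \<int>" using that M(1)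
      by (intro tr_in_Ints) (auto simp: integers_of_def intro!: K_closed(2,6) K_closed'(2) algebraic_int_mult
            algebraic_int_power algebraic_int_\<zeta>)
    then obtain t where "tr (x * \<zeta> ^ ((n - 1) * j)) = of_int t" by (auto elim: Ints_cases)
    thus ?thesis unfolding T_def by (rule someI)
  qed
  define key where "key x = map (\<lambda>j. T x j mod int (n * N)) [0..<n]" for x
  have "key ` integers_of M \<subseteq> {xs. set xs \<subseteq> {0..<int (n * N)} \<and> length xs = n}"
    using N n_gt_2 by (auto simp: key_def)
  hence fin: "finite (key ` integers_of M)" by (rule finite_subset) (rule finite_lists_length_eq, simp)
  define S where "S = inv_into (integers_of M) key ` key ` integers_of M"
  show ?thesis
  proof (rule that)
    show "finite S" using fin by (simp add: S_def)
    show "S \<subseteq> integers_of M" by (auto simp: S_def intro: inv_into_into)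
    fix x assume x: "x \<in> integers_of M"
    define s where "s = inv_into (integers_of M) key (key x)"
    have s: "s \<in> S" "s \<in> integers_of M" "key s = key x"
      using x by (auto simp: S_def s_def intro: inv_into_into f_inv_into_f)
    have "\<exists>u. T x j - T s j = int (n * N) * u" if "j < n" for j
    proof -
      have "key s ! j = key x ! j" using s by simp
      hence "T x j mod int (n * N) = T s j mod int (n * N)" using that by (simp add: key_def)
      thus ?thesis by (metis mod_eq_dvd_iff dvd_def)
    qed
    then obtain u where u: "j < n \<Longrightarrow> T x j - T s j = int (n * N) * u j" for j by metis
    define z where "z = (\<Sum>j<n. of_int (u j) * \<zeta> ^ j)"
    have xs: "x \<in> K" "s \<in> K" using x s M(1) by (auto simp: integers_of_def)
    have "of_nat n * (x - s) = (\<Sum>j<n. of_int (T x j - T s j) * \<zeta> ^ j)"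
      using trace_expansion[OF xs(1)] trace_expansion[OF xs(2)] T x s
      by (simp add: algebra_simps sum_subtractf)
    also have "\<dots> = (\<Sum>j<n. of_nat n * (of_nat N * (of_int (u j) * \<zeta> ^ j)))"
      using u by (intro sum.cong refl) simp
    also have "\<dots> = of_nat n * (of_nat N * z)" by (simp only: z_def sum_distrib_left)
    finally have "x - s = of_nat N * z" using n_gt_2 by (simp only: mult_cancel_left of_nat_eq_0_iff) simp
    hence eq: "x = s + of_nat N * z" by (simp add: algebra_simps)
    hence "z = (x - s) * inverse (of_nat N)" using N by (simp add: field_simps)
    hence "z \<in> M" using M x s by (auto simp: integers_of_def)
    moreover have "algebraic_int z" unfolding z_def
      by (intro algebraic_int_sum algebraic_int_mult algebraic_int_power algebraic_int_\<zeta> algebraic_int_of_int)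
    ultimately show "\<exists>s\<in>S. \<exists>z\<in>integers_of M. x = s + of_nat N * z"
      using eq s by (auto simp: integers_of_def)
  qed
qed

text \<open>If \<open>x\<^sup>2\<close> is divisible by \<open>q\<close>, then so is the \<open>q\<close>-th power of each trace
  \<open>tr (x * \<zeta>\<^sup>k)\<close>, by the freshman's dream.\<close>

lemma integers_mod_prime_reduced:
  assumes q: "Factorial_Ring.prime q" "coprime n q" and x: "x \<in> K" "algebraic_int x" "algebraic_int (x\<^sup>2 / of_nat q)"
  shows "algebraic_int (x / of_nat q)"
proof -
  have q2: "q \<ge> 2" using q prime_ge_2_nat by blast
  have "tr (x * \<zeta> ^ k) / of_nat q \<in> \<int>" for k
  proof -
    define y where "y = x * \<zeta> ^ k"
    have y: "y \<in> K" "algebraic_int y" unfolding y_def using x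
      by (auto intro!: K_closed(2,6) K_closed'(2) algebraic_int_mult algebraic_int_power algebraic_int_\<zeta>)
    have conj: "algebraic_int (gal a y ^ q / of_nat q)" if a: "a \<in> G" for a
    proof -
      have "y\<^sup>2 / of_nat q = x\<^sup>2 / of_nat q * \<zeta> ^ (2 * k)" 
        by (simp add: y_def power_mult_distrib mult.commute flip: power_mult)
      hence "algebraic_int (y\<^sup>2 / of_nat q)"
        using x(3) by (metis algebraic_int_mult algebraic_int_power algebraic_int_\<zeta>)
      moreover have "y\<^sup>2 / of_nat q \<in> K" using y by simp
      ultimately have "algebraic_int (gal a (y\<^sup>2 / of_nat q))" using a gal_algebraic_int by blast
      also have "gal a (y\<^sup>2 / of_nat q) = (gal a y)\<^sup>2 / of_nat q"
        unfolding divide_inverse using a y by (simp add: gal_mult gal_power gal_rat K_closed K_closed')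
      finally have "algebraic_int ((gal a y)\<^sup>2 / of_nat q * gal a y ^ (q - 2))"
        using a y by (intro algebraic_int_mult algebraic_int_power gal_algebraic_int)
      moreover have "(gal a y)\<^sup>2 / of_nat q * gal a y ^ (q - 2) = gal a y ^ q / of_nat q"
        using q2 by (simp only: times_divide_eq_left power_add[symmetric] le_add_diff_inverse)
      ultimately show ?thesis by (simp only:)
    qed
    have tr: "tr y \<in> \<int>" by (rule tr_in_Ints[OF y])
    then obtain t where t: "tr y = of_int t" by (auto elim: Ints_cases)
    \<comment> \<open>The two summands add up to \<open>tr y ^ q / q\<close>: the first is integral
      by the freshman's dream, the second because each conjugate has its \<open>q\<close>-th power
      divisible by \<open>q\<close>.\<close>
    have "algebraic_int ((tr y ^ q - (\<Sum>a\<in>G. gal a y ^ q)) / of_nat q + (\<Sum>a\<in>G. gal a y ^ q / of_nat q))"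
      unfolding tr_def using y conj
      by (intro algebraic_int_add algebraic_int_sum algebraic_int_freshman_dream q gal_algebraic_int)
    also have "(tr y ^ q - (\<Sum>a\<in>G. gal a y ^ q)) / of_nat q + (\<Sum>a\<in>G. gal a y ^ q / of_nat q) = of_int (t ^ q) / of_nat q"
      by (simp add: t diff_divide_distrib sum_divide_distrib)
    finally have "of_int (t ^ q) / of_nat q \<in> (\<int> :: complex set)"
      by (rule rational_algebraic_int_is_int) simp
    then obtain v where "of_int (t ^ q) / of_nat q = (of_int v :: complex)" by (auto elim: Ints_cases)
    hence "(of_int (t ^ q) :: complex) = of_int (int q * v)" using q2 by (simp add: field_simps)
    hence "t ^ q = int q * v" by (simp only: of_int_eq_iff)
    hence "int q dvd t ^ q" by simp
    hence "int q dvd t" using q(1) prime_dvd_power by (metis prime_nat_int_transfer)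
    then obtain w where "t = int q * w" by auto
    hence "tr y / of_nat q = of_int w" using q2 t by simp
    thus ?thesis unfolding y_def by simp
  qed
  hence int: "algebraic_int (tr (x * \<zeta> ^ k) / of_nat q)" for k by (rule int_imp_algebraic_int)
  have "of_nat n * x / of_nat q = (\<Sum>j<n. (tr (x * \<zeta> ^ ((n - 1) * j)) / of_nat q) * \<zeta> ^ j)"
    unfolding trace_expansion[OF x(1)] by (simp add: sum_divide_distrib)
  hence "algebraic_int (of_nat n * x / of_nat q)"
    by (auto intro!: algebraic_int_sum algebraic_int_mult[OF int] algebraic_int_power algebraic_int_\<zeta> simp del: times_divide_eq_left)
  thus ?thesis using algebraic_int_dividend_coprime[OF q(2) x(2)] q2 by simp
qed

lemma bij_betw_mod_shift: "bij_betw (\<lambda>u. (y + u) mod n) {..<n} {..<n}"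
proof -
  have inj: "inj_on (\<lambda>u. (y + u) mod n) {..<n}"
  proof (rule inj_onI)
    fix u v assume "u \<in> {..<n}" "v \<in> {..<n}" "(y + u) mod n = (y + v) mod n"
    thus "u = v" using cong_add_lcancel_nat[of y u v n] cong_less_modulus_unique_nat[of u v n]
      by (auto simp: Cong.cong_def)
  qed
  moreover have "(\<lambda>u. (y + u) mod n) ` {..<n} = {..<n}"
    by (rule endo_inj_surj[OF _ _ inj]) (use n_gt_2 in auto)
  ultimately show ?thesis by (simp add: bij_betw_def)
qed

text \<open>The quadratic Gauss sum \<open>g\<close> has absolute value \<open>\<surd>n\<close>, and it is real because -1 is a
  square modulo \<open>n\<close>.\<close>

lemma sqrt_in_K:
  assumes "odd n" "n dvd i\<^sup>2 + 1"
  shows "complex_of_real (sqrt (real n)) \<in> K"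
proof -
  define g where "g = (\<Sum>x<n. \<zeta> ^ (x\<^sup>2))"
  have gK: "g \<in> K" unfolding g_def by (intro K_closed' K_closed)
  have sq_mod: "\<zeta> ^ ((x mod n)\<^sup>2) = \<zeta> ^ (x\<^sup>2)" for x
    unfolding \<zeta>_power_eq_iff by (simp add: power_mod)
  have cnj_g: "cnj g = (\<Sum>x<n. \<zeta> ^ ((n - 1) * x\<^sup>2))"
    by (simp add: g_def cnj_\<zeta> power_mult)
  have nz: "[(n - 1) * x\<^sup>2 + x\<^sup>2 = 0] (mod n)" for x
  proof -
    have "(n - 1) * x\<^sup>2 + x\<^sup>2 = n * x\<^sup>2" using n_gt_2 by (cases n) (auto simp: algebra_simps)
    thus ?thesis by (simp add: cong_0_iff)
  qed
  have i_sq: "[(i * x)\<^sup>2 + x\<^sup>2 = 0] (mod n)" for x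
  proof -
    have "(i * x)\<^sup>2 + x\<^sup>2 = (i\<^sup>2 + 1) * x\<^sup>2" by (simp add: algebra_simps power2_eq_square)
    thus ?thesis using assms(2) by (simp only: cong_0_iff dvd_mult2)
  qed
  \<comment> \<open>\<open>i\<close> is a unit modulo \<open>n\<close>, with inverse
    \<open>- i\<close>.\<close>
  have inj: "inj_on (\<lambda>x. i * x mod n) {..<n}"
  proof (rule inj_onI)
    fix x y assume xy: "x \<in> {..<n}" "y \<in> {..<n}" "i * x mod n = i * y mod n"
    have d1: "int n dvd int i * int x - int i * int y"
      using xy(3) by (metis mod_eq_dvd_iff of_nat_mult zmod_int)
    have d2: "int n dvd int (i\<^sup>2 + 1)" using assms(2) by presburger
    have "int n dvd int (i\<^sup>2 + 1) * (int x - int y) - int i * (int i * int x - int i * int y)"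
      by (rule dvd_diff[OF dvd_mult2[OF d2] dvd_mult[OF d1]])
    also have "\<dots> = int x - int y" by (simp add: algebra_simps power2_eq_square)
    finally have "[x = y] (mod n)" by (simp add: cong_iff_dvd_diff flip: cong_int_iff)
    thus "x = y" using xy(1,2) cong_less_modulus_unique_nat by auto
  qed
  have "(\<lambda>x. i * x mod n) ` {..<n} = {..<n}"
    by (rule endo_inj_surj[OF _ _ inj]) (use n_gt_2 in auto)
  hence "bij_betw (\<lambda>x. i * x mod n) {..<n} {..<n}" using inj by (simp add: bij_betw_def)
  \<comment> \<open>Replacing \<open>x\<close> by \<open>i * x\<close> negates every square modulo
    \<open>n\<close>, so it turns the Gauss sum into its conjugate.\<close>
  from sum.reindex_bij_betw[OF this, of "\<lambda>x. \<zeta> ^ (x\<^sup>2)"]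
  have "g = (\<Sum>x<n. \<zeta> ^ ((i * x)\<^sup>2))" by (simp add: g_def sq_mod)
  also have "\<dots> = cnj g" unfolding cnj_g
  proof (intro sum.cong refl)
    fix x
    have "[(i * x)\<^sup>2 + x\<^sup>2 = (n - 1) * x\<^sup>2 + x\<^sup>2] (mod n)"
      by (rule cong_trans[OF i_sq cong_sym[OF nz]])
    hence "[(i * x)\<^sup>2 = (n - 1) * x\<^sup>2] (mod n)" by (simp only: cong_add_rcancel_nat)
    thus "\<zeta> ^ ((i * x)\<^sup>2) = \<zeta> ^ ((n - 1) * x\<^sup>2)" by (simp only: \<zeta>_power_eq_iff Cong.cong_def)
  qed
  finally have real: "cnj g = g" by simp
  have "g * cnj g = (\<Sum>y<n. (\<Sum>x<n. \<zeta> ^ (x\<^sup>2)) * \<zeta> ^ ((n - 1) * y\<^sup>2))"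
    unfolding cnj_g by (simp only: g_def sum_distrib_left)
  \<comment> \<open>After the substitution \<open>x = y + u\<close> the squares of \<open>y\<close>
    cancel and \<open>y\<close> occurs linearly. Summing over \<open>y\<close> then leaves only the
    \<open>u\<close> with \<open>2 * u\<close> divisible by \<open>n\<close>, that is
    \<open>u = 0\<close>, as \<open>n\<close> is odd.\<close>
  also have "\<dots> = (\<Sum>y<n. (\<Sum>u<n. \<zeta> ^ (u\<^sup>2) * (\<zeta> ^ (2 * u)) ^ y))"
  proof (intro sum.cong refl)
    fix y
    have "(\<Sum>x<n. \<zeta> ^ (x\<^sup>2)) = (\<Sum>u<n. \<zeta> ^ ((y + u)\<^sup>2))"
      using sum.reindex_bij_betw[OF bij_betw_mod_shift, of "\<lambda>x. \<zeta> ^ (x\<^sup>2)"] by (simp only: sq_mod)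
    moreover have "\<zeta> ^ ((y + u)\<^sup>2) * \<zeta> ^ ((n - 1) * y\<^sup>2) = \<zeta> ^ (u\<^sup>2) * (\<zeta> ^ (2 * u)) ^ y" for u
    proof -
      have "(y + u)\<^sup>2 + (n - 1) * y\<^sup>2 = ((n - 1) * y\<^sup>2 + y\<^sup>2) + (u\<^sup>2 + 2 * u * y)"
        by (simp add: power2_sum)
      also have "[\<dots> = 0 + (u\<^sup>2 + 2 * u * y)] (mod n)" by (intro cong_add nz cong_refl)
      finally have "\<zeta> ^ ((y + u)\<^sup>2 + (n - 1) * y\<^sup>2) = \<zeta> ^ (u\<^sup>2 + 2 * u * y)"
        by (simp only: \<zeta>_power_eq_iff Cong.cong_def add_0)
      thus ?thesis by (simp only: power_add power_mult)
    qed
    ultimately show "(\<Sum>x<n. \<zeta> ^ (x\<^sup>2)) * \<zeta> ^ ((n - 1) * y\<^sup>2) = (\<Sum>u<n. \<zeta> ^ (u\<^sup>2) * (\<zeta> ^ (2 * u)) ^ y)"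
      by (simp only: sum_distrib_right)
  qed
  also have "\<dots> = (\<Sum>u<n. \<zeta> ^ (u\<^sup>2) * (\<Sum>y<n. (\<zeta> ^ (2 * u)) ^ y))"
    by (subst sum.swap) (simp add: sum_distrib_left)
  also have "\<dots> = (\<Sum>u<n. if u = 0 then of_nat n else 0)"
  proof (intro sum.cong refl)
    fix u assume u: "u \<in> {..<n}"
    have "\<zeta> ^ (2 * u) = 1 \<longleftrightarrow> n dvd 2 * u"
      using \<zeta>_power_eq_iff[of "2 * u" 0] by auto
    also have "\<dots> \<longleftrightarrow> n dvd u" using assms(1) by (simp add: coprime_dvd_mult_right_iff)
    also have "\<dots> \<longleftrightarrow> u = 0" using u by (auto dest: dvd_imp_le)
    finally have u0: "\<zeta> ^ (2 * u) = 1 \<longleftrightarrow> u = 0" .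
    show "\<zeta> ^ (u\<^sup>2) * (\<Sum>y<n. (\<zeta> ^ (2 * u)) ^ y) = (if u = 0 then of_nat n else 0)"
      using geometric_sum_root_of_unity[OF power_n_root[of "2 * u"]] u0 by (simp del: power_mult)
  qed
  also have "\<dots> = of_nat n" using n_gt_2 by simp
  finally have "g\<^sup>2 = of_nat n" using real by (simp add: power2_eq_square)
  also have "\<dots> = (complex_of_real (sqrt (real n)))\<^sup>2" by (simp flip: of_real_power)
  finally have "complex_of_real (sqrt (real n)) = g \<or> complex_of_real (sqrt (real n)) = - g"
    by (metis power2_eq_iff)
  thus ?thesis using gK by auto
qed

lemma card_G_dvd_totient: "card G dvd totient n"
proof (rule card_dvd_totient)
  show "\<exists>b\<in>G. b * a mod n = 1" if "a \<in> G" for a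
  proof -
    have "1 \<in> (\<lambda>b. b * a mod n) ` G"
      using bij_betw_imp_surj_on[OF bij_betw_G[OF that]] one_in_G by simp
    thus ?thesis by auto
  qed
qed (rule n_gt_2 one_in_G G_mult; assumption | force simp: G_def)+

end


section \<open>The real quadratic subfield\<close>

locale cyclotomic_sqrt = cyclotomic +
  fixes r :: complex
  assumes odd_n: "odd n" and r_K: "r \<in> K" and r_real: "cnj r = r"
    and r_sq: "r\<^sup>2 = of_nat n" and r_irrational: "r \<notin> \<rat>"
begin

definition H :: "nat set" where "H = {a\<in>G. gal a r = r}"

text \<open>The automorphisms \<open>gal a\<close> and \<open>gal (n - a)\<close> agree on real numbers, so \<open>H_half\<close> represents
  the Galois group of the maximal real subfield over the quadratic field.\<close>

definition H_half :: "nat set" where "H_half = {a\<in>H. 2 * a < n}"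

lemma gal_r: "a \<in> G \<Longrightarrow> gal a r = r \<or> gal a r = - r"
proof -
  assume a: "a \<in> G"
  have "(gal a r)\<^sup>2 = r\<^sup>2" using gal_power[OF a r_K, of 2] gal_rat[OF a] by (simp add: r_sq)
  thus ?thesis by (simp add: power2_eq_iff)
qed

lemma conjugation_exists: obtains c where "c \<in> G" "gal c r = - r"
  using fixed_field[OF r_K] r_irrational gal_r by metis

lemma r_nonzero: "r \<noteq> 0" using r_irrational by auto

lemma H_eq: "a \<in> G \<Longrightarrow> a \<notin> H \<longleftrightarrow> gal a r = - r"
  using gal_r[of a] r_nonzero by (auto simp: H_def eq_neg_iff_add_eq_0)

lemma gal_mult_r: "a \<in> G \<Longrightarrow> c \<in> G \<Longrightarrow> gal c r = - r \<Longrightarrow> gal (a * c mod n) r = - gal a r"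
  using gal_gal[of a c r] r_K gal_minus[of a r] by simp

text \<open>\<open>H\<close> is the kernel of the sign with which \<open>G\<close> acts on
  \<open>r\<close>, so its translate by \<open>c\<close> is the other coset and \<open>H\<close> has
  index two.\<close>

lemma bij_betw_H:
  assumes c: "c \<in> G" "gal c r = - r"
  shows "bij_betw (\<lambda>a. a * c mod n) H (G - H)"
proof -
  have inj: "inj_on (\<lambda>a. a * c mod n) H"
    by (rule inj_on_subset[OF bij_betw_imp_inj_on[OF bij_betw_G[OF c(1)]]]) (auto simp: H_def)
  have "(\<lambda>a. a * c mod n) ` H = G - H"
  proof (intro equalityI subsetI)
    fix x assume "x \<in> (\<lambda>a. a * c mod n) ` H"
    then obtain a where a: "a \<in> H" "x = a * c mod n" by auto
    hence "a \<in> G" "gal a r = r" by (auto simp: H_def)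
    hence "x \<in> G" "gal x r = - r" using gal_mult_r[of a c] a c G_mult by auto
    thus "x \<in> G - H" using H_eq by auto
  next
    fix x assume x: "x \<in> G - H"
    then obtain a where a: "a \<in> G" "x = a * c mod n"
      using bij_betw_imp_surj_on[OF bij_betw_G[OF c(1)]] by blast
    have "gal a r = r" using gal_mult_r[OF a(1) c] H_eq[of x] x a(2) by auto
    thus "x \<in> (\<lambda>a. a * c mod n) ` H" using a by (auto simp: H_def)
  qed
  thus ?thesis using inj by (simp add: bij_betw_def)
qed

lemma finite_H: "finite H" using finite_G by (simp add: H_def)

lemma card_G: "card G = 2 * card H"
proof -
  obtain c where c: "c \<in> G" "gal c r = - r" by (rule conjugation_exists)
  have "card (G - H) = card H" using bij_betw_same_card[OF bij_betw_H[OF c]] by simp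
  moreover have "card (G - H) = card G - card H" "card H \<le> card G"
    using finite_H finite_G by (auto intro!: card_Diff_subset card_mono simp: H_def)
  ultimately show ?thesis by simp
qed

text \<open>Let \<open>y\<close> be the image of \<open>x\<close> under an automorphism that negates
  \<open>r\<close>. Both \<open>x + y\<close> and \<open>(x - y) * r\<close> are fixed by all of
  \<open>G\<close>, hence rational, and dividing the latter by \<open>r\<^sup>2 = n\<close> recovers
  \<open>x\<close>. That \<open>H\<close> also fixes \<open>y\<close> uses commutativity of the
  group.\<close>

lemma fixed_field_H:
  assumes x: "x \<in> K" "\<And>a. a \<in> H \<Longrightarrow> gal a x = x"
  obtains u v where "x = of_rat u + of_rat v * r"
proof -
  obtain c where c: "c \<in> G" "gal c r = - r" by (rule conjugation_exists)
  define y where "y = gal c x"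
  have y: "y \<in> K" using x c gal_closed by (simp add: y_def)
  have cc: "c * c mod n \<in> H" using gal_mult_r[OF c(1) c] c G_mult by (simp add: H_def)
  have galx: "gal b x = (if b \<in> H then x else y)" "gal b y = (if b \<in> H then y else x)" if b: "b \<in> G" for b
  proof -
    have comm: "gal b y = gal c (gal b x)"
      using gal_gal[OF b c(1) x(1)] gal_gal[OF c(1) b x(1)] by (simp add: y_def mult.commute)
    have cy: "gal c y = x" using gal_gal[OF c(1) c(1) x(1)] x(2)[OF cc] by (simp add: y_def)
    have not: "gal b x = y" if "b \<notin> H"
    proof -
      obtain a where a: "a \<in> H" "b = a * c mod n"
      proof -
        have "b \<in> (\<lambda>a. a * c mod n) ` H"
          unfolding bij_betw_imp_surj_on[OF bij_betw_H[OF c]] using b \<open>b \<notin> H\<close> by simp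
        thus thesis using that by auto
      qed
      hence aG: "a \<in> G" by (simp add: H_def)
      have "gal b x = gal c (gal a x)" using gal_gal[OF c(1) aG x(1)] a by (simp add: mult.commute)
      thus ?thesis using x(2)[OF a(1)] by (simp add: y_def)
    qed
    show "gal b x = (if b \<in> H then x else y)" using not x(2) by auto
    thus "gal b y = (if b \<in> H then y else x)" using comm cy by (auto simp: y_def)
  qed
  have "x + y \<in> \<rat>"
    by (rule fixed_field) (use x(1) y in \<open>auto simp: gal_add galx\<close>)
  moreover have "(x - y) * r \<in> \<rat>"
  proof (rule fixed_field)
    fix a assume a: "a \<in> G"
    have "gal a ((x - y) * r) = (gal a x - gal a y) * gal a r" using a x(1) y r_K by (simp add: gal_mult gal_diff)
    thus "gal a ((x - y) * r) = (x - y) * r"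
      using galx[OF a] H_eq[OF a] by (cases "a \<in> H") (auto simp: H_def algebra_simps)
  qed (use x(1) y r_K in simp)
  ultimately obtain u v where uv: "x + y = of_rat u" "(x - y) * r = of_rat v" by (auto elim!: Rats_cases)
  have "(x - y) * (r * r) = of_rat v * r" using uv(2) by (simp only: mult.assoc[symmetric])
  hence "(x - y) * of_nat n = of_rat v * r" using r_sq by (simp only: power2_eq_square)
  hence "x - y = of_rat v * r / of_nat n" using n_gt_2 by (simp add: eq_divide_eq)
  moreover have "x = (x + y) / 2 + (x - y) / 2" by (simp add: field_simps)
  ultimately have "x = of_rat u / 2 + of_rat v * r / of_nat n / 2" using uv(1) by (simp only:)
  also have "\<dots> = of_rat (u / 2) + of_rat (v / (2 * of_nat n)) * r"
    by (simp add: of_rat_divide of_rat_mult)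
  finally show ?thesis by (rule that)
qed

lemma G_pos: "a \<in> G \<Longrightarrow> a > 0"
proof (rule ccontr)
  assume a: "a \<in> G" "\<not> a > 0"
  have "\<zeta> ^ 1 \<noteq> \<zeta> ^ 0" unfolding \<zeta>_power_eq_iff using n_gt_2 by simp
  hence "\<zeta> - 1 \<noteq> 0" by simp
  thus False using gal_eq_0_iff[OF a(1), of "\<zeta> - 1"] gal_\<zeta>[OF a(1)] a gal_diff[OF a(1), of \<zeta> 1] gal_rat[OF a(1), of 1] by simp
qed

lemma minus_mod: "0 < a \<Longrightarrow> a < n \<Longrightarrow> (n - 1) * a mod n = n - a"
proof -
  assume a: "0 < a" "a < n"
  have "(n - 1) * a = (a - 1) * n + (n - a)" 
    using a by (cases a; cases n) (auto simp: algebra_simps)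
  thus ?thesis using a by (simp only: mod_mult_self3) simp
qed

lemma G_minus: 
  assumes a: "a \<in> G" shows "n - a \<in> G" "x \<in> K \<Longrightarrow> gal (n - a) x = gal a (cnj x)" 
proof -
  have eq: "a * (n - 1) mod n = n - a" using minus_mod[of a] G_pos[OF a] a by (simp add: G_def mult.commute)
  show "n - a \<in> G" using G_mult[OF a minus_one_in_G] eq by simp
  show "gal (n - a) x = gal a (cnj x)" if "x \<in> K"
    using gal_gal[OF a minus_one_in_G that] eq gal_minus_one[OF that] by simp
qed

lemma H_minus: "a \<in> H \<Longrightarrow> n - a \<in> H"
  using G_minus[of a] r_K r_real by (auto simp: H_def)

lemma H_mult: "a \<in> H \<Longrightarrow> b \<in> H \<Longrightarrow> a * b mod n \<in> H"
  using gal_gal[of a b r] r_K G_mult by (auto simp: H_def)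

text \<open>The map \<open>a \<mapsto> n - a\<close> exchanges \<open>H_half\<close> with the rest
  of \<open>H\<close>; it has no fixed point because \<open>n\<close> is odd.\<close>

lemma card_H: "card H = 2 * card H_half"
proof -
  have "bij_betw (\<lambda>a. n - a) H_half (H - H_half)"
  proof (rule bij_betwI[of _ _ _ "\<lambda>a. n - a"])
    have odd: "2 * a \<noteq> n" for a using odd_n by auto
    have HG: "a < n" "a > 0" if "a \<in> H" for a
      using that G_pos[of a] unfolding H_def by (simp_all add: G_def)
    show "(\<lambda>a. n - a) \<in> H_half \<rightarrow> H - H_half"
    proof
      fix a assume "a \<in> H_half"
      hence "a \<in> H" "2 * a < n" by (auto simp: H_half_def)
      thus "n - a \<in> H - H_half" using H_minus[of a] HG[of a] by (simp add: H_half_def)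
    qed
    show "(\<lambda>a. n - a) \<in> H - H_half \<rightarrow> H_half"
    proof
      fix a assume "a \<in> H - H_half"
      hence "a \<in> H" "\<not> 2 * a < n" by (auto simp: H_half_def)
      thus "n - a \<in> H_half" using H_minus[of a] HG[of a] odd[of a] by (simp add: H_half_def)
    qed
  qed (auto simp: H_half_def H_def G_def)
  hence "card (H - H_half) = card H_half" using bij_betw_same_card by metis
  moreover have "card (H - H_half) = card H - card H_half" "card H_half \<le> card H"
    using finite_H by (auto intro!: card_Diff_subset card_mono simp: H_half_def)
  ultimately show ?thesis by simp
qed

lemma card_H_half_dvd: "card H_half dvd totient n div 4"
proof -
  have "card H_half * 4 dvd totient n" using card_G_dvd_totient card_G card_H by (simp add: mult.commute)
  thus ?thesis by (metis dvd_div_iff_mult dvd_mult_right zero_neq_numeral)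
qed

text \<open>On real elements this is the relative norm to the quadratic field. On other elements the
  product depends on which of \<open>a\<close> and \<open>n - a\<close> represents a pair.\<close>

definition nrm :: "complex \<Rightarrow> complex" where "nrm x = (\<Prod>a\<in>H_half. gal a x)"

lemma nrm_closed: "x \<in> K \<Longrightarrow> nrm x \<in> K"
  unfolding nrm_def by (rule K_closed') (auto simp: H_half_def H_def gal_closed)

text \<open>Multiplication by \<open>b\<close> permutes \<open>H_half\<close> once each residue
  above \<open>n / 2\<close> is replaced by its negative, and for real \<open>x\<close> this
  replacement does not change \<open>gal\<close>.\<close>

lemma nrm_fixed:
  assumes b: "b \<in> H" and x: "x \<in> K" "cnj x = x"
  shows "gal b (nrm x) = nrm x"
proof -
  define \<rho> where "\<rho> a = (if 2 * (a * b mod n) < n then a * b mod n else n - a * b mod n)" for a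
  have HG: "a \<in> G" "a < n" "a > 0" if "a \<in> H" for a
    using that G_pos[of a] unfolding H_def by (simp_all add: G_def)
  have bG: "b \<in> G" using HG b by blast
  have odd: "2 * a \<noteq> n" for a using odd_n by auto
  have \<rho>: "\<rho> a \<in> H_half" if "a \<in> H_half" for a
  proof -
    have "a * b mod n \<in> H" using H_mult that b by (auto simp: H_half_def)
    moreover from HG[OF this] odd[of "a * b mod n"] have "2 * (n - a * b mod n) < n" if "\<not> 2 * (a * b mod n) < n"
      using that by linarith
    ultimately show ?thesis using H_minus by (auto simp: \<rho>_def H_half_def)
  qed
  have eq: "gal (\<rho> a) x = gal b (gal a x)" if "a \<in> H_half" for a
  proof -
    have aG: "a \<in> G" using that by (simp add: H_half_def H_def)
    have "gal (\<rho> a) x = gal (a * b mod n) x" using G_minus(2)[OF G_mult[OF aG bG]] x by (simp add: \<rho>_def)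
    thus ?thesis using gal_gal[OF bG aG x(1)] by (simp add: mult.commute)
  qed
  have minus: "(n - a) * b mod n = n - a * b mod n" if "a \<in> H" for a
  proof -
    have ab: "a * b mod n \<in> H" using H_mult[OF that b] .
    have "(n - a) * b mod n = ((n - 1) * a mod n) * b mod n" using minus_mod[of a] HG[OF that] by simp
    also have "\<dots> = (n - 1) * (a * b mod n) mod n" by (simp add: mod_simps mult.assoc)
    also have "\<dots> = n - a * b mod n" by (rule minus_mod[OF HG(3)[OF ab] HG(2)[OF ab]])
    finally show ?thesis .
  qed
  have reflect: "x = n - y"
    if "(if 2 * x < n then x else n - x) = (if 2 * y < n then y else n - y)" "x < n" "y < n" "x \<noteq> y" for x y
    using that by (auto split: if_splits)
  have inj: "inj_on \<rho> H_half"
  proof (rule inj_onI)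
    fix a a' assume a: "a \<in> H_half" "a' \<in> H_half" "\<rho> a = \<rho> a'"
    have aH: "a \<in> H" "a' \<in> H" "2 * a < n" "2 * a' < n" using a by (auto simp: H_half_def)
    have lt: "a * b mod n < n" "a' * b mod n < n" using n_gt_2 by auto
    have injG: "x * b mod n = y * b mod n \<Longrightarrow> x = y" if "x \<in> G" "y \<in> G" for x y
      using bij_betw_imp_inj_on[OF bij_betw_G[OF bG]] that by (auto dest: inj_onD)
    show "a = a'"
    proof (rule ccontr)
      assume ne: "a \<noteq> a'"
      hence "a * b mod n \<noteq> a' * b mod n" using injG aH HG by blast
      \<comment> \<open>Folding identifies a residue only with its negative, so a collision would
        mean \<open>a = n - a'\<close>, impossible when both lie below \<open>n / 2\<close>.\<close>
      hence "a * b mod n = n - a' * b mod n"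
        using reflect[OF a(3)[unfolded \<rho>_def] lt] by blast
      hence "a * b mod n = (n - a') * b mod n" using minus aH by simp
      hence "a = n - a'" using injG[of a "n - a'"] aH HG G_minus by auto
      thus False using aH by linarith
    qed
  qed
  have fin: "finite H_half" using finite_H by (simp add: H_half_def)
  have "\<rho> ` H_half = H_half" by (rule endo_inj_surj[OF fin _ inj]) (use \<rho> in auto)
  hence bij: "bij_betw \<rho> H_half H_half" using inj by (simp add: bij_betw_def)
  have "gal b (nrm x) = (\<Prod>a\<in>H_half. gal (\<rho> a) x)"
    unfolding nrm_def using eq x bG by (subst gal_prod) (auto simp: H_half_def H_def gal_closed)
  also have "\<dots> = nrm x" unfolding nrm_def by (rule prod.reindex_bij_betw[OF bij])
  finally show ?thesis .
qed

end


section \<open>Fractional ideals and finite class numbers\<close>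

abbreviation fractional_prod :: "complex set \<Rightarrow> complex set \<Rightarrow> complex set" (infixl "\<star>" 70) where
  "A \<star> B \<equiv> ideal_prod complex_ring A B"

lemma ideal_prodI: "a \<in> A \<Longrightarrow> b \<in> B \<Longrightarrow> a * b \<in> A \<star> B"
  using ideal_prod.prod[of a A b B complex_ring] by simp

lemma ideal_prod_add: "x \<in> A \<star> B \<Longrightarrow> y \<in> A \<star> B \<Longrightarrow> x + y \<in> A \<star> B"
  using ideal_prod.sum[of x complex_ring A B y] by simp

lemma ideal_prod_induct [consumes 1, case_names prod sum]:
  assumes "x \<in> A \<star> B"
    and "\<And>a b. a \<in> A \<Longrightarrow> b \<in> B \<Longrightarrow> P (a * b)" and "\<And>x y. P x \<Longrightarrow> P y \<Longrightarrow> P (x + y)"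
  shows "P x"
  using assms(1)
proof (induction rule: ideal_prod.induct)
  case (prod a b)
  thus ?case using assms(2) by simp
next
  case (sum x y)
  thus ?case using assms(3) by simp
qed

lemma ideal_prod_subset:
  assumes "\<And>a b. a \<in> A \<Longrightarrow> b \<in> B \<Longrightarrow> a * b \<in> C" "\<And>x y. x \<in> C \<Longrightarrow> y \<in> C \<Longrightarrow> x + y \<in> C"
  shows "A \<star> B \<subseteq> C"
proof
  fix x assume "x \<in> A \<star> B"
  thus "x \<in> C" by (induction rule: ideal_prod_induct) (use assms in auto)
qed

lemma ideal_prod_mono: "A \<subseteq> A' \<Longrightarrow> B \<subseteq> B' \<Longrightarrow> (A \<star> B) \<subseteq> A' \<star> B'"
  by (rule ideal_prod_subset[OF ideal_prodI ideal_prod_add]) blast+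

lemma ideal_prod_commute: "A \<star> B = B \<star> A"
proof -
  have "A \<star> B \<subseteq> B \<star> A" for A B
    by (rule ideal_prod_subset[OF _ ideal_prod_add]) (subst mult.commute, rule ideal_prodI)
  thus ?thesis by blast
qed

lemma ideal_prod_assoc_le:
  "A \<star> B \<star> C \<subseteq> A \<star> (B \<star> C)"
proof (rule ideal_prod_subset)
  fix x c assume x: "x \<in> A \<star> B" and c: "c \<in> C"
  from x show "x * c \<in> A \<star> (B \<star> C)"
  proof (induction rule: ideal_prod_induct)
    case (prod a b)
    thus ?case using ideal_prodI[OF prod(1) ideal_prodI[OF prod(2) c]] by (simp add: mult.assoc)
  qed (auto simp: distrib_right intro: ideal_prod_add)
qed (rule ideal_prod_add)

lemma ideal_prod_assoc:
  "A \<star> B \<star> C = A \<star> (B \<star> C)"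
proof (rule equalityI[OF ideal_prod_assoc_le])
  have "A \<star> (B \<star> C) = C \<star> B \<star> A"
    by (simp add: ideal_prod_commute)
  also have "\<dots> \<subseteq> C \<star> (B \<star> A)" by (rule ideal_prod_assoc_le)
  also have "\<dots> = A \<star> B \<star> C" by (simp add: ideal_prod_commute)
  finally show "A \<star> (B \<star> C) \<subseteq> A \<star> B \<star> C" .
qed

lemma subgroup_complex_add_iff:
  "subgroup I (add_monoid complex_ring) \<longleftrightarrow> 0 \<in> I \<and> (\<forall>x\<in>I. \<forall>y\<in>I. x + y \<in> I) \<and> (\<forall>x\<in>I. - x \<in> I)"
proof -
  have inv: "inv\<^bsub>add_monoid complex_ring\<^esub> x = - x" for x
    using complex_ring_inverses(1)[of x] by (simp add: a_inv_def)
  show ?thesis unfolding subgroup_def inv by auto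
qed

text \<open>The interface through which both the quadratic field and the maximal real subfield enter
  the ideal theory. The last three assumptions take the place of an integral basis and of the
  norm.\<close>

locale number_ring =
  fixes M :: "complex set"
  assumes M_add: "x \<in> M \<Longrightarrow> y \<in> M \<Longrightarrow> x + y \<in> M" and M_mult: "x \<in> M \<Longrightarrow> y \<in> M \<Longrightarrow> x * y \<in> M"
    and M_uminus: "x \<in> M \<Longrightarrow> - x \<in> M" and M_inverse: "x \<in> M \<Longrightarrow> inverse x \<in> M"
    and M_rat: "x \<in> \<rat> \<Longrightarrow> x \<in> M"
    and denominator: "x \<in> M \<Longrightarrow> \<exists>k>0. of_nat k * x \<in> integers_of M"
    and integer_multiple: "x \<in> integers_of M \<Longrightarrow> x \<noteq> 0 \<Longrightarrow> \<exists>y\<in>integers_of M. \<exists>k>0. x * y = of_nat k"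
    and finite_residues: "N > 0 \<Longrightarrow> \<exists>S. finite S \<and> S \<subseteq> integers_of M \<and>
      (\<forall>x\<in>integers_of M. \<exists>s\<in>S. \<exists>z\<in>integers_of M. x = s + of_nat N * z)"
begin

abbreviation \<O> :: "complex set" where "\<O> \<equiv> integers_of M"

abbreviation frac :: "complex set \<Rightarrow> bool" where "frac \<equiv> fractional_ideal M"

abbreviation FI :: "complex set monoid" where "FI \<equiv> fractional_ideal_group M"

abbreviation fpow :: "complex set \<Rightarrow> nat \<Rightarrow> complex set" (infixl "\<up>" 75) where
  "I \<up> k \<equiv> I [^]\<^bsub>FI\<^esub> k"

abbreviation \<P> :: "complex set set" where "\<P> \<equiv> principal_fractional_ideals M"

definition pr :: "complex \<Rightarrow> complex set" where "pr c = (\<lambda>x. c * x) ` \<O>"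

lemma O_closed:
  "x \<in> \<O> \<Longrightarrow> y \<in> \<O> \<Longrightarrow> x + y \<in> \<O>" "x \<in> \<O> \<Longrightarrow> y \<in> \<O> \<Longrightarrow> x * y \<in> \<O>" "x \<in> \<O> \<Longrightarrow> - x \<in> \<O>"
  "0 \<in> \<O>" "1 \<in> \<O>" "of_nat k \<in> \<O>" "of_int i \<in> \<O>"
  unfolding integers_of_def using M_add M_mult M_uminus algebraic_int_add algebraic_int_mult
  by (simp_all add: M_rat)

lemma O_diff: "x \<in> \<O> \<Longrightarrow> y \<in> \<O> \<Longrightarrow> x - y \<in> \<O>"
  using O_closed(1)[of x "-y"] O_closed(3) by simp

lemma O_power: "x \<in> \<O> \<Longrightarrow> x ^ k \<in> \<O>"
  by (induction k) (simp_all add: O_closed)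

lemma O_M: "x \<in> \<O> \<Longrightarrow> x \<in> M" by (simp add: integers_of_def)

lemma M_power: "x \<in> M \<Longrightarrow> x ^ k \<in> M"
  by (induction k) (simp_all add: M_mult M_rat)

lemma fracI:
  assumes "I \<subseteq> M" "x0 \<in> I" "x0 \<noteq> 0" "\<And>x y. x \<in> I \<Longrightarrow> y \<in> I \<Longrightarrow> x + y \<in> I"
    "\<And>a x. a \<in> \<O> \<Longrightarrow> x \<in> I \<Longrightarrow> a * x \<in> I" "d \<in> \<O>" "d \<noteq> 0" "\<And>x. x \<in> I \<Longrightarrow> d * x \<in> \<O>"
  shows "frac I"
proof -
  have "0 \<in> I" using assms(5)[OF O_closed(4) assms(2)] by simp
  moreover have "- x \<in> I" if "x \<in> I" for x using assms(5)[OF O_closed(3)[OF O_closed(5)] that] by simp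
  ultimately show ?thesis
    unfolding fractional_ideal_def subgroup_complex_add_iff
    using assms(1-5) assms(6-8) by (intro conjI ballI bexI[of _ d]) auto
qed

lemma fracD:
  assumes "frac I"
  shows "I \<subseteq> M" "0 \<in> I" "x \<in> I \<Longrightarrow> y \<in> I \<Longrightarrow> x + y \<in> I" "a \<in> \<O> \<Longrightarrow> x \<in> I \<Longrightarrow> a * x \<in> I"
    "\<exists>x\<in>I. x \<noteq> 0" "\<exists>d\<in>\<O>. d \<noteq> 0 \<and> (\<forall>x\<in>I. d * x \<in> \<O>)"
proof -
  have I: "I \<subseteq> M" "I \<noteq> {0}" "0 \<in> I" "\<forall>x\<in>I. \<forall>y\<in>I. x + y \<in> I" "\<forall>a\<in>\<O>. \<forall>x\<in>I. a * x \<in> I"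
    "\<exists>d\<in>\<O> - {0}. \<forall>x\<in>I. d * x \<in> \<O>"
    using assms unfolding fractional_ideal_def subgroup_complex_add_iff by simp_all
  show "I \<subseteq> M" "0 \<in> I" by (rule I)+
  show "x \<in> I \<Longrightarrow> y \<in> I \<Longrightarrow> x + y \<in> I" using I(4) by simp
  show "a \<in> \<O> \<Longrightarrow> x \<in> I \<Longrightarrow> a * x \<in> I" using I(5) by simp
  show "\<exists>x\<in>I. x \<noteq> 0" using I(2,3) by blast
  show "\<exists>d\<in>\<O>. d \<noteq> 0 \<and> (\<forall>x\<in>I. d * x \<in> \<O>)" using I(6) by blast
qed

lemma frac_iprod:
  assumes A: "frac A" and B: "frac B" shows "frac (A \<star> B)"
proof -
  obtain a b where ab: "a \<in> A" "a \<noteq> 0" "b \<in> B" "b \<noteq> 0" using fracD(5) A B by meson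
  obtain d e where d: "d \<in> \<O>" "d \<noteq> 0" "\<And>x. x \<in> A \<Longrightarrow> d * x \<in> \<O>"
    and e: "e \<in> \<O>" "e \<noteq> 0" "\<And>x. x \<in> B \<Longrightarrow> e * x \<in> \<O>" using fracD(6) A B by meson
  show ?thesis
  proof (rule fracI)
    show "A \<star> B \<subseteq> M" by (rule ideal_prod_subset) (use fracD(1)[OF A] fracD(1)[OF B] in \<open>auto intro!: M_add M_mult\<close>)
    show "a * b \<in> A \<star> B" "a * b \<noteq> 0" using ab(2,4) ideal_prodI[OF ab(1,3)] by auto
    show "x + y \<in> A \<star> B" if "x \<in> A \<star> B" "y \<in> A \<star> B" for x y using that by (rule ideal_prod_add)
    show "c * x \<in> A \<star> B" if "c \<in> \<O>" "x \<in> A \<star> B" for c x using that(2)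
    proof (induction rule: ideal_prod_induct)
      case (prod a b)
      thus ?case using ideal_prodI[OF fracD(4)[OF A that(1) prod(1)] prod(2)] by (simp add: mult.assoc)
    qed (auto simp: distrib_left intro: ideal_prod_add)
    show "d * e \<in> \<O>" "d * e \<noteq> 0" using d(2) e(2) O_closed(2)[OF d(1) e(1)] by auto
    show "d * e * x \<in> \<O>" if "x \<in> A \<star> B" for x using that
    proof (induction rule: ideal_prod_induct)
      case (prod a b)
      have "d * e * (a * b) = (d * a) * (e * b)" by simp
      thus ?case using O_closed(2)[OF d(3)[OF prod(1)] e(3)[OF prod(2)]] by (simp only:)
    qed (auto simp: distrib_left intro: O_closed)
  qed
qed

lemma frac_O: "frac \<O>"
  by (rule fracI[of _ 1 1]) (simp_all add: O_closed O_M subsetI)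

lemma O_iprod: 
  assumes "frac A" shows "\<O> \<star> A = A"
proof
  show "\<O> \<star> A \<subseteq> A" by (rule ideal_prod_subset[OF fracD(4)[OF assms] fracD(3)[OF assms]])
  show "A \<subseteq> \<O> \<star> A"
  proof
    fix x assume "x \<in> A"
    from ideal_prodI[OF O_closed(5) this] show "x \<in> \<O> \<star> A" by simp
  qed
qed

lemma FI_simps [simp]: "carrier FI = {I. frac I}" "monoid.mult FI = (\<star>)" "\<one>\<^bsub>FI\<^esub> = \<O>"
  by (simp_all add: fractional_ideal_group_def)

lemma comm_monoid_FI: "comm_monoid FI"
proof (rule comm_monoidI)
  show "x \<otimes>\<^bsub>FI\<^esub> y = y \<otimes>\<^bsub>FI\<^esub> x" for x y by (simp add: ideal_prod_commute)
qed (simp_all add: frac_iprod frac_O O_iprod ideal_prod_assoc)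

lemma monoid_FI: "Group.monoid FI"
  by (rule comm_monoid.axioms(1)[OF comm_monoid_FI])

lemma nat_pow_FI: "A \<up> 0 = \<O>" "A \<up> Suc k = A \<up> k \<star> A"
  using monoid.nat_pow_0[OF monoid_FI] monoid.nat_pow_Suc[OF monoid_FI] by simp_all

lemma pr_iprod: 
  assumes A: "frac A" shows "pr c \<star> A = (\<lambda>x. c * x) ` A"
proof
  show "pr c \<star> A \<subseteq> (\<lambda>x. c * x) ` A"
  proof (rule ideal_prod_subset)
    fix x y assume "x \<in> pr c" "y \<in> A"
    from \<open>x \<in> pr c\<close> obtain z where "z \<in> \<O>" "x = c * z" unfolding pr_def by blast
    moreover have "z * y \<in> A" by (rule fracD(4)[OF A \<open>z \<in> \<O>\<close> \<open>y \<in> A\<close>])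
    ultimately show "x * y \<in> (\<lambda>x. c * x) ` A" by (auto simp: mult.assoc)
  next
    fix x y assume "x \<in> (\<lambda>x. c * x) ` A" "y \<in> (\<lambda>x. c * x) ` A"
    then obtain u v where "x = c * u" "y = c * v" "u \<in> A" "v \<in> A" by blast
    thus "x + y \<in> (\<lambda>x. c * x) ` A" using fracD(3)[OF A \<open>u \<in> A\<close> \<open>v \<in> A\<close>] by (auto simp flip: distrib_left)
  qed
  have "c \<in> pr c" unfolding pr_def using O_closed(5) by (intro image_eqI[of _ _ 1]) auto
  thus "(\<lambda>x. c * x) ` A \<subseteq> pr c \<star> A" by (auto intro: ideal_prodI)
qed

lemma frac_pr: "c \<in> M \<Longrightarrow> c \<noteq> 0 \<Longrightarrow> frac (pr c)"
proof -
  assume c: "c \<in> M" "c \<noteq> 0"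
  have "\<exists>d\<in>\<O>. d \<noteq> 0 \<and> d * c \<in> \<O>"
    
  proof -
    obtain k where "k > 0" "of_nat k * c \<in> \<O>" using denominator[OF c(1)] by blast
    thus ?thesis by (intro bexI[of _ "of_nat k"]) (auto simp: O_closed)
  qed
  then obtain d where d: "d \<in> \<O>" "d \<noteq> 0" "d * c \<in> \<O>" by blast
  show ?thesis
  proof (rule fracI)
    show "pr c \<subseteq> M" unfolding pr_def using M_mult[OF c(1) O_M] by blast
    show "c \<in> pr c" unfolding pr_def using O_closed(5) by (intro image_eqI[of _ _ 1]) auto
    show "x + y \<in> pr c" if xy: "x \<in> pr c" "y \<in> pr c" for x y
    proof -
      obtain u v where "x = c * u" "y = c * v" "u \<in> \<O>" "v \<in> \<O>" using xy unfolding pr_def by blast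
      thus ?thesis unfolding pr_def by (intro image_eqI[of _ _ "u + v"]) (auto simp: distrib_left O_closed)
    qed
    show "a * x \<in> pr c" if ax: "a \<in> \<O>" "x \<in> pr c" for a x
    proof -
      obtain u where "x = c * u" "u \<in> \<O>" using ax(2) unfolding pr_def by blast
      thus ?thesis unfolding pr_def using ax(1) by (intro image_eqI[of _ _ "a * u"]) (auto simp: O_closed)
    qed
    show "d * x \<in> \<O>" if x: "x \<in> pr c" for x
    proof -
      obtain u where "x = c * u" "u \<in> \<O>" using x unfolding pr_def by blast
      thus ?thesis using O_closed(2)[OF d(3)] by (simp add: mult.assoc)
    qed
  qed (use c d in auto)
qed

lemma pr_mult: "pr c \<star> pr d = pr (c * d)" if "d \<in> M" "d \<noteq> 0"
  unfolding pr_iprod[OF frac_pr[OF that]] by (simp add: pr_def image_image mult.assoc)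

lemma pr_one: "pr 1 = \<O>" by (simp add: pr_def)

lemma pr_inverse: "c \<in> M \<Longrightarrow> c \<noteq> 0 \<Longrightarrow> pr c \<star> pr (inverse c) = \<O>"
  by (simp add: pr_mult M_inverse pr_one)

lemma PI_eq: "\<P> = {pr c |c. c \<in> M - {0}}"
  by (auto simp: principal_fractional_ideals_def pr_def)

text \<open>The powers of \<open>b \<in> B\<close> have bounded denominators, so two of them differ by an algebraic
  integer.\<close>

lemma multiplier_subset_O:
  assumes A: "frac A" and B: "frac B" and AB: "A \<star> B \<subseteq> A"
  shows "B \<subseteq> \<O>"
proof
  fix b assume b: "b \<in> B"
  have bM: "b \<in> M" using b fracD(1)[OF B] by auto
  obtain a where a: "a \<in> A" "a \<noteq> 0" using fracD(5)[OF A] by blast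
  obtain d where d: "d \<in> \<O>" "d \<noteq> 0" "\<And>x. x \<in> A \<Longrightarrow> d * x \<in> \<O>" using fracD(6)[OF A] by blast
  have pow: "b ^ k * a \<in> A" for k
  proof (induction k)
    case (Suc k)
    have "(b ^ k * a) * b \<in> A" using ideal_prodI[OF Suc b] AB by blast
    thus ?case by (simp add: ac_simps)
  qed (use a in simp)
  obtain f N where f: "f \<in> \<O>" "N > 0" "d * a * f = of_nat N"
    using integer_multiple[OF d(3)[OF a(1)]] a(2) d(2) by auto
  have Nb: "of_nat N * b ^ k \<in> \<O>" for k
  proof -
    have "of_nat N * b ^ k = f * (d * (b ^ k * a))" unfolding f(3)[symmetric] by (simp add: ac_simps)
    thus ?thesis using O_closed(2)[OF f(1) d(3)[OF pow]] by (simp only:)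
  qed
  obtain S where S: "finite S" "\<And>x. x \<in> \<O> \<Longrightarrow> \<exists>s\<in>S. \<exists>z\<in>\<O>. x = s + of_nat N * z"
    using finite_residues[OF f(2)] by blast
  obtain s z where sz: "\<And>k. s k \<in> S" "\<And>k. z k \<in> \<O>" "\<And>k. of_nat N * b ^ k = s k + of_nat N * z k"
    using S(2)[OF Nb] by metis
  have "\<not> inj_on s (UNIV :: nat set)"
    using S(1) sz(1) by (metis finite_imageD finite_subset image_subsetI infinite_UNIV_nat)
  then obtain i j :: nat where ij: "i < j" "s i = s j"
    unfolding inj_on_def by (metis linorder_neqE_nat)
  have "of_nat N * (b ^ j - b ^ i) = of_nat N * (z j - z i)"
    using sz(3)[of i] sz(3)[of j] ij(2) by (simp add: algebra_simps)
  hence eq: "b ^ j - b ^ i = z j - z i" using f(2) by simp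
  have "z j - z i \<in> \<O>" using sz(2) O_diff by blast
  have "algebraic_int b"
  proof (rule algebraic_int_root[of "z j - z i" "Polynomial.monom 1 j - Polynomial.monom 1 i"])
    show "algebraic_int (z j - z i)" using \<open>z j - z i \<in> \<O>\<close> by (simp add: integers_of_def)
    show "poly (Polynomial.monom 1 j - Polynomial.monom 1 i) b = z j - z i" using eq by (simp add: poly_monom)
    have deg: "Polynomial.degree (Polynomial.monom 1 j - Polynomial.monom (1 :: complex) i) = j"
      using ij(1) by (intro antisym degree_le le_degree) auto
    thus "0 < Polynomial.degree (Polynomial.monom 1 j - Polynomial.monom (1 :: complex) i)"
      "lead_coeff (Polynomial.monom 1 j - Polynomial.monom (1 :: complex) i) = 1" using ij(1) by auto
  qed (auto simp: coeff_monom)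
  thus "b \<in> \<O>" using bM by (simp add: integers_of_def)
qed

text \<open>The recursion along the list allows generators to be eliminated one at a time.\<close>

fun span_O :: "complex list \<Rightarrow> complex set" where
  "span_O [] = {0}"
| "span_O (m # ms) = {x * m + y |x y. x \<in> \<O> \<and> y \<in> span_O ms}"

lemma span_O_closed:
  "x \<in> span_O ms \<Longrightarrow> y \<in> span_O ms \<Longrightarrow> x + y \<in> span_O ms"
  "a \<in> \<O> \<Longrightarrow> x \<in> span_O ms \<Longrightarrow> a * x \<in> span_O ms"
proof -
  show "x \<in> span_O ms \<Longrightarrow> y \<in> span_O ms \<Longrightarrow> x + y \<in> span_O ms"
  proof (induction ms arbitrary: x y)
    case (Cons m ms)
    then obtain u v u' v' where "x = u * m + v" "y = u' * m + v'" "u \<in> \<O>" "u' \<in> \<O>" "v \<in> span_O ms" "v' \<in> span_O ms"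
      by auto
    hence "x + y = (u + u') * m + (v + v')" "u + u' \<in> \<O>" "v + v' \<in> span_O ms"
      using Cons(1) O_closed(1) by (auto simp: algebra_simps)
    thus ?case by auto
  qed simp
  show "a \<in> \<O> \<Longrightarrow> x \<in> span_O ms \<Longrightarrow> a * x \<in> span_O ms"
  proof (induction ms arbitrary: x)
    case (Cons m ms)
    then obtain u v where "x = u * m + v" "u \<in> \<O>" "v \<in> span_O ms" by auto
    moreover from this have "a * x = (a * u) * m + a * v" by (simp add: algebra_simps)
    moreover have "a * u \<in> \<O>" "a * v \<in> span_O ms"
      using Cons(1)[OF Cons(2) \<open>v \<in> span_O ms\<close>] O_closed(2)[OF Cons(2) \<open>u \<in> \<O>\<close>] by simp_all
    ultimately show ?case unfolding span_O.simps by blast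
  qed simp
qed

lemma zero_in_span_O: "0 \<in> span_O ms"
proof (induction ms)
  case (Cons m ms)
  have "0 = 0 * m + 0" by simp
  thus ?case using Cons O_closed(4) unfolding span_O.simps by blast
qed simp

lemma list_in_span_O: "m \<in> set ms \<Longrightarrow> m \<in> span_O ms"
proof (induction ms)
  case (Cons a ms)
  have "a = 1 * a + 0" by simp
  moreover have "m = 0 * a + m" by simp
  ultimately show ?case using Cons O_closed(4,5) zero_in_span_O[of ms] unfolding span_O.simps set_simps by blast
qed simp

text \<open>Let \<open>d\<close> be a denominator of \<open>A\<close> and \<open>f\<close> such that
  \<open>d * a * f\<close> is a natural number \<open>N\<close>. Modulo \<open>N\<close> each
  \<open>d * x\<close> is one of finitely many residues \<open>s\<close>, and the correction is a
  multiple of \<open>N = d * (f * a)\<close>. So \<open>f * a\<close> and those quotients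
  \<open>s / d\<close> that lie in \<open>A\<close> generate \<open>A\<close>.\<close>

lemma frac_finitely_generated:
  assumes A: "frac A"
  obtains ms where "set ms \<subseteq> A" "A \<subseteq> span_O ms"
proof -
  obtain a where a: "a \<in> A" "a \<noteq> 0" using fracD(5)[OF A] by blast
  obtain d where d: "d \<in> \<O>" "d \<noteq> 0" "\<And>x. x \<in> A \<Longrightarrow> d * x \<in> \<O>" using fracD(6)[OF A] by blast
  obtain f N where f: "f \<in> \<O>" "N > 0" "d * a * f = of_nat N"
    using integer_multiple[OF d(3)[OF a(1)]] a(2) d(2) by auto
  obtain S where S: "finite S" "\<And>x. x \<in> \<O> \<Longrightarrow> \<exists>s\<in>S. \<exists>z\<in>\<O>. x = s + of_nat N * z"
    using finite_residues[OF f(2)] by blast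
  have "finite {s / d |s. s \<in> S \<and> s / d \<in> A}"
    by (rule finite_subset[of _ "(\<lambda>s. s / d) ` S"]) (use S(1) in auto)
  then obtain ss where ss: "set ss = {s / d |s. s \<in> S \<and> s / d \<in> A}" using finite_list by blast
  have fa: "f * a \<in> A" using fracD(4)[OF A f(1) a(1)] .
  have mem: "x \<in> span_O (f * a # ss)" if x: "x \<in> A" for x
  proof -
    obtain s z where sz: "s \<in> S" "z \<in> \<O>" "d * x = s + of_nat N * z" using S(2)[OF d(3)[OF x]] by blast
    hence eq: "x = z * (f * a) + s / d" using d(2) f(3) by (simp add: field_simps)
    have "s / d = x + (- z) * (f * a)" using eq by simp
    also have "\<dots> \<in> A" by (rule fracD(3)[OF A x fracD(4)[OF A O_closed(3)[OF sz(2)] fa]])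
    finally have "s / d \<in> set ss" using ss sz(1) by auto
    thus ?thesis using eq sz(2) list_in_span_O by auto
  qed
  show ?thesis by (rule that[of "f * a # ss"]) (use ss fa mem in auto)
qed

lemma span_O_mult_ideal:
  assumes B: "frac B" "B \<subseteq> \<O>" and "x \<in> span_O (m # ms)" "b \<in> B"
  obtains c y where "x * b = c * m + y" "c \<in> B" "y \<in> span_O ms"
proof -
  obtain u v where "x = u * m + v" "u \<in> \<O>" "v \<in> span_O ms" using assms(3) by auto
  moreover from this have "x * b = (u * b) * m + b * v" by (simp add: algebra_simps)
  moreover have "u * b \<in> B" by (rule fracD(4)[OF B(1) \<open>u \<in> \<O>\<close> assms(4)])
  moreover have "b * v \<in> span_O ms" using assms(4) B(2) \<open>v \<in> span_O ms\<close> by (intro span_O_closed) auto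
  ultimately show ?thesis using that by blast
qed

text \<open>Nakayama's lemma. Eliminating one generator of \<open>A\<close> after the other replaces the usual
  determinant.\<close>

lemma nakayama:
  assumes A: "frac A" and B: "frac B" "B \<subseteq> \<O>" and AB: "A \<star> B = A"
  shows "set ms \<subseteq> A \<Longrightarrow> (\<And>x. x \<in> A \<Longrightarrow> c * x \<in> span_O ms) \<Longrightarrow> 1 - c \<in> B \<Longrightarrow> 1 \<in> B"
\<comment> \<open>The multiplier \<open>c\<close> is 1 modulo \<open>B\<close> and carries
  \<open>A\<close> into the span of the remaining generators. With none left it annihilates
  \<open>A\<close>, so \<open>c = 0\<close> and \<open>1 \<in> B\<close>.\<close>
proof (induction ms arbitrary: c)
  case Nil
  obtain a where "a \<in> A" "a \<noteq> 0" using fracD(5)[OF A] by blast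
  hence "c = 0" using Nil(2) by fastforce
  thus ?case using Nil(3) by simp
next
  case (Cons m ms)
  have c: "c \<in> \<O>" using Cons(4) B(2) O_diff[OF O_closed(5), of "1 - c"] by auto
  have mA: "m \<in> A" using Cons(2) by simp
  have "\<exists>b\<in>B. \<exists>y\<in>span_O ms. c * x = b * m + y" if "x \<in> A" for x
  proof -
    have "x \<in> A \<star> B" using that AB by simp
    thus ?thesis
    proof (induction rule: ideal_prod_induct)
      case (prod a b)
      obtain b' y where "c * a * b = b' * m + y" "b' \<in> B" "y \<in> span_O ms"
        using span_O_mult_ideal[OF B Cons(3)[OF prod(1)] prod(2)] by blast
      thus ?case by (auto simp: mult.assoc)
    next
      case (sum x x')
      then obtain b y b' y' where "b \<in> B" "b' \<in> B" "y \<in> span_O ms" "y' \<in> span_O ms"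
        "c * x = b * m + y" "c * x' = b' * m + y'" by auto
      thus ?case
        by (intro bexI[of _ "b + b'"] bexI[of _ "y + y'"])
          (auto simp: algebra_simps intro: span_O_closed fracD(3)[OF B(1)])
    qed
  qed
  then obtain b y where bY: "b \<in> B" "y \<in> span_O ms" "c * m = b * m + y" using mA by blast
  have cb: "c - b \<in> \<O>" using c bY(1) B(2) O_diff by auto
  \<comment> \<open>Since \<open>(c - b) * m = y\<close> lies in the span of \<open>ms\<close>, the
    multiplier \<open>(c - b) * c\<close> dispenses with \<open>m\<close>; it is still 1 modulo
    \<open>B\<close>, as both factors are.\<close>
  show ?case
  proof (rule Cons(1))
    show "set ms \<subseteq> A" using Cons(2) by simp
    fix x assume "x \<in> A"
    then obtain u v where uv: "c * x = u * m + v" "u \<in> \<O>" "v \<in> span_O ms" using Cons(3) by fastforce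
    have "(c - b) * c * x = u * (c * m - b * m) + (c - b) * v" using uv(1) by (simp add: algebra_simps)
    also have "\<dots> = u * y + (c - b) * v" using bY(3) by simp
    also have "\<dots> \<in> span_O ms" by (intro span_O_closed uv bY cb)
    finally show "(c - b) * c * x \<in> span_O ms" .
  next
    have "1 - (c - b) * c = (1 + c) * (1 - c) + c * b" by (simp add: algebra_simps)
    thus "1 - (c - b) * c \<in> B"
      using fracD(3)[OF B(1) fracD(4)[OF B(1) O_closed(1)[OF O_closed(5) c] Cons(4)] fracD(4)[OF B(1) c bY(1)]]
      by simp
  qed
qed

text \<open>\<open>B\<close> is integral because it maps \<open>A\<close> into itself, and
  Nakayama's lemma puts 1 into it. This special case of cancellation is exactly what the pigeonhole
  argument on ideal classes produces.\<close>

lemma iprod_cancel: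
  assumes A: "frac A" and B: "frac B" and AB: "A \<star> B = A"
  shows "B = \<O>"
proof
  show BO: "B \<subseteq> \<O>" using multiplier_subset_O[OF A B] AB by simp
  obtain ms where ms: "set ms \<subseteq> A" "A \<subseteq> span_O ms" using frac_finitely_generated[OF A] .
  have "1 \<in> B" by (rule nakayama[OF A B BO AB ms(1), of 1]) (use ms fracD(2)[OF B] in auto)
  thus "\<O> \<subseteq> B" using fracD(4)[OF B _ \<open>1 \<in> B\<close>] by force
qed

section \<open>Invertibility of fractional ideals and the class group\<close>

lemma frac_pow: "frac A \<Longrightarrow> frac (A \<up> k)"
  using monoid.nat_pow_closed[OF comm_monoid.axioms(1)[OF comm_monoid_FI], of A k] by simp

text \<open>An infinite set has cardinality 0, so \<open>class_number M > 0\<close> is the form in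
  which finiteness of the class group is assumed.\<close>

lemma rcosets_finite:
  assumes "class_number M > 0"
  shows "finite (rcosets\<^bsub>FI\<^esub> \<P>)"
proof (rule card_ge_0_finite)
  show "0 < card (rcosets\<^bsub>FI\<^esub> \<P>)"
    using assms unfolding class_number_def class_group_def Coset.order_def FactGroup_def by (simp only: partial_object.simps)
qed

lemma mem_coset: "frac I \<Longrightarrow> I \<in> \<P> #>\<^bsub>FI\<^esub> I"
proof -
  assume I: "frac I"
  have "pr 1 \<in> \<P>" unfolding PI_eq using M_rat[of 1] by auto
  thus ?thesis using O_iprod[OF I] unfolding pr_one r_coset_def by auto
qed

lemma coset_mem_rcosets:
  "frac I \<Longrightarrow> \<P> #>\<^bsub>FI\<^esub> I \<in> rcosets\<^bsub>FI\<^esub> \<P>"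
  unfolding RCOSETS_def by simp blast

text \<open>By pigeonhole, \<open>A \<up> i = pr c \<star> A \<up> j\<close> for some
  \<open>i < j\<close>. So multiplying \<open>A \<up> i\<close> by
  \<open>A \<up> (j - i) \<star> pr c\<close> changes nothing, and cancellation makes that factor
  the unit ideal.\<close>

lemma power_principal:
  assumes fin: "class_number M > 0" and A: "frac A"
  obtains k :: nat and c where "k > 0" "c \<in> M" "c \<noteq> 0" "A \<up> k \<star> pr c = \<O>"
proof -
  define f where "f k = \<P> #>\<^bsub>FI\<^esub> (A \<up> k)" for k :: nat
  have "range f \<subseteq> rcosets\<^bsub>FI\<^esub> \<P>"
    unfolding f_def by (rule image_subsetI) (rule coset_mem_rcosets[OF frac_pow[OF A]])
  hence "finite (range f)" using rcosets_finite[OF fin] finite_subset by blast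
  hence "\<not> inj f" using finite_imageD infinite_UNIV_nat by blast
  then obtain i j where ij: "i < j" "f i = f j" unfolding inj_on_def by (metis linorder_neqE_nat)
  have "A \<up> i \<in> f i" unfolding f_def by (rule mem_coset[OF frac_pow[OF A]])
  hence "A \<up> i \<in> f j" by (simp only: ij(2))
  then obtain c where c: "c \<in> M" "c \<noteq> 0" "A \<up> i = pr c \<star> A \<up> j"
    by (auto simp: f_def r_coset_def PI_eq)
  define k where "k = j - i"
  have "A \<up> j = A \<up> i \<star> A \<up> k"
    using monoid.nat_pow_mult[OF monoid_FI, of A i k] A ij(1) by (simp add: k_def)
  hence "A \<up> i \<star> (A \<up> k \<star> pr c) = A \<up> i"
    
    unfolding ideal_prod_assoc[symmetric] using c(3) by (simp add: ideal_prod_commute)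
  hence "A \<up> k \<star> pr c = \<O>"
    by (intro iprod_cancel[of "A \<up> i"]) (auto simp: frac_pow A c frac_iprod frac_pr)
  moreover have "k > 0" using ij(1) by (simp add: k_def)
  ultimately show ?thesis using that c(1,2) by blast
qed

lemma comm_group_FI:
  assumes "class_number M > 0" shows "comm_group FI"
proof -
  have "\<exists>B. frac B \<and> B \<star> A = \<O>" if A: "frac A" for A
  proof -
    obtain k :: nat and c where k: "k > 0" "c \<in> M" "c \<noteq> 0" "A \<up> k \<star> pr c = \<O>"
      using power_principal[OF assms A] .
    define B where "B = A \<up> (k - 1) \<star> pr c"
    have "A \<up> k = A \<up> (k - 1) \<star> A" 
      using nat_pow_FI(2)[of A "k - 1"] k(1) by simp
    hence "B \<star> A = \<O>" 
      using k(4) unfolding B_def by (simp add: ideal_prod_assoc ideal_prod_commute[of A])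
    thus ?thesis using frac_iprod[OF frac_pow[OF A] frac_pr[OF k(2,3)]] B_def by blast
  qed
  hence "\<exists>J\<in>carrier FI. J \<otimes>\<^bsub>FI\<^esub> I = \<one>\<^bsub>FI\<^esub>" if "I \<in> carrier FI" for I using that by auto
  thus ?thesis by (intro comm_group.intro comm_monoid_FI monoid.group_l_invI[OF monoid_FI])
qed

lemma frac_invertible:
  assumes "class_number M > 0" "frac A" obtains B where "frac B" "A \<star> B = \<O>"
proof -
  have F: "Group.group FI" by (rule comm_group.axioms(2)[OF comm_group_FI[OF assms(1)]])
  show ?thesis
    using that[of "inv\<^bsub>FI\<^esub> A"] group.r_inv[OF F, of A] group.inv_closed[OF F, of A] assms(2) by simp
qed

lemma
  assumes "class_number M > 0"
  shows normal_PI: "\<P> \<lhd> FI" and group_class_group: "Group.group (class_group M)"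
proof -
  have F: "Group.group FI" by (rule comm_group.axioms(2)[OF comm_group_FI[OF assms]])
  have "subgroup \<P> FI"
  proof (rule group.subgroupI[OF F])
    show "\<P> \<subseteq> carrier FI" by (auto simp: PI_eq frac_pr)
    show "\<P> \<noteq> {}" using M_rat[of 1] by (auto simp: PI_eq)
    show "inv\<^bsub>FI\<^esub> I \<in> \<P>" if I: "I \<in> \<P>" for I
    proof -
      obtain c where c: "I = pr c" "c \<in> M" "c \<noteq> 0" using I by (auto simp: PI_eq)
      have "inv\<^bsub>FI\<^esub> I = pr (inverse c)"
        using c group.inv_equality[OF F, of "pr (inverse c)" "pr c"] pr_inverse[of c]
        by (simp add: frac_pr M_inverse ideal_prod_commute)
      thus ?thesis using c M_inverse by (auto simp: PI_eq)
    qed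
    show "I \<otimes>\<^bsub>FI\<^esub> J \<in> \<P>"
      if "I \<in> \<P>" "J \<in> \<P>" for I J
      using that by (auto simp: PI_eq pr_mult) (metis M_mult mult_eq_0_iff)
  qed
  thus N: "\<P> \<lhd> FI" by (rule comm_group.subgroup_imp_normal[OF comm_group_FI[OF assms]])
  show "Group.group (class_group M)"
    unfolding class_group_def by (rule normal.factorgroup_is_group[OF N])
qed

lemma ideal_class_hom:
  assumes "class_number M > 0"
  shows "ideal_class M \<in> hom FI (class_group M)"
  using normal.r_coset_hom_Mod[OF normal_PI[OF assms]] unfolding class_group_def ideal_class_def[abs_def] .

lemma one_class_group: "\<one>\<^bsub>class_group M\<^esub> = \<P>"
  by (simp add: class_group_def FactGroup_def)

lemma ideal_class_eq_one:
  assumes "class_number M > 0" "frac I" "ideal_class M I = \<one>\<^bsub>class_group M\<^esub>"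
  shows "I \<in> \<P>"
  using mem_coset[OF assms(2)] assms(3) unfolding ideal_class_def one_class_group by (simp only:)

lemma power_class_number_principal:
  assumes cl: "class_number M > 0" and I: "frac I"
  shows "I \<up> class_number M \<in> \<P>"
proof -
  have F: "Group.group FI" by (rule comm_group.axioms(2)[OF comm_group_FI[OF cl]])
  have C: "Group.group (class_group M)" by (rule group_class_group[OF cl])
  have h: "group_hom FI (class_group M) (ideal_class M)"
    by (intro group_hom.intro group_hom_axioms.intro F C ideal_class_hom[OF cl])
  have x: "ideal_class M I \<in> carrier (class_group M)" using group_hom.hom_closed[OF h] I by simp
  have "ideal_class M I [^]\<^bsub>class_group M\<^esub> class_number M = \<one>\<^bsub>class_group M\<^esub>"
    using group.pow_eq_id[OF C x] group.ord_dvd_group_order[OF C x] by (simp add: class_number_def)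
  hence "ideal_class M (I \<up> class_number M) = \<one>\<^bsub>class_group M\<^esub>"
    using group_hom.hom_nat_pow[OF h, of I] I by simp
  thus ?thesis by (rule ideal_class_eq_one[OF cl frac_pow[OF I]])
qed

text \<open>By Lagrange a subgroup of a group of prime order is trivial or everything, and the class
  of the nonprincipal \<open>I\<close> is not the identity.\<close>

lemma generate_class_group:
  assumes p: "Factorial_Ring.prime (class_number M)" and T: "\<And>I. I \<in> T \<Longrightarrow> frac I"
    and I: "I \<in> T" "I \<notin> \<P>"
  shows "generate (class_group M) (ideal_class M ` T) = carrier (class_group M)"
proof -
  have cl: "class_number M > 0" using p prime_gt_0_nat by blast
  have C: "Group.group (class_group M)" by (rule group_class_group[OF cl])
  have sub: "ideal_class M ` T \<subseteq> carrier (class_group M)"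
    using ideal_class_hom[OF cl] T unfolding hom_def by auto
  define U where "U = generate (class_group M) (ideal_class M ` T)"
  have U: "subgroup U (class_group M)" unfolding U_def by (rule group.generate_is_subgroup[OF C sub])
  have fin: "finite (carrier (class_group M))"
    using cl unfolding class_number_def Coset.order_def by (rule card_ge_0_finite)
  have "card U dvd class_number M" unfolding class_number_def using group.lagrange[OF C U] by (metis dvd_triv_right)
  hence "card U = 1 \<or> card U = class_number M" using p by (auto simp: prime_nat_iff)
  moreover have "card U \<noteq> 1"
  proof
    assume "card U = 1"
    then obtain x where "U = {x}" by (auto simp: card_1_singleton_iff)
    moreover have "\<one>\<^bsub>class_group M\<^esub> \<in> U" using U by (rule subgroup.one_closed)
    moreover have "ideal_class M I \<in> U" unfolding U_def using I(1) by (intro generate.incl) auto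
    ultimately have "ideal_class M I = \<one>\<^bsub>class_group M\<^esub>" by auto
    thus False using ideal_class_eq_one[OF cl T[OF I(1)]] I(2) by blast
  qed
  ultimately have "card U = card (carrier (class_group M))" by (simp add: class_number_def Coset.order_def)
  thus ?thesis using fin subgroup.subset[OF U] card_subset_eq unfolding U_def by blast
qed

end


section \<open>A nonprincipal ideal of the quadratic field\<close>

text \<open>Descent on \<open>b\<close>: multiplying \<open>a + b \<surd>(s\<^sup>2 + 4)\<close> by the unit \<open>(s - \<surd>(s\<^sup>2 + 4)) / 2\<close>
  preserves the norm up to its sign and decreases \<open>\<bar>b\<bar>\<close>.\<close>

lemma no_small_quadratic_norm:
  fixes a b :: int and s q :: nat
  assumes q: "q > 0" "q < s" "odd s" "\<nexists>t. t * t = q"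
  shows "\<bar>a\<^sup>2 - (int s ^ 2 + 4) * b\<^sup>2\<bar> \<noteq> 4 * int q"
proof (induction "nat \<bar>b\<bar>" arbitrary: a b rule: less_induct)
  case less
  define S where "S = int s"
  have S: "S > int q" "odd S" "int q > 0" using q by (auto simp: S_def)
  show ?case unfolding S_def[symmetric]
  proof
    assume eq: "\<bar>a\<^sup>2 - (S\<^sup>2 + 4) * b\<^sup>2\<bar> = 4 * int q"
    have parity: "even a \<longleftrightarrow> even b"
    proof -
      have "even (a\<^sup>2 - (S\<^sup>2 + 4) * b\<^sup>2)" using eq by (metis dvd_abs_iff dvd_mult2 even_numeral)
      thus ?thesis using S(2) by simp
    qed
    show False
    proof (cases "b = 0")
      case True
      hence "even a" using parity by simp
      then obtain t where "a = 2 * t" by auto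
      hence "t\<^sup>2 = int q" using eq True by simp
      hence "nat \<bar>t\<bar> * nat \<bar>t\<bar> = q" by (simp add: power2_eq_square nat_mult_distrib[symmetric] abs_mult_self_eq flip: nat_abs_mult_distrib)
      thus False using q(4) by blast
    next
      case False
      define A B where "A = \<bar>a\<bar>" and "B = \<bar>b\<bar>"
      have B: "B \<ge> 1" using False by (simp add: B_def)
      have eqAB: "\<bar>A\<^sup>2 - (S\<^sup>2 + 4) * B\<^sup>2\<bar> = 4 * int q" using eq by (simp add: A_def B_def)
      have BB: "B\<^sup>2 \<ge> 1" using B by (simp add: one_le_power)
      \<comment> \<open>Here \<open>q < s\<close> enters: the bound confines \<open>A\<close>
        strictly to within \<open>2 * B\<close> of \<open>B * S\<close>.\<close>
      have SB: "4 * (S * B\<^sup>2) > 4 * int q"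
      proof -
        have "S * 1 \<le> S * B\<^sup>2" using BB S(1,3) by (intro mult_left_mono) linarith+
        thus ?thesis using S(1) by linarith
      qed
      have BS: "0 \<le> B * S" using B S by simp
      have upper: "A < B * S + 2 * B"
      proof (rule ccontr)
        assume "\<not> ?thesis"
        hence "(B * S + 2 * B)\<^sup>2 \<le> A\<^sup>2" using B BS by (intro power_mono) linarith+
        moreover have "(B * S + 2 * B)\<^sup>2 = (S\<^sup>2 + 4) * B\<^sup>2 + 4 * (S * B\<^sup>2)"
          by (simp add: power2_eq_square algebra_simps)
        ultimately have "(S\<^sup>2 + 4) * B\<^sup>2 + 4 * (S * B\<^sup>2) \<le> A\<^sup>2" by (simp only:)
        thus False using SB eqAB by linarith
      qed
      have lower: "A > B * S - 2 * B"
      proof (rule ccontr)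
        assume "\<not> ?thesis"
        hence "A\<^sup>2 \<le> (B * S - 2 * B)\<^sup>2" 
          unfolding A_def by (intro power_mono abs_ge_zero) linarith
        moreover have "(B * S - 2 * B)\<^sup>2 = (S\<^sup>2 + 4) * B\<^sup>2 - 4 * (S * B\<^sup>2)"
          by (simp add: power2_eq_square algebra_simps)
        ultimately have "A\<^sup>2 \<le> (S\<^sup>2 + 4) * B\<^sup>2 - 4 * (S * B\<^sup>2)" by (simp only:)
        thus False using SB eqAB by linarith
      qed
      \<comment> \<open>With \<open>R\<close> the square root of \<open>S\<^sup>2 + 4\<close>, the
        product of \<open>A + B * R\<close> and the unit \<open>(S - R) / 2\<close> of norm -1 is
        \<open>a' - b' * R\<close>. The bounds on \<open>A\<close> say that
        \<open>\<bar>b'\<bar> < B\<close>.\<close>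
      have "even (S * A - (S\<^sup>2 + 4) * B)" "even (A - B * S)"
        using parity S(2) by (auto simp: A_def B_def)
      then obtain a' b' where ab: "S * A - (S\<^sup>2 + 4) * B = 2 * a'" "A - B * S = 2 * b'" unfolding dvd_def by blast
      have "4 * (a'\<^sup>2 - (S\<^sup>2 + 4) * b'\<^sup>2) = (2 * a')\<^sup>2 - (S\<^sup>2 + 4) * (2 * b')\<^sup>2" by (simp add: power2_eq_square)
      also have "\<dots> = - 4 * (A\<^sup>2 - (S\<^sup>2 + 4) * B\<^sup>2)"
        by (simp only: ab[symmetric]) (simp add: power2_eq_square algebra_simps)
      finally have "4 * (a'\<^sup>2 - (S\<^sup>2 + 4) * b'\<^sup>2) = - 4 * (A\<^sup>2 - (S\<^sup>2 + 4) * B\<^sup>2)" .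
      moreover have "\<bar>x\<bar> = c" if "4 * x = - 4 * y" "\<bar>y\<bar> = c" for x y c :: int using that by linarith
      ultimately have "\<bar>a'\<^sup>2 - (S\<^sup>2 + 4) * b'\<^sup>2\<bar> = 4 * int q" using eqAB by blast
      moreover have "nat \<bar>b'\<bar> < nat \<bar>b\<bar>" using upper lower ab(2) by (auto simp: B_def)
      ultimately show False using less[of b' a'] by (simp add: S_def)
    qed
  qed
qed

lemma denominator_evq: "algebraic_int z \<Longrightarrow> \<exists>k>0. algebraic_int (of_nat k * evq p z)"
proof (induction p)
  case (pCons c p)
  then obtain k where k: "k > 0" "algebraic_int (of_nat k * evq p z)" by auto
  obtain a b where c: "c = Rat.Fract a b" "b > 0" using Rat_cases by blast
  have "of_rat c = (of_int a / of_int b :: complex)" using c by (simp add: of_rat_rat)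
  moreover have b: "(of_nat (nat b) :: complex) = of_int b" using c(2) by simp
  ultimately have "of_nat (k * nat b) * evq (pCons c p) z = of_nat k * of_int a + of_int b * z * (of_nat k * evq p z)"
    using c(2) by (simp add: field_simps)
  also have "algebraic_int \<dots>"
    by (rule algebraic_int_add[OF algebraic_int_mult[OF algebraic_int_of_nat algebraic_int_of_int]
          algebraic_int_mult[OF algebraic_int_mult[OF algebraic_int_of_int pCons.prems] k(2)]])
  finally show ?case using k(1) c(2) by (intro exI[of _ "k * nat b"]) simp
qed (auto intro: exI[of _ 1])

section \<open>Subfields of the cyclotomic field as instances of the ideal theory\<close>

context cyclotomic
begin

text \<open>The natural multiple of an integral \<open>x\<close> is its norm over \<open>G\<close>
  up to sign. The cofactor is integral as the product of the other conjugates, and it lies in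
  \<open>M\<close> as the rational norm divided by \<open>x\<close>.\<close>

lemma number_ring_subfield:
  assumes M: "M \<subseteq> K" "\<And>x y. x \<in> M \<Longrightarrow> y \<in> M \<Longrightarrow> x + y \<in> M" "\<And>x y. x \<in> M \<Longrightarrow> y \<in> M \<Longrightarrow> x * y \<in> M"
    "\<And>x. x \<in> M \<Longrightarrow> - x \<in> M" "\<And>x. x \<in> M \<Longrightarrow> inverse x \<in> M" "\<And>x. x \<in> \<rat> \<Longrightarrow> x \<in> M"
  shows "number_ring M"
proof
  show "\<exists>k>0. of_nat k * x \<in> integers_of M" if x: "x \<in> M" for x
  proof -
    obtain p where "x = evq p \<zeta>" using x M(1) unfolding K_eq by blast
    then obtain k where "k > 0" "algebraic_int (of_nat k * x)" using denominator_evq[OF algebraic_int_\<zeta>] by blast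
    thus ?thesis using x M(3,6) by (auto simp: integers_of_def)
  qed
  show "\<exists>y\<in>integers_of M. \<exists>k>0. x * y = of_nat k" if x: "x \<in> integers_of M" "x \<noteq> 0" for x
  proof -
    have xK: "x \<in> K" "algebraic_int x" using x M(1) by (auto simp: integers_of_def)
    define N where "N = (\<Prod>a\<in>G. gal a x)"
    define y where "y = (\<Prod>a\<in>G - {1}. gal a x)"
    have N: "N = x * y" unfolding N_def y_def
      using prod.remove[OF finite_G one_in_G, of "\<lambda>a. gal a x"] gal_one[OF xK(1)] by simp
    have "N \<noteq> 0" unfolding N_def using gal_eq_0_iff xK(1) x(2) finite_G by simp
    have "N \<in> \<rat>"
    proof (rule fixed_field)
      show "N \<in> K" unfolding N_def by (rule K_closed') (simp add: gal_closed xK)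
      fix b assume b: "b \<in> G"
      have "gal b N = (\<Prod>a\<in>G. gal (a * b mod n) x)"
        unfolding N_def using b xK(1) by (simp add: gal_prod gal_closed gal_gal mult.commute)
      also have "\<dots> = N" unfolding N_def by (rule prod.reindex_bij_betw[OF bij_betw_G[OF b]])
      finally show "gal b N = N" .
    qed
    moreover have "algebraic_int N" unfolding N_def by (rule algebraic_int_prod) (simp add: gal_algebraic_int xK)
    ultimately have "N \<in> \<int>" by (rule rational_algebraic_int_is_int[rotated])
    then obtain k where k: "N = of_int k" by (auto elim: Ints_cases)
    have "algebraic_int y" unfolding y_def by (rule algebraic_int_prod) (simp add: gal_algebraic_int xK)
    moreover have "y = N * inverse x" using N x(2) by simp
    hence "y \<in> M" using \<open>N \<in> \<rat>\<close> x(1) M(3,5,6) by (simp add: integers_of_def)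
    ultimately have "of_int (sgn k) * y \<in> integers_of M"
      using M(3,6) by (auto simp: integers_of_def intro!: algebraic_int_mult)
    moreover have "x * (of_int (sgn k) * y) = of_nat (nat \<bar>k\<bar>)"
    proof -
      have "x * (of_int (sgn k) * y) = of_int (sgn k * k)" using N k by (simp add: ac_simps)
      also have "sgn k * k = int (nat \<bar>k\<bar>)" using abs_sgn[of k] by (simp only: nat_0_le abs_ge_zero mult.commute)
      finally show ?thesis by (simp only: of_int_of_nat_eq)
    qed
    moreover have "nat \<bar>k\<bar> > 0" using \<open>N \<noteq> 0\<close> k by simp
    ultimately show ?thesis by blast
  qed
  show "\<exists>S. finite S \<and> S \<subseteq> integers_of M \<and>
      (\<forall>x\<in>integers_of M. \<exists>s\<in>S. \<exists>z\<in>integers_of M. x = s + of_nat N * z)" if N: "N > 0" for N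
  proof -
    have "x - y \<in> M" if "x \<in> M" "y \<in> M" for x y using M(2)[OF that(1) M(4)[OF that(2)]] by simp
    moreover have "x * c \<in> M" if "x \<in> M" "c \<in> \<rat>" for x c using M(3)[OF that(1) M(6)[OF that(2)]] .
    ultimately show ?thesis using finite_residues[OF M(1) _ _ N] by metis
  qed
qed (fact M)+

end

text \<open>For \<open>s = (2 * m + 1) * q\<close> the odd cofactor \<open>2 * m + 1 \<ge> 3\<close>
  is recorded by \<open>q dvd s\<close>, \<open>q < s\<close> and the oddness of
  \<open>s\<close>.\<close>

locale twisted_square =
  fixes n s q :: nat
  assumes n_eq: "n = s\<^sup>2 + 4" and n_squarefree: "squarefree n" and prime_q: "Factorial_Ring.prime q"
    and odd_q: "odd q" and q_dvd_s: "q dvd s" and q_less_s: "q < s" and odd_s: "odd s"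
begin

lemma q_ge_3: "q \<ge> 3"
  using prime_ge_2_nat[OF prime_q] odd_q by (cases "q = 2") auto

text \<open>The bound by \<open>q + 1\<close> will keep \<open>\<zeta> ^ (q + 1)\<close> and
  \<open>\<zeta> ^ (q - 1)\<close> different from 1.\<close>

lemma n_gt: "n > q + 1" "n > 2"
proof -
  have "q * q \<le> s * s" using q_less_s by (intro mult_mono) auto
  thus "n > q + 1" "n > 2" using q_ge_3 mult_le_mono1[OF q_ge_3, of q] unfolding n_eq power2_eq_square by linarith+
qed

lemma odd_n: "odd n" using odd_s by (simp add: n_eq)

lemma coprime_n_q: "coprime n q"
proof -
  have "\<not> q dvd n"
  proof
    assume "q dvd n"
    moreover have "q dvd s\<^sup>2" using q_dvd_s by (simp add: power2_eq_square)
    ultimately have "q dvd 2 ^ 2" unfolding n_eq by (simp add: dvd_add_right_iff)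
    hence "q dvd 2" using prime_dvd_power[OF prime_q] by blast
    thus False using q_ge_3 by (auto dest: dvd_imp_le)
  qed
  thus ?thesis using prime_imp_coprime[OF prime_q] coprime_commute by blast
qed

abbreviation r :: complex where "r \<equiv> complex_of_real (sqrt (real n))"

lemma r_sq: "r\<^sup>2 = of_nat n"
  by (simp flip: of_real_power)

text \<open>A rational root of \<open>n\<close> would be an odd integer above \<open>s\<close>, so
  at least \<open>s + 2\<close>, whose square exceeds \<open>s\<^sup>2 + 4\<close>.\<close>

lemma r_irrational: "r \<notin> \<rat>"
proof
  assume "r \<in> \<rat>"
  moreover have "algebraic_int r" by (rule algebraic_int_if_power[of r 2]) (simp_all add: r_sq)
  ultimately have "r \<in> \<int>" by (rule rational_algebraic_int_is_int[rotated])
  then obtain k where "r = of_int k" by (auto elim: Ints_cases)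
  hence "of_int (k\<^sup>2) = (of_int (int n) :: complex)" using r_sq by simp
  hence k: "k\<^sup>2 = int n" by (simp only: of_int_eq_iff)
  define t where "t = \<bar>k\<bar>"
  have t: "t\<^sup>2 = int s ^ 2 + 4" using k by (simp add: t_def n_eq)
  have "t\<^sup>2 > int s ^ 2" using t by simp
  hence "t > int s" by (rule power_less_imp_less_base) (simp add: t_def)
  moreover have "odd (int s ^ 2 + 4)" using odd_s by simp
  hence "odd t" by (simp add: t[symmetric])
  hence "t \<noteq> int s + 1" using odd_s by auto
  ultimately have "t \<ge> int s + 2" by linarith
  hence "(int s + 2)\<^sup>2 \<le> t\<^sup>2" by (intro power_mono) linarith+
  moreover have "(int s + 2)\<^sup>2 = int s ^ 2 + 4 * int s + 4" by (simp add: power2_eq_square algebra_simps)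
  ultimately show False using t q_less_s by linarith
qed

text \<open>Modulo \<open>n\<close> the square of \<open>s\<close> is -4, so \<open>s / 2\<close> is
  a root of -1; \<open>h\<close> is the inverse of 2.\<close>

lemma minus_one_square: "\<exists>i. n dvd i\<^sup>2 + 1"
proof -
  define h where "h = (n + 1) div 2"
  have h: "2 * h = n + 1" using odd_n by (simp add: h_def)
  have "4 * ((s * h)\<^sup>2 + 1) = s\<^sup>2 * (2 * h)\<^sup>2 + 4" by (simp add: power_mult_distrib)
  also have "\<dots> = n * (s\<^sup>2 * (n + 2) + 1)" unfolding h n_eq by (simp add: power2_eq_square algebra_simps)
  finally have "n dvd 4 * ((s * h)\<^sup>2 + 1)" by simp
  moreover have "coprime n 4" using odd_n by (metis coprime_left_2_iff_odd coprime_commute coprime_power_right_iff num_double numeral_times_numeral power2_eq_square)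
  ultimately show ?thesis using coprime_dvd_mult_right_iff by blast
qed

end

sublocale twisted_square \<subseteq> cyclotomic n
  by unfold_locales (rule n_gt)

sublocale twisted_square \<subseteq> cyclotomic_sqrt n r
proof unfold_locales
  show "r \<in> K" using minus_one_square sqrt_in_K[OF odd_n] by blast
qed (rule odd_n r_sq r_irrational | simp)+


text \<open>In lowest terms the squared denominator of \<open>w\<close> divides
  \<open>n\<close>.\<close>

lemma rational_sqrt_squarefree_int:
  fixes n :: nat and w :: rat
  assumes "squarefree n" "of_nat n * w\<^sup>2 = of_int t"
  shows "w \<in> \<int>"
proof -
  obtain a b where w: "w = of_int a / of_int b" "b > 0" "coprime a b"
    by (metis Rat_cases of_int_rat quotient_of_denom_pos quotient_of_coprime quotient_of_div surj_pair)
  have "of_int (int n * a\<^sup>2) = (of_int (t * b\<^sup>2) :: rat)"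
    using assms(2) w(1,2) by (simp add: field_simps)
  hence "int n * a\<^sup>2 = t * b\<^sup>2" by (simp only: of_int_eq_iff)
  hence "b\<^sup>2 dvd int n * a\<^sup>2" by simp
  moreover have "coprime (b\<^sup>2) (a\<^sup>2)" using w(3) by (simp add: coprime_commute)
  ultimately have "b\<^sup>2 dvd int n" by (simp add: coprime_dvd_mult_left_iff)
  hence "(nat b)\<^sup>2 dvd n" using w(2) by (metis int_dvd_int_iff nat_0_le of_nat_power order_less_imp_le)
  hence "nat b dvd 1" using assms(1) by (auto simp: squarefree_def)
  hence "b = 1" using w(2) by simp
  thus ?thesis using w(1) by simp
qed

text \<open>The field is a parameter, so that the same generators describe an ideal of the quadratic
  field and its extension to the maximal real subfield.\<close>

definition two_generated :: "complex set \<Rightarrow> complex \<Rightarrow> complex \<Rightarrow> complex set" where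
  "two_generated M a b = {a * x + b * y |x y. x \<in> integers_of M \<and> y \<in> integers_of M}"

context number_ring
begin

lemma frac_integral:
  assumes "I \<subseteq> \<O>" "x0 \<in> I" "x0 \<noteq> 0" "\<And>x y. x \<in> I \<Longrightarrow> y \<in> I \<Longrightarrow> x + y \<in> I"
    "\<And>a x. a \<in> \<O> \<Longrightarrow> x \<in> I \<Longrightarrow> a * x \<in> I"
  shows "frac I"
proof (rule fracI[OF _ assms(2-5), of 1])
  show "I \<subseteq> M" using assms(1) O_M by blast
  show "1 * x \<in> \<O>" if "x \<in> I" for x using assms(1) that by auto
qed (simp_all add: O_closed)

lemma two_generated_mem: "a \<in> two_generated M a b" "b \<in> two_generated M a b"
proof -
  have "a = a * 1 + b * 0" "b = a * 0 + b * 1" by simp_all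
  thus "a \<in> two_generated M a b" "b \<in> two_generated M a b"
    unfolding two_generated_def using O_closed(4,5) by blast+
qed

lemma two_generated_integral: "a \<in> \<O> \<Longrightarrow> b \<in> \<O> \<Longrightarrow> two_generated M a b \<subseteq> \<O>"
  unfolding two_generated_def by (auto intro!: O_closed)

lemma two_generated_closed:
  "x \<in> two_generated M a b \<Longrightarrow> y \<in> two_generated M a b \<Longrightarrow> x + y \<in> two_generated M a b"
  "c \<in> \<O> \<Longrightarrow> x \<in> two_generated M a b \<Longrightarrow> c * x \<in> two_generated M a b"
proof -
  assume "x \<in> two_generated M a b" "y \<in> two_generated M a b"
  then obtain u v u' v' where uv: "x = a * u + b * v" "y = a * u' + b * v'" "u \<in> \<O>" "v \<in> \<O>" "u' \<in> \<O>" "v' \<in> \<O>"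
    unfolding two_generated_def by blast
  hence "x + y = a * (u + u') + b * (v + v')" by (simp add: algebra_simps)
  thus "x + y \<in> two_generated M a b" unfolding two_generated_def using uv O_closed(1) by blast
next
  assume c: "c \<in> \<O>" "x \<in> two_generated M a b"
  then obtain u v where uv: "x = a * u + b * v" "u \<in> \<O>" "v \<in> \<O>"
    unfolding two_generated_def by blast
  hence "c * x = a * (c * u) + b * (c * v)" by (simp add: algebra_simps)
  thus "c * x \<in> two_generated M a b" unfolding two_generated_def using uv c O_closed(2) by blast
qed

lemma frac_two_generated: "a \<in> \<O> \<Longrightarrow> b \<in> \<O> \<Longrightarrow> a \<noteq> 0 \<Longrightarrow> frac (two_generated M a b)"
  by (rule frac_integral[OF two_generated_integral two_generated_mem(1) _ two_generated_closed])

lemma principal_iff: "I \<in> \<P> \<longleftrightarrow> (\<exists>c\<in>M. c \<noteq> 0 \<and> I = (\<lambda>x. c * x) ` \<O>)"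
  unfolding principal_fractional_ideals_def by blast

lemma power_mem:
  assumes "frac I" "a \<in> I" "b \<in> I"
  shows "a ^ i * b ^ j \<in> I \<up> (i + j)"
proof (induction i)
  case 0
  show ?case
  proof (induction j)
    case (Suc j)
    have "a ^ 0 * b ^ Suc j = (a ^ 0 * b ^ j) * b" by simp
    thus ?case using ideal_prodI[OF Suc assms(3)] by (simp only: add_Suc_right nat_pow_FI)
  qed (simp add: O_closed nat_pow_FI)
next
  case (Suc i)
  have "a ^ Suc i * b ^ j = (a ^ i * b ^ j) * a" by simp
  thus ?case using ideal_prodI[OF Suc assms(2)] by (simp only: add_Suc nat_pow_FI)
qed

text \<open>\<open>A\<close> may be larger than the ring of integers at hand: it will be that of the
  maximal real subfield, with \<open>I\<close> an ideal of the quadratic field.\<close>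

lemma power_subset:
  assumes "I \<subseteq> (\<lambda>x. a * x) ` A" "\<And>x y. x \<in> A \<Longrightarrow> y \<in> A \<Longrightarrow> x + y \<in> A" "\<And>x y. x \<in> A \<Longrightarrow> y \<in> A \<Longrightarrow> x * y \<in> A"
    "\<O> \<subseteq> A"
  shows "I \<up> k \<subseteq> (\<lambda>x. a ^ k * x) ` A"
proof (induction k)
  case (Suc k)
  show ?case unfolding nat_pow_FI
  proof (rule ideal_prod_subset)
    fix x y assume "x \<in> I \<up> k" "y \<in> I"
    then obtain u v where "x = a ^ k * u" "y = a * v" "u \<in> A" "v \<in> A" using Suc assms(1) by blast
    moreover from this have "x * y = a ^ Suc k * (u * v)" by simp
    ultimately show "x * y \<in> (\<lambda>x. a ^ Suc k * x) ` A" using assms(3) by blast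
  next
    fix x y assume "x \<in> (\<lambda>x. a ^ Suc k * x) ` A" "y \<in> (\<lambda>x. a ^ Suc k * x) ` A"
    then obtain u v where "x = a ^ Suc k * u" "y = a ^ Suc k * v" "u \<in> A" "v \<in> A" by blast
    moreover from this have "x + y = a ^ Suc k * (u + v)" by (simp only: distrib_left)
    ultimately show "x + y \<in> (\<lambda>x. a ^ Suc k * x) ` A" using assms(2) by blast
  qed
qed (use assms(4) in \<open>simp add: nat_pow_FI\<close>)

text \<open>For \<open>x \<in> I\<close> the element \<open>x / d\<close> is integral because its \<open>h\<close>-th power is;
  this gives one inclusion, and the other one follows from it by comparing \<open>h\<close>-th powers.\<close>

lemma principal_if_power_eq:
  assumes I: "frac I" and h: "h > 0" and d: "d \<in> M" "d \<noteq> 0"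
    and eq: "I \<up> h = (\<lambda>x. d ^ h * x) ` \<O>"
  shows "I = (\<lambda>x. d * x) ` \<O>"
proof
  show sub: "I \<subseteq> (\<lambda>x. d * x) ` \<O>"
  proof
    fix x assume x: "x \<in> I"
    have "x ^ h * x ^ 0 \<in> I \<up> (h + 0)" by (rule power_mem[OF I x x])
    then obtain t where t: "x ^ h = d ^ h * t" "t \<in> \<O>" using eq by auto
    hence "(x / d) ^ h = t" using d(2) by (simp add: power_divide)
    hence "algebraic_int ((x / d) ^ h)" using t(2) by (simp add: integers_of_def)
    hence "algebraic_int (x / d)" using h by (rule algebraic_int_if_power)
    moreover have "x / d \<in> M"
      unfolding divide_inverse using x fracD(1)[OF I] by (intro M_mult M_inverse d) auto
    ultimately have "x / d \<in> \<O>" by (simp add: integers_of_def)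
    thus "x \<in> (\<lambda>x. d * x) ` \<O>" using d(2) by (intro image_eqI[of _ _ "x / d"]) auto
  qed
  \<comment> \<open>For \<open>h = Suc k\<close> this gives \<open>d ^ h = d ^ k * t\<close> with
    \<open>t \<in> I\<close>, that is \<open>d \<in> I\<close>.\<close>
  have pow: "I \<up> Suc k \<subseteq> (\<lambda>x. d ^ k * x) ` I" for k
  proof (induction k)
    case 0
    show ?case unfolding nat_pow_FI using O_iprod[OF I] by simp
  next
    case (Suc k)
    show ?case unfolding nat_pow_FI(2)[of I "Suc k"]
    proof (rule ideal_prod_subset)
      fix x y assume "x \<in> I \<up> Suc k" "y \<in> I"
      then obtain u v where "x = d ^ k * u" "y = d * v" "u \<in> I" "v \<in> \<O>" using Suc sub by blast
      moreover from this have "x * y = d ^ Suc k * (v * u)" by simp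
      moreover have "v * u \<in> I" by (rule fracD(4)[OF I \<open>v \<in> \<O>\<close> \<open>u \<in> I\<close>])
      ultimately show "x * y \<in> (\<lambda>x. d ^ Suc k * x) ` I" by blast
    next
      fix x y assume "x \<in> (\<lambda>x. d ^ Suc k * x) ` I" "y \<in> (\<lambda>x. d ^ Suc k * x) ` I"
      then obtain u v where "x = d ^ Suc k * u" "y = d ^ Suc k * v" "u \<in> I" "v \<in> I" by blast
      moreover from this have "x + y = d ^ Suc k * (u + v)" by (simp only: distrib_left)
      moreover have "u + v \<in> I" by (rule fracD(3)[OF I \<open>u \<in> I\<close> \<open>v \<in> I\<close>])
      ultimately show "x + y \<in> (\<lambda>x. d ^ Suc k * x) ` I" by blast
    qed
  qed
  have "d ^ h * 1 \<in> I \<up> h" unfolding eq using O_closed(5) by blast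
  moreover obtain k where k: "h = Suc k" using h by (cases h) auto
  ultimately obtain t where t: "d ^ h * 1 = d ^ k * t" "t \<in> I" using pow[of k] by auto
  hence "d = t" using d(2) k by simp
  hence "d \<in> I" using t(2) by simp
  thus "(\<lambda>x. d * x) ` \<O> \<subseteq> I" using fracD(4)[OF I _ \<open>d \<in> I\<close>] by (auto simp: mult.commute[of d])
qed

end

section \<open>Norms in the quadratic field and the prime q\<close>

context twisted_square
begin

definition quad :: "complex set" where "quad = adjoin_Q r"

definition L :: "complex set" where "L = max_real_cyclotomic_field n"

definition cj :: nat where "cj = (SOME c. c \<in> G \<and> gal c r = - r)"

lemma cj: "cj \<in> G" "gal cj r = - r"
proof -
  obtain c where "c \<in> G \<and> gal c r = - r" using conjugation_exists by blast
  hence "cj \<in> G \<and> gal cj r = - r" unfolding cj_def by (rule someI)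
  thus "cj \<in> G" "gal cj r = - r" by auto
qed

lemma quad_iff: "x \<in> quad \<longleftrightarrow> (\<exists>u v. x = of_rat u + of_rat v * r)"
proof -
  have "\<exists>u v. evq p r = of_rat u + of_rat v * r" for p
  proof (induction p)
    case 0
    show ?case by (rule exI[of _ 0], rule exI[of _ 0]) simp
  next
    case (pCons c p)
    then obtain u v where "evq p r = of_rat u + of_rat v * r" by blast
    hence "evq (pCons c p) r = of_rat c + of_rat u * r + of_rat v * (r * r)" by (simp add: algebra_simps)
    also have "r * r = of_rat (of_nat n)" using r_sq by (simp add: power2_eq_square)
    also have "of_rat c + of_rat u * r + of_rat v * of_rat (of_nat n) = of_rat (c + v * of_nat n) + of_rat u * r"
      by (simp add: of_rat_add of_rat_mult)
    finally show ?case by blast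
  qed
  moreover have "quad = range (\<lambda>p. evq p r)" unfolding quad_def
    using r_sq by (intro adjoin_Q_eq_range_evq[of "[:- of_nat n, 0, 1:]"]) (auto simp: power2_eq_square of_rat_minus)
  moreover have "of_rat u + of_rat v * r = evq [:u, v:] r" for u v by simp
  ultimately show ?thesis by (metis rangeE rangeI)
qed

lemma L_iff: "x \<in> L \<longleftrightarrow> x \<in> K \<and> cnj x = x"
  by (auto simp: L_def max_real_cyclotomic_field_def K_def Reals_cnj_iff)

lemma quad_sub_L: "quad \<subseteq> L"
proof
  fix x assume "x \<in> quad"
  then obtain u v where "x = of_rat u + of_rat v * r" by (auto simp: quad_iff)
  moreover have "cnj (of_rat u) = of_rat u" for u using cnj_evq[of "[:u:]" 0] by simp
  moreover have "of_rat u \<in> K" for u by (rule K_closed(5)) simp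
  ultimately show "x \<in> L" using r_K unfolding L_iff by simp
qed

lemma L_sub_K: "L \<subseteq> K" by (auto simp: L_iff)

lemma number_ring_quad: "number_ring quad"
  by (rule number_ring_subfield[OF order.trans[OF quad_sub_L L_sub_K]]) (simp_all add: quad_def adjoin_Q_closed)

lemma number_ring_L: "number_ring L"
proof (rule number_ring_subfield[OF L_sub_K])
  show "x \<in> L" if "x \<in> \<rat>" for x
    using that K_closed(5)[OF that] unfolding L_iff
    by (auto elim!: Rats_cases) (metis cnj_evq evq_simps(7))
qed (auto simp: L_iff)

lemma quad_fixed: "a \<in> H \<Longrightarrow> x \<in> quad \<Longrightarrow> gal a x = x"
proof -
  assume a: "a \<in> H" "x \<in> quad"
  then obtain u v where x: "x = of_rat u + of_rat v * r" by (auto simp: quad_iff)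
  have "a \<in> G" "gal a r = r" using a by (auto simp: H_def)
  moreover have "of_rat w \<in> K" for w by (rule K_closed(5)) simp
  ultimately show ?thesis unfolding x using r_K by (simp add: gal_add gal_mult gal_rat)
qed

text \<open>For \<open>x = u + v * r\<close> the trace \<open>2 * u\<close> is an integer, hence so
  is \<open>n * (2 * v)\<^sup>2\<close>, and \<open>2 * v\<close> is one because \<open>n\<close> is
  squarefree. These are \<open>a\<close> and \<open>b\<close>.\<close>

lemma quad_norm:
  assumes x: "x \<in> integers_of quad"
  obtains N a b :: int where "x * gal cj x = of_int N" "4 * N = a\<^sup>2 - int n * b\<^sup>2"
proof -
  have xK: "x \<in> K" "algebraic_int x" using x quad_sub_L L_sub_K by (auto simp: integers_of_def)
  obtain u v where uv: "x = of_rat u + of_rat v * r" using x by (auto simp: quad_iff integers_of_def)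
  have ratK: "of_rat w \<in> K" for w by (rule K_closed(5)) simp
  define y where "y = gal cj x"
  have y: "y = of_rat u - of_rat v * r"
    unfolding uv y_def using r_K ratK cj by (simp add: gal_add gal_mult gal_rat)
  have int: "algebraic_int y" unfolding y_def by (rule gal_algebraic_int[OF cj(1) xK])
  have xy: "x + y = of_rat (2 * u)" by (simp add: uv y of_rat_mult)
  hence "(of_rat (2 * u) :: complex) \<in> \<int>"
    using rational_algebraic_int_is_int[OF algebraic_int_add[OF xK(2) int]] by (simp only: Rats_of_rat)
  then obtain a where "of_rat (2 * u) = (of_int a :: complex)" by (auto elim: Ints_cases)
  hence a: "2 * u = of_int a" by (metis of_rat_eq_iff of_rat_of_int_eq)
  have "x * y = of_rat u * of_rat u - of_rat v * of_rat v * (r * r)" by (simp add: uv y algebra_simps)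
  also have "r * r = of_rat (of_nat n)" using r_sq by (simp add: power2_eq_square)
  also have "of_rat u * of_rat u - of_rat v * of_rat v * of_rat (of_nat n) = of_rat (u * u - v * v * of_nat n)"
    by (simp add: of_rat_diff of_rat_mult)
  finally have N0: "x * y = of_rat (u * u - v * v * of_nat n)" .
  hence "(of_rat (u * u - v * v * of_nat n) :: complex) \<in> \<int>"
    using rational_algebraic_int_is_int[OF algebraic_int_mult[OF xK(2) int]] by (simp only: Rats_of_rat)
  then obtain N where N: "of_rat (u * u - v * v * of_nat n) = (of_int N :: complex)" by (auto elim: Ints_cases)
  hence N': "u * u - v * v * of_nat n = of_int N" by (metis of_rat_eq_iff of_rat_of_int_eq)
  hence "of_nat n * (2 * v)\<^sup>2 = (2 * u)\<^sup>2 - 4 * of_int N" by (simp add: power2_eq_square algebra_simps)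
  also have "\<dots> = of_int (a\<^sup>2 - 4 * N)" by (simp add: a)
  finally have v: "of_nat n * (2 * v)\<^sup>2 = of_int (a\<^sup>2 - 4 * N)" .
  hence "2 * v \<in> \<int>" by (rule rational_sqrt_squarefree_int[OF n_squarefree])
  then obtain b where "2 * v = of_int b" by (auto elim: Ints_cases)
  hence "of_int (int n * b\<^sup>2) = (of_int (a\<^sup>2 - 4 * N) :: rat)" using v by simp
  hence "int n * b\<^sup>2 = a\<^sup>2 - 4 * N" by (simp only: of_int_eq_iff)
  hence "4 * N = a\<^sup>2 - int n * b\<^sup>2" by simp
  moreover have "x * gal cj x = of_int N" using N0 N by (simp only: y_def)
  ultimately show ?thesis using that by blast
qed

lemma r_minus_2: "r - 2 \<in> integers_of quad" "r + 2 \<in> integers_of quad" "of_nat q \<in> integers_of quad"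
proof -
  have "algebraic_int r" by (rule algebraic_int_if_power[of r 2]) (simp_all add: r_sq)
  moreover have "r \<in> quad" unfolding quad_iff by (rule exI[of _ 0], rule exI[of _ 1]) simp
  ultimately have r: "r \<in> integers_of quad" by (simp add: integers_of_def)
  have 2: "(2 :: complex) \<in> integers_of quad" using number_ring.O_closed(6)[OF number_ring_quad, of 2] by simp
  show "r - 2 \<in> integers_of quad" by (rule number_ring.O_diff[OF number_ring_quad r 2])
  show "r + 2 \<in> integers_of quad" by (rule number_ring.O_closed(1)[OF number_ring_quad r 2])
  show "of_nat q \<in> integers_of quad" by (rule number_ring.O_closed(6)[OF number_ring_quad])
qed

text \<open>Adding the conjugate gives \<open>- 4 / q\<close> and \<open>4 / q\<close>, and the odd
  prime \<open>q\<close> does not divide 4.\<close>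

lemma not_algebraic_int_div_q: "\<not> algebraic_int ((r - 2) / of_nat q)" "\<not> algebraic_int ((r + 2) / of_nat q)"
proof -
  have rK: "r - 2 \<in> K" "r + 2 \<in> K" using r_K K_simps'(3)[of 2] by simp_all
  have 2: "gal cj 2 = 2" using gal_rat[OF cj(1), of 2] by simp
  have q: "gal cj (of_nat q) = of_nat q" using gal_rat[OF cj(1)] by simp
  have K2: "2 \<in> K" using K_simps'(3)[of 2] by simp
  have conj: "gal cj ((r - 2) / of_nat q) = (- r - 2) / of_nat q" "gal cj ((r + 2) / of_nat q) = (- r + 2) / of_nat q"
    unfolding divide_inverse using rK r_K K2
    by (simp_all add: gal_mult[OF cj(1)] gal_diff[OF cj(1)] gal_add[OF cj(1)] gal_inverse[OF cj(1)] q 2 cj(2))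
  have "\<not> algebraic_int (4 / of_nat q :: complex)"
  proof
    assume "algebraic_int (4 / of_nat q :: complex)"
    moreover have "4 / of_nat q \<in> (\<rat> :: complex set)" by (intro Rats_divide) auto
    ultimately have "4 / of_nat q \<in> (\<int> :: complex set)" by (rule rational_algebraic_int_is_int)
    then obtain t where "4 / of_nat q = (of_int t :: complex)" by (auto elim: Ints_cases)
    hence "(of_int 4 :: complex) = of_int (t * int q)" using q_ge_3 by (simp add: field_simps)
    hence "4 = t * int q" by (simp only: of_int_eq_iff)
    hence "int q dvd int 4" by (metis dvd_triv_right of_nat_numeral)
    hence "q dvd 4" by (simp only: int_dvd_int_iff)
    hence "q dvd 2 ^ 2" by simp
    hence "q dvd 2" using prime_dvd_power[OF prime_q] by blast
    thus False using q_ge_3 by (auto dest: dvd_imp_le)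
  qed
  hence no: "\<not> algebraic_int (- (4 / of_nat q :: complex))" "\<not> algebraic_int (4 / of_nat q :: complex)" by simp_all
  have K': "(r - 2) / of_nat q \<in> K" "(r + 2) / of_nat q \<in> K" using rK by simp_all
  show "\<not> algebraic_int ((r - 2) / of_nat q)"
  proof
    assume int: "algebraic_int ((r - 2) / of_nat q)"
    hence "algebraic_int ((r - 2) / of_nat q + (- r - 2) / of_nat q)"
      using gal_algebraic_int[OF cj(1) K'(1) int] conj(1) by (auto intro: algebraic_int_add)
    also have "(r - 2) / of_nat q + (- r - 2) / of_nat q = - (4 / of_nat q)" by (simp flip: add_divide_distrib)
    finally show False using no by simp
  qed
  show "\<not> algebraic_int ((r + 2) / of_nat q)"
  proof
    assume int: "algebraic_int ((r + 2) / of_nat q)"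
    hence "algebraic_int ((r + 2) / of_nat q + (- r + 2) / of_nat q)"
      using gal_algebraic_int[OF cj(1) K'(2) int] conj(2) by (auto intro: algebraic_int_add)
    also have "(r + 2) / of_nat q + (- r + 2) / of_nat q = 4 / of_nat q" by (simp flip: add_divide_distrib)
    finally show False using no by simp
  qed
qed

text \<open>The prime \<open>q\<close> splits in the quadratic field, because \<open>n\<close> is congruent to 4 modulo \<open>q\<close>;
  the ideal generated by \<open>q\<close> and \<open>r - 2\<close> is one of the two primes above it.\<close>

lemma quad_ideal_nonprincipal:
  assumes \<alpha>: "two_generated quad (of_nat q) (r - 2) = (\<lambda>x. \<alpha> * x) ` integers_of quad"
  shows False
proof -
  interpret number_ring quad by (rule number_ring_quad)
  have gen: "of_nat q \<in> (\<lambda>x. \<alpha> * x) ` \<O>" "r - 2 \<in> (\<lambda>x. \<alpha> * x) ` \<O>" "\<alpha> \<in> two_generated quad (of_nat q) (r - 2)"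
  proof -
    have "\<alpha> * 1 \<in> (\<lambda>x. \<alpha> * x) ` \<O>" using O_closed(5) by blast
    thus "\<alpha> \<in> two_generated quad (of_nat q) (r - 2)" using \<alpha> by simp
  qed (use two_generated_mem \<alpha> in blast)+
  obtain \<beta> \<gamma> where \<beta>: "of_nat q = \<alpha> * \<beta>" "\<beta> \<in> \<O>" and \<gamma>: "r - 2 = \<alpha> * \<gamma>" "\<gamma> \<in> \<O>" using gen(1,2) by blast
  obtain x y where xy: "\<alpha> = of_nat q * x + (r - 2) * y" "x \<in> \<O>" "y \<in> \<O>"
    using gen(3) unfolding two_generated_def by blast
  have \<alpha>O: "\<alpha> \<in> \<O>" using gen(3) two_generated_integral[OF r_minus_2(3,1)] by blast
  have K: "z \<in> K" "algebraic_int z" if "z \<in> \<O>" for z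
    using that quad_sub_L L_sub_K by (auto simp: integers_of_def)
  have conj_int: "algebraic_int (gal cj z)" if "z \<in> \<O>" for z by (rule gal_algebraic_int[OF cj(1) K[OF that]])
  obtain N a b where N: "\<alpha> * gal cj \<alpha> = of_int N" "4 * N = a\<^sup>2 - int n * b\<^sup>2" using quad_norm[OF \<alpha>O] .
  obtain N' a' b' where N': "\<beta> * gal cj \<beta> = of_int N'" "4 * N' = a'\<^sup>2 - int n * b'\<^sup>2" using quad_norm[OF \<beta>(2)] .
  have "of_int (N * N') = (\<alpha> * \<beta>) * gal cj (\<alpha> * \<beta>)"
    using N(1)[symmetric] N'(1)[symmetric] by (simp add: gal_mult[OF cj(1) K(1)[OF \<alpha>O] K(1)[OF \<beta>(2)]])
  also have "\<dots> = of_int (int q * int q)" unfolding \<beta>(1)[symmetric] using gal_rat[OF cj(1)] by simp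
  finally have "N * N' = int q * int q" by (simp only: of_int_eq_iff)
  hence "nat \<bar>N\<bar> * nat \<bar>N'\<bar> = q ^ 2"
    by (metis abs_mult nat_abs_mult_distrib nat_int of_nat_mult power2_eq_square abs_of_nat)
  hence "nat \<bar>N\<bar> dvd q ^ 2" by (metis dvd_triv_left)
  then obtain i where "i \<le> 2" "nat \<bar>N\<bar> = q ^ i" using divides_primepow_nat[OF prime_q] by auto
  have div_q: "z / of_nat q = w" if "z = of_nat q * w" for z w :: complex
    using that q_ge_3 by simp
  have "i = 0 \<or> i = 1 \<or> i = 2" using \<open>i \<le> 2\<close> by auto
  thus False
  proof (elim disjE)
    assume "i = 1"
    hence "\<bar>4 * N\<bar> = 4 * int q" using \<open>nat \<bar>N\<bar> = q ^ i\<close> by simp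
    hence "\<bar>a\<^sup>2 - (int s ^ 2 + 4) * b\<^sup>2\<bar> = 4 * int q" using N(2) n_eq by simp
    moreover have "\<nexists>t. t * t = q"
      using prime_q by (metis One_nat_def dvd_triv_left mult.right_neutral nat_mult_eq_cancel_disj not_prime_1 not_prime_0 prime_nat_iff)
    ultimately show False using no_small_quadratic_norm[of q s a b] q_ge_3 q_less_s odd_s by auto
  next
    \<comment> \<open>Here \<open>\<alpha>\<close> would be a unit. As
      \<open>(r + 2) * (r - 2) = s\<^sup>2\<close> is divisible by \<open>q\<close>, so is
      \<open>r + 2\<close> times each generator of the ideal, hence
      \<open>(r + 2) * \<alpha>\<close> and \<open>r + 2\<close> itself.\<close>
    assume "i = 0"
    hence "\<bar>N\<bar> = 1" using \<open>nat \<bar>N\<bar> = q ^ i\<close> by simp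
    hence NN: "of_int N * of_int N = (1 :: complex)" by (metis abs_mult_self_eq mult_1 of_int_1 of_int_mult)
    obtain t where t: "s = q * t" using q_dvd_s by auto
    have "(r + 2) * (r - 2) = of_nat n - 4" using r_sq by (simp add: power2_eq_square algebra_simps)
    also have "\<dots> = of_nat q * (of_nat q * of_nat t * of_nat t)" unfolding n_eq t by (simp add: power2_eq_square)
    finally have r: "(r + 2) * (r - 2) = of_nat q * (of_nat q * of_nat t * of_nat t)" .
    have "(r + 2) * \<alpha> = of_nat q * ((r + 2) * x) + ((r + 2) * (r - 2)) * y" unfolding xy(1) by (simp add: algebra_simps)
    also have "\<dots> = of_nat q * ((r + 2) * x + of_nat q * of_nat t * of_nat t * y)" unfolding r by (simp add: algebra_simps)
    finally have e: "(r + 2) * \<alpha> = of_nat q * ((r + 2) * x + of_nat q * of_nat t * of_nat t * y)" .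
    have "r + 2 = (r + 2) * (of_int N * of_int N)" using NN by simp
    also have "\<dots> = ((r + 2) * \<alpha>) * gal cj \<alpha> * of_int N" using N(1)[symmetric] by (simp add: ac_simps)
    finally have "r + 2 = of_nat q * (((r + 2) * x + of_nat q * of_nat t * of_nat t * y) * gal cj \<alpha> * of_int N)"
      by (simp only: e mult.assoc)
    hence "(r + 2) / of_nat q = ((r + 2) * x + of_nat q * of_nat t * of_nat t * y) * gal cj \<alpha> * of_int N"
      by (rule div_q)
    moreover have "algebraic_int (((r + 2) * x + of_nat q * of_nat t * of_nat t * y) * gal cj \<alpha> * of_int N)"
      by (rule algebraic_int_mult[OF algebraic_int_mult[OF algebraic_int_add[OF algebraic_int_mult[OF
          K(2)[OF r_minus_2(2)] K(2)[OF xy(2)]] algebraic_int_mult[OF algebraic_int_mult[OF algebraic_int_mult[OF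
          algebraic_int_of_nat algebraic_int_of_nat] algebraic_int_of_nat] K(2)[OF xy(3)]]]
          conj_int[OF \<alpha>O]] algebraic_int_of_int])
    ultimately show False using not_algebraic_int_div_q(2) by simp
  next
    \<comment> \<open>Here \<open>\<beta>\<close> is a unit, so \<open>\<alpha>\<close> is
      associated with \<open>q\<close>, and \<open>q\<close> would divide
      \<open>r - 2\<close>.\<close>
    assume "i = 2"
    hence "nat \<bar>N'\<bar> = 1"
      using \<open>nat \<bar>N\<bar> * nat \<bar>N'\<bar> = q ^ 2\<close> \<open>nat \<bar>N\<bar> = q ^ i\<close> q_ge_3 by simp
    hence "\<bar>N'\<bar> = 1" by simp
    hence NN: "of_int N' * of_int N' = (1 :: complex)" by (metis abs_mult_self_eq mult_1 of_int_1 of_int_mult)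
    have "r - 2 = \<alpha> * \<gamma> * (of_int N' * of_int N')" using NN \<gamma> by simp
    also have "\<dots> = (\<alpha> * \<beta>) * (\<gamma> * gal cj \<beta> * of_int N')" using N'(1)[symmetric] by (simp add: ac_simps)
    finally have "(r - 2) / of_nat q = \<gamma> * gal cj \<beta> * of_int N'"
      unfolding \<beta>(1)[symmetric] by (rule div_q)
    moreover have "algebraic_int (\<gamma> * gal cj \<beta> * of_int N')"
      by (rule algebraic_int_mult[OF algebraic_int_mult[OF K(2)[OF \<gamma>(2)] conj_int[OF \<beta>(2)]] algebraic_int_of_int])
    ultimately show False using not_algebraic_int_div_q(1) by simp
  qed
qed

end


section \<open>Nonprincipal primes, residue degrees and ramification\<close>

text \<open>Finiteness makes \<open>A\<close> finite-dimensional, so that \<open>dim\<close> really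
  denotes its dimension. In dimension one the single vector \<open>\<one>\<close> is a basis, and
  every element is a scalar.\<close>

lemma field_dim_finite:
  assumes A: "field A" "finite (carrier A)" and K: "subfield K A"
  shows "(ring.dim A over K) (carrier A) \<ge> 1"
    and "(ring.dim A over K) (carrier A) = 1 \<Longrightarrow> carrier A \<subseteq> K"
proof -
  interpret field A by (rule A(1))
  obtain Us where Us: "set Us = carrier A" using finite_list[OF A(2)] by blast
  have "Span K Us = carrier A"
    using Span_in_carrier[of K Us] Span_base_incl[OF K, of Us] Us subringE(1)[OF subfieldE(1)[OF K]] by blast
  hence "finite_dimension K (carrier A)" using Span_finite_dimension[OF K, of Us] Us by simp
  hence dim: "dimension ((dim over K) (carrier A)) K (carrier A)" by (rule finite_dimensionE[OF K])
  have "(dim over K) (carrier A) \<noteq> 0"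
  proof
    assume "(dim over K) (carrier A) = 0"
    hence "carrier A = {\<zero>\<^bsub>A\<^esub>}" using dimension_zero[OF K, of "carrier A"] dim by (simp only:)
    thus False using one_closed one_not_zero by blast
  qed
  thus "(dim over K) (carrier A) \<ge> 1" by simp
  assume one: "(dim over K) (carrier A) = 1"
  have "independent K [\<one>\<^bsub>A\<^esub>]"
    using one_not_zero by (auto intro!: li_Cons li_Nil)
  hence "Span K [\<one>\<^bsub>A\<^esub>] = carrier A"
    using independent_length_eq_dimension[OF K, of 1 "carrier A" "[\<one>\<^bsub>A\<^esub>]"] dim one by simp
  moreover have "Span K [\<one>\<^bsub>A\<^esub>] \<subseteq> K"
  proof
    fix u assume "u \<in> Span K [\<one>\<^bsub>A\<^esub>]"
    then obtain k where "k \<in> K" "u = k \<otimes>\<^bsub>A\<^esub> \<one>\<^bsub>A\<^esub> \<oplus>\<^bsub>A\<^esub> \<zero>\<^bsub>A\<^esub>" by (auto simp: line_extension_mem_iff)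
    moreover from this have "k \<in> carrier A" using subringE(1)[OF subfieldE(1)[OF K]] by blast
    ultimately show "u \<in> K" by simp
  qed
  ultimately show "carrier A \<subseteq> K" by simp
qed

section \<open>Maximal nonprincipal ideals\<close>

context number_ring
begin

definition integral_ideal :: "complex set \<Rightarrow> bool" where
  "integral_ideal I \<longleftrightarrow> I \<subseteq> \<O> \<and> 0 \<in> I \<and> (\<forall>x\<in>I. \<forall>y\<in>I. x + y \<in> I) \<and> (\<forall>a\<in>\<O>. \<forall>x\<in>I. a * x \<in> I)"

lemma integral_idealD:
  assumes "integral_ideal I"
  shows "x \<in> I \<Longrightarrow> x \<in> \<O>" "0 \<in> I" "x \<in> I \<Longrightarrow> y \<in> I \<Longrightarrow> x + y \<in> I" "a \<in> \<O> \<Longrightarrow> x \<in> I \<Longrightarrow> a * x \<in> I"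
    "x \<in> I \<Longrightarrow> y \<in> I \<Longrightarrow> x - y \<in> I"
proof -
  have I: "I \<subseteq> \<O>" "0 \<in> I" "\<forall>x\<in>I. \<forall>y\<in>I. x + y \<in> I" "\<forall>a\<in>\<O>. \<forall>x\<in>I. a * x \<in> I"
    using assms by (simp_all add: integral_ideal_def)
  show "x \<in> I \<Longrightarrow> x \<in> \<O>" using I(1) by blast
  show "0 \<in> I" by fact
  show add: "x \<in> I \<Longrightarrow> y \<in> I \<Longrightarrow> x + y \<in> I" for x y using I(3) by simp
  show mult: "a \<in> \<O> \<Longrightarrow> x \<in> I \<Longrightarrow> a * x \<in> I" for a x using I(4) by simp
  show "x \<in> I \<Longrightarrow> y \<in> I \<Longrightarrow> x - y \<in> I"
    using add[of x "(-1) * y"] mult[of "-1" y] O_closed(3)[OF O_closed(5)] by simp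
qed

lemma frac_integral_ideal: "integral_ideal I \<Longrightarrow> x \<in> I \<Longrightarrow> x \<noteq> 0 \<Longrightarrow> frac I"
  by (rule frac_integral) (auto dest: integral_idealD)

text \<open>Let the finite set \<open>S\<close> represent all residues modulo \<open>N\<close>. An
  ideal containing \<open>N\<close> contains, with each element, a representative of its residue, so
  a strictly larger ideal meets \<open>S\<close> in more elements; maximizing
  \<open>card (J \<inter> S)\<close> suffices.\<close>

lemma exists_maximal_nonprincipal:
  assumes I: "integral_ideal I" "of_nat N \<in> I" "N > 0" "I \<notin> \<P>"
  obtains P where "integral_ideal P" "of_nat N \<in> P" "P \<notin> \<P>"
    "\<And>J. integral_ideal J \<Longrightarrow> P \<subset> J \<Longrightarrow> J \<in> \<P>"
proof -
  obtain S where S: "finite S" "\<And>x. x \<in> \<O> \<Longrightarrow> \<exists>s\<in>S. \<exists>z\<in>\<O>. x = s + of_nat N * z"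
    using finite_residues[OF I(3)] by blast
  define Q where "Q J \<longleftrightarrow> integral_ideal J \<and> of_nat N \<in> J \<and> J \<notin> \<P>" for J
  have "card (J \<inter> S) \<le> card S" for J using S(1) by (intro card_mono) auto
  moreover have "Q I" using I by (simp add: Q_def)
  ultimately obtain P where P: "Q P" "\<And>J. Q J \<Longrightarrow> card (J \<inter> S) \<le> card (P \<inter> S)"
    using ex_has_greatest_nat[of Q I "\<lambda>J. card (J \<inter> S)" "Suc (card S)"] by (metis le_imp_less_Suc)
  have PI: "integral_ideal P" "of_nat N \<in> P" "P \<notin> \<P>" using P(1) by (auto simp: Q_def)
  have "J \<in> \<P>" if J: "integral_ideal J" "P \<subset> J" for J
  proof (rule ccontr)
    assume "J \<notin> \<P>"
    hence "Q J" using J PI(2) by (auto simp: Q_def)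
    hence le: "card (J \<inter> S) \<le> card (P \<inter> S)" by (rule P(2))
    obtain x where x: "x \<in> J" "x \<notin> P" using J(2) by blast
    obtain s z where sz: "s \<in> S" "z \<in> \<O>" "x = s + of_nat N * z" using S(2) integral_idealD(1)[OF J(1) x(1)] by blast
    have Nz: "z * of_nat N \<in> P" by (rule integral_idealD(4)[OF PI(1) sz(2) PI(2)])
    have "x - z * of_nat N \<in> J" using integral_idealD(5)[OF J(1) x(1)] Nz J(2) by blast
    hence "s \<in> J" using sz(3) by (simp add: mult.commute)
    moreover have "s \<notin> P" using integral_idealD(3)[OF PI(1) _ Nz, of s] x(2) sz(3) by (auto simp: mult.commute)
    ultimately have "P \<inter> S \<subset> J \<inter> S" using J(2) sz(1) by blast
    hence "card (P \<inter> S) < card (J \<inter> S)" using S(1) by (intro psubset_card_mono) auto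
    thus False using le by simp
  qed
  thus ?thesis using that PI by blast
qed

text \<open>Suppose \<open>x * y \<in> P\<close> with neither factor in \<open>P\<close>. The ideal
  \<open>J\<close>, generated by \<open>P\<close> and \<open>x\<close>, is strictly larger, hence
  generated by some \<open>c\<close>. The quotient ideal \<open>D\<close> of all \<open>w\<close>
  with \<open>w * c \<in> P\<close> contains \<open>P\<close> and \<open>y\<close>, so it is
  generated by some \<open>e\<close>. Every element of \<open>P\<close> is a multiple of
  \<open>c\<close>, so \<open>P\<close> is \<open>c\<close> times \<open>D\<close>, generated by
  \<open>c * e\<close>: a contradiction.\<close>

lemma maximal_nonprincipal_prime:
  assumes P: "integral_ideal P" "P \<notin> \<P>" "\<exists>x\<in>P. x \<noteq> 0"
    and max: "\<And>J. integral_ideal J \<Longrightarrow> P \<subset> J \<Longrightarrow> J \<in> \<P>"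
  shows "1 \<notin> P" and "x \<in> \<O> \<Longrightarrow> y \<in> \<O> \<Longrightarrow> x * y \<in> P \<Longrightarrow> x \<in> P \<or> y \<in> P"
proof -
  show "1 \<notin> P"
  proof
    assume "1 \<in> P"
    have "x \<in> P" if "x \<in> \<O>" for x using integral_idealD(4)[OF P(1) that \<open>1 \<in> P\<close>] by simp
    hence "P = (\<lambda>x. 1 * x) ` \<O>" using integral_idealD(1)[OF P(1)] by (simp only: mult_1 image_ident) blast
    moreover have "(1 :: complex) \<in> M" "(1 :: complex) \<noteq> 0" using M_rat[of 1] by simp_all
    ultimately show False using P(2) unfolding principal_iff by blast
  qed
  assume xy: "x \<in> \<O>" "y \<in> \<O>" "x * y \<in> P"
  show "x \<in> P \<or> y \<in> P"
  proof (rule ccontr)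
    assume no: "\<not> (x \<in> P \<or> y \<in> P)"
    define J where "J = {p + z * x |p z. p \<in> P \<and> z \<in> \<O>}"
    have J: "integral_ideal J" unfolding integral_ideal_def
    proof (intro conjI ballI subsetI)
      show "w \<in> \<O>" if "w \<in> J" for w
      proof -
        have "\<exists>p z. w = p + z * x \<and> p \<in> P \<and> z \<in> \<O>" using that by (simp only: J_def mem_Collect_eq)
        then obtain p z where "w = p + z * x" "p \<in> P" "z \<in> \<O>" by blast
        thus ?thesis using O_closed(1)[OF integral_idealD(1)[OF P(1)] O_closed(2)[OF _ xy(1)]] by simp
      qed
      have "0 = 0 + 0 * x" by simp
      thus "0 \<in> J" unfolding J_def using integral_idealD(2)[OF P(1)] O_closed(4) by blast
      show "v + w \<in> J" if vw: "v \<in> J" "w \<in> J" for v w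
      proof -
        obtain p z p' z' where "v = p + z * x" "w = p' + z' * x" "p \<in> P" "p' \<in> P" "z \<in> \<O>" "z' \<in> \<O>"
          using vw unfolding J_def by blast
        moreover from this have "v + w = (p + p') + (z + z') * x" by (simp add: algebra_simps)
        ultimately show ?thesis unfolding J_def using integral_idealD(3)[OF P(1)] O_closed(1) by blast
      qed
      show "a * w \<in> J" if aw: "a \<in> \<O>" "w \<in> J" for a w
      proof -
        obtain p z where "w = p + z * x" "p \<in> P" "z \<in> \<O>" using aw(2) unfolding J_def by blast
        moreover from this have "a * w = a * p + (a * z) * x" by (simp add: algebra_simps)
        ultimately show ?thesis unfolding J_def using integral_idealD(4)[OF P(1) aw(1)] O_closed(2)[OF aw(1)] by blast
      qed
    qed
    have PJ: "P \<subseteq> J"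
    proof
      fix p assume "p \<in> P"
      moreover have "p = p + 0 * x" by simp
      ultimately show "p \<in> J" unfolding J_def using O_closed(4) by blast
    qed
    have "x = 0 + 1 * x" by simp
    hence xJ: "x \<in> J" unfolding J_def using integral_idealD(2)[OF P(1)] O_closed(5) by blast
    hence "J \<in> \<P>" using no PJ by (intro max J) blast
    then obtain c where c: "c \<in> M" "c \<noteq> 0" "J = (\<lambda>x. c * x) ` \<O>" unfolding principal_iff by blast
    have cJ: "c \<in> J" unfolding c(3) using O_closed(5) by (intro image_eqI[of _ _ 1]) auto
    define D where "D = {w \<in> \<O>. w * c \<in> P}"
    have D: "integral_ideal D" unfolding integral_ideal_def D_def
      using integral_idealD(2-4)[OF P(1)] O_closed(1,2,4) by (auto simp: distrib_right mult.assoc)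
    have cO: "c \<in> \<O>" by (rule integral_idealD(1)[OF J cJ])
    have PD: "P \<subseteq> D" 
    proof
      fix p assume p: "p \<in> P"
      have "c * p \<in> P" by (rule integral_idealD(4)[OF P(1) cO p])
      thus "p \<in> D" unfolding D_def using integral_idealD(1)[OF P(1) p] by (simp add: mult.commute)
    qed
    obtain p z where pz: "c = p + z * x" "p \<in> P" "z \<in> \<O>" using cJ unfolding J_def by blast
    have "y * c = y * p + z * (x * y)" unfolding pz(1) by (simp add: algebra_simps)
    also have "\<dots> \<in> P"
      by (rule integral_idealD(3)[OF P(1) integral_idealD(4)[OF P(1) xy(2) pz(2)] integral_idealD(4)[OF P(1) pz(3) xy(3)]])
    finally have "y \<in> D" unfolding D_def using xy(2) by simp
    hence "D \<in> \<P>" using no PD by (intro max D) blast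
    then obtain e where e: "e \<in> M" "e \<noteq> 0" "D = (\<lambda>x. e * x) ` \<O>" unfolding principal_iff by blast
    have "P = (\<lambda>x. (c * e) * x) ` \<O>"
    proof (intro equalityI subsetI)
      fix p assume p: "p \<in> P"
      then obtain w where w: "p = c * w" "w \<in> \<O>" using PJ c(3) by blast
      hence "w \<in> D" unfolding D_def using p by (simp add: mult.commute)
      then obtain v where "w = e * v" "v \<in> \<O>" using e(3) by blast
      thus "p \<in> (\<lambda>x. (c * e) * x) ` \<O>" using w(1) by (intro image_eqI[of _ _ v]) auto
    next
      fix p assume "p \<in> (\<lambda>x. (c * e) * x) ` \<O>"
      then obtain v where v: "p = (c * e) * v" "v \<in> \<O>" by blast
      have "e * v \<in> D" unfolding e(3) using v(2) by (rule imageI)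
      hence "(e * v) * c \<in> P" by (simp only: D_def mem_Collect_eq)
      thus "p \<in> P" unfolding v(1) by (simp only: mult.commute mult.left_commute mult.assoc)
    qed
    moreover have "c * e \<in> M" "c * e \<noteq> 0" using c(1,2) e(1,2) M_mult[of c e] by simp_all
    ultimately show False using P(2) unfolding principal_iff by blast
  qed
qed

section \<open>The residue field of a prime ideal above q\<close>

lemma ring_of_integers_simps [simp]:
  "carrier (ring_of_integers M) = \<O>" "monoid.mult (ring_of_integers M) = (*)"
  "\<one>\<^bsub>ring_of_integers M\<^esub> = 1" "\<zero>\<^bsub>ring_of_integers M\<^esub> = 0" "add (ring_of_integers M) = (+)"
  by (simp_all add: ring_of_integers_def)

lemma cring_ring_of_integers: "cring (ring_of_integers M)"
proof (rule cringI)
  show "abelian_group (ring_of_integers M)"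
  proof (rule abelian_groupI)
    show "\<exists>y\<in>carrier (ring_of_integers M). y \<oplus>\<^bsub>ring_of_integers M\<^esub> x = \<zero>\<^bsub>ring_of_integers M\<^esub>"
      if "x \<in> carrier (ring_of_integers M)" for x
      using that O_closed(3) by (intro bexI[of _ "- x"]) auto
  qed (simp_all add: O_closed add.assoc add.commute)
  show "comm_monoid (ring_of_integers M)"
    by (rule comm_monoidI) (simp_all add: O_closed mult.assoc mult.commute)
qed (simp add: distrib_right)

lemma a_inv_ring_of_integers: "x \<in> \<O> \<Longrightarrow> \<ominus>\<^bsub>ring_of_integers M\<^esub> x = - x"
  using abelian_group.minus_equality[OF cring.axioms(1)[OF cring_ring_of_integers, THEN ring.axioms(1)], of "-x" x] O_closed(3)
  by simp

lemma ideal_iff: "ideal I (ring_of_integers M) \<longleftrightarrow> integral_ideal I"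
proof
  assume I: "ideal I (ring_of_integers M)"
  have sub: "additive_subgroup I (ring_of_integers M)" by (rule ideal.axioms(1)[OF I])
  show "integral_ideal I" unfolding integral_ideal_def
    using additive_subgroup.a_subset[OF sub] additive_subgroup.zero_closed[OF sub]
      additive_subgroup.a_closed[OF sub] ideal.I_l_closed[OF I] by simp
next
  assume I: "integral_ideal I"
  have inv: "inv\<^bsub>add_monoid (ring_of_integers M)\<^esub> x = - x" if "x \<in> \<O>" for x
    using a_inv_ring_of_integers[OF that] by (simp add: a_inv_def)
  show "ideal I (ring_of_integers M)"
  proof (rule idealI)
    show "ring (ring_of_integers M)" by (rule cring.axioms(1)[OF cring_ring_of_integers])
    show "subgroup I (add_monoid (ring_of_integers M))"
    proof
      show "I \<subseteq> carrier (add_monoid (ring_of_integers M))" using integral_idealD(1)[OF I] by auto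
      show "x \<otimes>\<^bsub>add_monoid (ring_of_integers M)\<^esub> y \<in> I" if "x \<in> I" "y \<in> I" for x y
        using integral_idealD(3)[OF I that] by simp
      show "\<one>\<^bsub>add_monoid (ring_of_integers M)\<^esub> \<in> I" using integral_idealD(2)[OF I] by simp
      show "inv\<^bsub>add_monoid (ring_of_integers M)\<^esub> x \<in> I" if "x \<in> I" for x
        using inv[OF integral_idealD(1)[OF I that]] integral_idealD(5)[OF I integral_idealD(2)[OF I] that] by simp
    qed
    show "x \<otimes>\<^bsub>ring_of_integers M\<^esub> a \<in> I" "a \<otimes>\<^bsub>ring_of_integers M\<^esub> x \<in> I"
      if "a \<in> I" "x \<in> carrier (ring_of_integers M)" for a x
      using integral_idealD(4)[OF I _ that(1), of x] that(2) by (simp_all add: mult.commute)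
  qed
qed

lemma primeideal_ring_of_integers:
  assumes "integral_ideal P" "1 \<notin> P" "\<And>x y. x \<in> \<O> \<Longrightarrow> y \<in> \<O> \<Longrightarrow> x * y \<in> P \<Longrightarrow> x \<in> P \<or> y \<in> P"
  shows "primeideal P (ring_of_integers M)"
proof (rule primeidealI)
  show "ideal P (ring_of_integers M)" using assms(1) by (simp only: ideal_iff)
  show "carrier (ring_of_integers M) \<noteq> P" using assms(2) O_closed(5) by auto
qed (use assms(3) cring_ring_of_integers in auto)

lemma integers_of_Rats: "integers_of \<rat> = \<int>"
  by (auto simp: integers_of_def rational_algebraic_int_is_int int_imp_algebraic_int elim: Ints_cases)

definition res :: "complex set \<Rightarrow> complex \<Rightarrow> complex set" where
  "res P x = P +>\<^bsub>ring_of_integers M\<^esub> x"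

context
  fixes P q
  assumes P: "integral_ideal P" "1 \<notin> P" "\<And>x y. x \<in> \<O> \<Longrightarrow> y \<in> \<O> \<Longrightarrow> x * y \<in> P \<Longrightarrow> x \<in> P \<or> y \<in> P"
    and q: "Factorial_Ring.prime q" "of_nat q \<in> P"
begin

abbreviation (input) RM :: "complex ring" where "RM \<equiv> ring_of_integers M"

abbreviation (input) RQ :: "complex set ring" where "RQ \<equiv> RM Quot P"

lemma ideal_P: "ideal P RM"
  using P(1) by (simp only: ideal_iff)

lemma res_hom: "res P \<in> Ring.ring_hom RM RQ"
  using ideal.rcos_ring_hom[OF ideal_P] unfolding res_def[abs_def] .

lemma carrier_RQ: "carrier RQ = res P ` \<O>"
  by (auto simp: FactRing_def A_RCOSETS_def' res_def)

lemma res_eq_iff: "x \<in> \<O> \<Longrightarrow> y \<in> \<O> \<Longrightarrow> res P x = res P y \<longleftrightarrow> x - y \<in> P"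
  using ring.quotient_eq_iff_same_a_r_cos[OF cring.axioms(1)[OF cring_ring_of_integers] ideal_P, of x y]
  by (simp add: a_minus_def a_inv_ring_of_integers res_def)

lemma finite_Quot: "finite (carrier RQ)"
proof -
  have "q > 0" using q(1) prime_gt_0_nat by blast
  then obtain S where S: "finite S" "S \<subseteq> \<O>" "\<And>x. x \<in> \<O> \<Longrightarrow> \<exists>s\<in>S. \<exists>z\<in>\<O>. x = s + of_nat q * z"
    using finite_residues[of q] by blast
  have "res P ` \<O> \<subseteq> res P ` S"
  proof
    fix C assume "C \<in> res P ` \<O>"
    then obtain x where x: "C = res P x" "x \<in> \<O>" by blast
    obtain s z where sz: "s \<in> S" "z \<in> \<O>" "x = s + of_nat q * z" using S(3)[OF x(2)] by blast
    have "z * of_nat q \<in> P" by (rule integral_idealD(4)[OF P(1) sz(2) q(2)])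
    hence "x - s \<in> P" using sz(3) by (simp add: mult.commute)
    hence "res P x = res P s" using res_eq_iff[OF x(2)] S(2) sz(1) by blast
    thus "C \<in> res P ` S" using x(1) sz(1) by blast
  qed
  thus ?thesis unfolding carrier_RQ using S(1) by (meson finite_imageI finite_subset)
qed

text \<open>By finiteness two powers \<open>x ^ i\<close> and \<open>x ^ j\<close> with
  \<open>i < j\<close> agree modulo \<open>P\<close>. Primality cancels \<open>x ^ i\<close>, and
  the remaining power of \<open>x\<close> is 1, which exhibits an inverse.\<close>

lemma field_Quot: "field RQ"
proof -
  have cr: "cring RQ" by (rule ideal.quotient_is_cring[OF ideal_P cring_ring_of_integers])
  have one: "\<one>\<^bsub>RQ\<^esub> = res P 1" and zero: "\<zero>\<^bsub>RQ\<^esub> = res P 0"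
    using ring_hom_one[OF res_hom] ring_hom_zero[OF res_hom cring.axioms(1)[OF cring_ring_of_integers] cring.axioms(1)[OF cr]] by simp_all
  show ?thesis
  proof (rule cring.cring_fieldI2[OF cr])
    show "\<zero>\<^bsub>RQ\<^esub> \<noteq> \<one>\<^bsub>RQ\<^esub>"
      unfolding one zero using res_eq_iff[OF O_closed(5) O_closed(4)] P(2) by auto
    fix C assume C: "C \<in> carrier RQ" "C \<noteq> \<zero>\<^bsub>RQ\<^esub>"
    then obtain x where x: "C = res P x" "x \<in> \<O>" unfolding carrier_RQ by blast
    have xP: "x \<notin> P" using C(2) x zero res_eq_iff[OF x(2) O_closed(4)] by auto
    have "range (\<lambda>k::nat. res P (x ^ k)) \<subseteq> carrier RQ" unfolding carrier_RQ using O_power[OF x(2)] by blast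
    hence "\<not> inj (\<lambda>k::nat. res P (x ^ k))" using finite_Quot finite_imageD finite_subset infinite_UNIV_nat by blast
    then obtain i j where ij: "i < j" "res P (x ^ i) = res P (x ^ j)" unfolding inj_on_def by (metis linorder_neqE_nat)
    define k where "k = j - i - 1"
    have j: "j = i + (k + 1)" using ij(1) by (simp add: k_def)
    have "x ^ i - x ^ j \<in> P" using ij(2) res_eq_iff O_power[OF x(2)] by blast
    hence "x ^ i * (1 - x ^ k * x) \<in> P" unfolding j by (simp add: algebra_simps power_add)
    moreover have "x ^ m \<notin> P" for m
    proof (induction m)
      case (Suc m)
      thus ?case using P(3)[OF x(2) O_power[OF x(2)], of m] xP by auto
    qed (use P(2) in simp)
    moreover have "1 - x ^ k * x \<in> \<O>" by (intro O_diff O_closed O_power x)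
    ultimately have "1 - x ^ k * x \<in> P" using P(3)[OF O_power[OF x(2)]] by blast
    hence "res P 1 = res P (x ^ k * x)" using res_eq_iff O_closed(5) O_closed(2)[OF O_power[OF x(2)] x(2)] by blast
    also have "\<dots> = res P (x * x ^ k)" by (simp add: mult.commute)
    also have "\<dots> = res P x \<otimes>\<^bsub>RQ\<^esub> res P (x ^ k)" using ring_hom_mult[OF res_hom, of x "x ^ k"] O_power x(2) by simp
    finally show "\<exists>D\<in>carrier RQ. C \<otimes>\<^bsub>RQ\<^esub> D = \<one>\<^bsub>RQ\<^esub>"
      unfolding one x(1) carrier_RQ using O_power[OF x(2)] by auto
  qed
qed

text \<open>If \<open>q\<close> did not divide \<open>t\<close>, Bezout would put 1 into
  \<open>P\<close>.\<close>

lemma integer_in_P_iff: "of_int t \<in> P \<longleftrightarrow> int q dvd t"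
proof
  assume "int q dvd t"
  then obtain u where "t = u * int q" by (metis dvdE mult.commute)
  thus "of_int t \<in> P" using integral_idealD(4)[OF P(1) O_closed(7) q(2), of u] by simp
next
  assume t: "of_int t \<in> P"
  show "int q dvd t"
  proof (rule ccontr)
    assume "\<not> int q dvd t"
    hence "coprime (int q) t" using q(1) by (intro prime_imp_coprime) auto
    then obtain u v where uv: "u * int q + v * t = 1" using bezout_int[of "int q" t] by auto
    have "of_int u * of_nat q + of_int v * of_int t \<in> P"
      by (rule integral_idealD(3)[OF P(1) integral_idealD(4)[OF P(1) O_closed(7) q(2)] integral_idealD(4)[OF P(1) O_closed(7) t]])
    also have "of_int u * of_nat q + of_int v * of_int t = (of_int (u * int q + v * t) :: complex)" by simp
    finally show False using P(2) uv by simp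
  qed
qed

lemma subfield_prime_field: "subfield (res P ` \<int>) RQ"
proof -
  have ring: "ring RM" "ring RQ"
    by (rule cring.axioms(1)[OF cring_ring_of_integers]) (rule ideal.quotient_is_ring[OF ideal_P])
  have IO: "x \<in> \<int> \<Longrightarrow> x \<in> \<O>" for x using O_closed(7) by (auto elim: Ints_cases)
  have minus: "\<ominus>\<^bsub>RQ\<^esub> res P x = res P (- x)" if "x \<in> \<O>" for x
  proof -
    have "res P (- x) \<oplus>\<^bsub>RQ\<^esub> res P x = res P (- x + x)" using ring_hom_add[OF res_hom, of "-x" x] that O_closed(3) by simp
    also have "\<dots> = \<zero>\<^bsub>RQ\<^esub>" using ring_hom_zero[OF res_hom ring] by simp
    finally show ?thesis
      using abelian_group.minus_equality[OF ring.axioms(1)[OF ring(2)], of "res P (- x)" "res P x"] that O_closed(3)[OF that]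
      unfolding carrier_RQ by blast
  qed
  have sub: "subring (res P ` \<int>) RQ"
  proof (rule ring.subringI[OF ring(2)])
    show "res P ` \<int> \<subseteq> carrier RQ" unfolding carrier_RQ using IO by blast
    show "\<one>\<^bsub>RQ\<^esub> \<in> res P ` \<int>" using ring_hom_one[OF res_hom] by (metis Ints_1 imageI ring_of_integers_simps(3))
    fix C assume "C \<in> res P ` \<int>"
    then obtain x where x: "C = res P x" "x \<in> \<int>" by blast
    show "\<ominus>\<^bsub>RQ\<^esub> C \<in> res P ` \<int>" unfolding x(1) minus[OF IO[OF x(2)]] using x(2) by (intro imageI) simp
    fix D assume "D \<in> res P ` \<int>"
    then obtain y where y: "D = res P y" "y \<in> \<int>" by blast
    have "C \<otimes>\<^bsub>RQ\<^esub> D = res P (x * y)" "C \<oplus>\<^bsub>RQ\<^esub> D = res P (x + y)"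
      using ring_hom_mult[OF res_hom, of x y] ring_hom_add[OF res_hom, of x y] IO x y by simp_all
    thus "C \<otimes>\<^bsub>RQ\<^esub> D \<in> res P ` \<int>" "C \<oplus>\<^bsub>RQ\<^esub> D \<in> res P ` \<int>" using x(2) y(2) by auto
  qed
  show ?thesis
  proof (rule field.subfieldI'[OF field_Quot sub])
    fix C assume C: "C \<in> res P ` \<int> - {\<zero>\<^bsub>RQ\<^esub>}"
    then obtain t where t: "C = res P (of_int t)" by (auto elim: Ints_cases)
    have "of_int t \<notin> P"
      using C t ring_hom_zero[OF res_hom ring] res_eq_iff[OF O_closed(7)[of t] O_closed(4)] by simp
    hence "\<not> int q dvd t" using integer_in_P_iff[of t] by blast
    hence "coprime (int q) t" using q(1) by (intro prime_imp_coprime) simp_all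
    then obtain u v where uv: "u * int q + v * t = 1" using bezout_int[of "int q" t] by auto
    have "of_int v * of_int t - (1 :: complex) = of_int (v * t - 1)" by simp
    also have "v * t - 1 = - u * int q" using uv by simp
    also have "of_int (- u * int q) \<in> P" by (subst integer_in_P_iff) simp
    finally have "res P (of_int v * of_int t) = res P 1"
      using res_eq_iff[OF O_closed(2)[OF O_closed(7)[of v] O_closed(7)[of t]] O_closed(5)] by blast
    hence "res P (of_int v) \<otimes>\<^bsub>RQ\<^esub> C = \<one>\<^bsub>RQ\<^esub>"
      using ring_hom_mult[OF res_hom, of "of_int v" "of_int t"] ring_hom_one[OF res_hom] O_closed(7) by (simp add: t)
    moreover have "C \<otimes>\<^bsub>RQ\<^esub> res P (of_int v) = res P (of_int v) \<otimes>\<^bsub>RQ\<^esub> C"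
      unfolding t using ring_hom_mult[OF res_hom, of "of_int v" "of_int t"] ring_hom_mult[OF res_hom, of "of_int t" "of_int v"]
      by (simp add: O_closed(7) mult.commute)
    ultimately have "inv\<^bsub>RQ\<^esub> C = res P (of_int v)"
      using monoid.inv_char[OF ring.axioms(2)[OF ring(2)], of C "res P (of_int v)"] t O_closed(7)
      unfolding carrier_RQ by (metis imageI)
    thus "inv\<^bsub>RQ\<^esub> C \<in> res P ` \<int>" by auto
  qed
qed

lemma residue_degree_prime:
  shows "residue_degree \<rat> M P \<ge> 1"
    and "residue_degree \<rat> M P = 1 \<Longrightarrow> x \<in> \<O> \<Longrightarrow> \<exists>t. x - of_int t \<in> P"
proof -
  have eq: "residue_degree \<rat> M P = (ring.dim RQ over (res P ` \<int>)) (carrier RQ)"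
    unfolding residue_degree_def integers_of_Rats res_def[abs_def] ..
  show "residue_degree \<rat> M P \<ge> 1"
    unfolding eq by (rule field_dim_finite(1)[OF field_Quot finite_Quot subfield_prime_field])
  assume "residue_degree \<rat> M P = 1" and x: "x \<in> \<O>"
  hence "carrier RQ \<subseteq> res P ` \<int>"
    unfolding eq
    using field_dim_finite(2)[OF field_Quot finite_Quot subfield_prime_field] by blast
  hence "res P x \<in> res P ` \<int>" unfolding carrier_RQ using x by blast
  then obtain t where "res P x = res P (of_int t)" by (auto elim: Ints_cases)
  thus "\<exists>t. x - of_int t \<in> P" using res_eq_iff[OF x O_closed(7)] by blast
qed

text \<open>An exponent of at least 2 would put \<open>q\<close> into \<open>P \<star> P\<close>,
  which contains all higher powers of \<open>P\<close>.\<close>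

lemma ramification_index_eq_1:
  assumes "of_nat q \<notin> P \<star> P"
  shows "ramification_index \<rat> M P = 1"
  unfolding ramification_index_def integers_of_Rats
proof (rule Greatest_equality)
  have fr: "frac P" using frac_integral_ideal[OF P(1) q(2)] prime_gt_0_nat[OF q(1)] by simp
  have ring: "ring RM" by (rule cring.axioms(1)[OF cring_ring_of_integers])
  have P1: "P \<up> 1 = P" using nat_pow_FI(2)[of P 0] O_iprod[OF fr] by (simp add: nat_pow_FI(1))
  show "Idl\<^bsub>RM\<^esub> (P \<inter> \<int>) \<subseteq> P \<up> 1"
    unfolding P1 by (rule ring.genideal_minimal[OF ring ideal_P]) blast
  fix e :: nat assume e: "Idl\<^bsub>RM\<^esub> (P \<inter> \<int>) \<subseteq> P \<up> e"
  show "e \<le> 1"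
  proof (rule ccontr)
    assume "\<not> e \<le> 1"
    then obtain k where k: "e = Suc (Suc k)" by (metis Suc_le_D not_less_eq_eq One_nat_def)
    have "P \<inter> \<int> \<subseteq> carrier RM" using integral_idealD(1)[OF P(1)] by auto
    hence "P \<inter> \<int> \<subseteq> Idl\<^bsub>RM\<^esub> (P \<inter> \<int>)" by (rule ring.genideal_self[OF ring])
    moreover have "of_nat q \<in> P \<inter> \<int>" using q(2) by simp
    ultimately have "of_nat q \<in> Idl\<^bsub>RM\<^esub> (P \<inter> \<int>)" by blast
    hence "of_nat q \<in> P \<up> e" using e by blast
    also have "P \<up> e = (P \<up> k \<star> P) \<star> P" unfolding k nat_pow_FI ..
    also have "\<dots> \<subseteq> P \<star> P"
    proof (rule ideal_prod_mono[OF _ order.refl])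
      have "P \<up> k \<subseteq> \<O>"
        using power_subset[of P 1 \<O> k] integral_idealD(1)[OF P(1)] O_closed(1,2) by auto
      hence "P \<up> k \<star> P \<subseteq> \<O> \<star> P" by (rule ideal_prod_mono) simp
      thus "P \<up> k \<star> P \<subseteq> P" using O_iprod[OF fr] by simp
    qed
    finally show False using assms by simp
  qed
qed

end

end


section \<open>Primes above \<open>q\<close> in the maximal real subfield\<close>

text \<open>Summation by parts, together with the vanishing of the full geometric sum. The explicit
  cofactor shows that \<open>u - 1\<close> divides \<open>n\<close> among the algebraic
  integers.\<close>

lemma root_of_unity_minus_one_dvd:
  fixes u :: complex
  assumes "u ^ n = 1" "u \<noteq> 1"
  shows "(u - 1) * (\<Sum>i<n. of_nat i * u ^ i) = of_nat n"
proof -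
  have "(u - 1) * (\<Sum>i<k. of_nat i * u ^ i) + (\<Sum>i<k. u ^ i) * u = of_nat k * u ^ k" for k
  proof (induction k)
    case (Suc k)
    have "(u - 1) * (\<Sum>i<Suc k. of_nat i * u ^ i) + (\<Sum>i<Suc k. u ^ i) * u
      = ((u - 1) * (\<Sum>i<k. of_nat i * u ^ i) + (\<Sum>i<k. u ^ i) * u) + (u - 1) * (of_nat k * u ^ k) + u ^ k * u"
      by (simp add: algebra_simps)
    also have "\<dots> = of_nat (Suc k) * u ^ Suc k" unfolding Suc by (simp add: algebra_simps)
    finally show ?case .
  qed simp
  from this[of n] show ?thesis
    using assms by (simp only: geometric_sum[OF assms(2)] diff_self div_0 mult_zero_left add_0_right mult_1_right)
qed

text \<open>An odd \<open>n\<close> is coprime to the powers of 2, and \<open>n - 1\<close> is an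
  eighth totative. The bound 85 is \<open>9\<^sup>2 + 4\<close>.\<close>

lemma eight_le_totient:
  assumes "odd n" "n \<ge> 85" shows "8 \<le> totient n"
proof -
  have "{1, 2, 4, 8, 16, 32, 64, n - 1} \<subseteq> totatives n"
  proof -
    have "coprime (2 ^ k) n" for k using assms(1) by simp
    from this[of 0] this[of 1] this[of 2] this[of 3] this[of 4] this[of 5] this[of 6]
    show ?thesis using assms(2) coprime_diff_one_left_nat[of n] by (auto simp: in_totatives_iff)
  qed
  hence "card {1, 2, 4, 8, 16, 32, 64, n - 1} \<le> totient n"
    unfolding totient_def by (intro card_mono) auto
  moreover have "card {1, 2, 4, 8, 16, 32, 64, n - 1} = 8" using assms(2) by simp
  ultimately show ?thesis by simp
qed

context twisted_square
begin

text \<open>Only 1 is coprime to 0, whereas \<open>s \<ge> 3 * 3\<close> makes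
  \<open>\<phi>(n)\<close> at least 8 and its quarter at least 2.\<close>

lemma class_number_quad_pos:
  assumes "coprime (totient n div 4) (class_number quad)" shows "class_number quad > 0"
proof (rule ccontr)
  assume "\<not> ?thesis"
  hence "totient n div 4 = 1" using assms by simp
  moreover have "s \<ge> 9"
  proof -
    obtain t where t: "s = q * t" using q_dvd_s by auto
    hence "t \<noteq> 0" "t \<noteq> 1" "t \<noteq> 2" using q_less_s odd_s by auto
    hence "3 * 3 \<le> q * t" using q_ge_3 by (intro mult_mono) auto
    thus ?thesis using t by simp
  qed
  hence "9 * 9 \<le> s * s" by (intro mult_mono) auto
  hence "n \<ge> 85" by (simp add: n_eq power2_eq_square)
  hence "8 \<le> totient n" by (rule eight_le_totient[OF odd_n])
  ultimately show False by linarith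
qed

lemma H_half_sub: "a \<in> H_half \<Longrightarrow> a \<in> H" "a \<in> H_half \<Longrightarrow> a \<in> G"
  by (simp_all add: H_half_def H_def)

lemma nrm_mult: "x \<in> K \<Longrightarrow> y \<in> K \<Longrightarrow> nrm (x * y) = nrm x * nrm y"
  unfolding nrm_def prod.distrib[symmetric] by (rule prod.cong[OF refl]) (rule gal_mult[OF H_half_sub(2)])

lemma nrm_power: "x \<in> K \<Longrightarrow> nrm (x ^ k) = nrm x ^ k"
  unfolding nrm_def prod_power_distrib by (rule prod.cong[OF refl]) (rule gal_power[OF H_half_sub(2)])

lemma nrm_algebraic_int: "x \<in> K \<Longrightarrow> algebraic_int x \<Longrightarrow> algebraic_int (nrm x)"
  unfolding nrm_def by (rule algebraic_int_prod) (rule gal_algebraic_int[OF H_half_sub(2)])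

lemma nrm_quad: "x \<in> quad \<Longrightarrow> nrm x = x ^ card H_half"
proof -
  assume x: "x \<in> quad"
  have "nrm x = (\<Prod>a\<in>H_half. x)"
    unfolding nrm_def by (rule prod.cong[OF refl]) (rule quad_fixed[OF H_half_sub(1) x])
  thus "nrm x = x ^ card H_half" by simp
qed

lemma nrm_nonzero: "x \<in> K \<Longrightarrow> x \<noteq> 0 \<Longrightarrow> nrm x \<noteq> 0"
proof -
  assume x: "x \<in> K" "x \<noteq> 0"
  have "finite H_half" using finite_H by (simp add: H_half_def)
  thus "nrm x \<noteq> 0" unfolding nrm_def using gal_eq_0_iff[OF H_half_sub(2) x(1)] x(2) by simp
qed

lemma nrm_in_quad: "x \<in> L \<Longrightarrow> nrm x \<in> quad"
proof -
  assume "x \<in> L"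
  hence x: "x \<in> K" "cnj x = x" by (simp_all add: L_iff)
  obtain u v where "nrm x = of_rat u + of_rat v * r"
    using fixed_field_H[OF nrm_closed[OF x(1)] nrm_fixed[OF _ x]] .
  thus "nrm x \<in> quad" unfolding quad_iff by blast
qed

lemma card_H_half_pos: "card H_half > 0"
proof -
  have "1 \<in> H_half" using one_in_G gal_one[OF r_K] n_gt_2 by (simp add: H_half_def H_def)
  moreover have "finite H_half" using finite_H by (simp add: H_half_def)
  ultimately show ?thesis unfolding card_gt_0_iff by blast
qed

lemma integers_quad_sub_L: "integers_of quad \<subseteq> integers_of L"
  using quad_sub_L unfolding integers_of_def by blast

lemma two_generated_quad_sub: "two_generated quad a b \<subseteq> two_generated L a b"
proof
  fix c assume "c \<in> two_generated quad a b"
  then obtain x y where "c = a * x + b * y" "x \<in> integers_of quad" "y \<in> integers_of quad"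
    unfolding two_generated_def by blast
  moreover from this have "x \<in> integers_of L" "y \<in> integers_of L" using integers_quad_sub_L by blast+
  ultimately show "c \<in> two_generated L a b" unfolding two_generated_def by blast
qed

text \<open>Over the quadratic field \<open>I ^ h\<close> has a generator \<open>\<beta>\<close>,
  and over \<open>L\<close> both \<open>\<alpha> ^ h\<close> and \<open>\<beta>\<close> generate it.
  Norms give \<open>\<gamma> ^ h = \<beta> ^ d * \<epsilon>\<close> with a unit
  \<open>\<epsilon>\<close> and \<open>d = card H_half\<close>. As \<open>d\<close> is prime to
  \<open>h\<close>, this makes \<open>\<beta>\<close> an \<open>h\<close>-th power up to a unit, so
  \<open>I\<close> itself would be principal.\<close>

lemma two_generated_L_nonprincipal:
  assumes cop: "coprime (totient n div 4) (class_number quad)"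
    and \<alpha>: "\<alpha> \<in> L" "\<alpha> \<noteq> 0" "two_generated L (of_nat q) (r - 2) = (\<lambda>x. \<alpha> * x) ` integers_of L"
  shows False
proof -
  interpret number_ring quad by (rule number_ring_quad)
  define h where "h = class_number quad"
  define d where "d = card H_half"
  define I where "I = two_generated quad (of_nat q) (r - 2)"
  have h: "h > 0" unfolding h_def by (rule class_number_quad_pos[OF cop])
  have q0: "(of_nat q :: complex) \<noteq> 0" using q_ge_3 by simp
  have I: "frac I" unfolding I_def by (rule frac_two_generated[OF r_minus_2(3,1) q0])
  have "fpow I h \<in> \<P>"
    unfolding h_def by (rule power_class_number_principal[OF _ I]) (use h h_def in simp)
  then obtain \<beta> where \<beta>: "\<beta> \<in> quad" "\<beta> \<noteq> 0" "fpow I h = (\<lambda>x. \<beta> * x) ` \<O>"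
    unfolding principal_iff by blast
  have \<beta>I: "\<beta> \<in> fpow I h" unfolding \<beta>(3) using O_closed(5) by (intro image_eqI[of _ _ 1]) auto
  have LK: "\<alpha> \<in> K" "\<beta> \<in> K" "\<beta> \<in> L" using \<alpha>(1) \<beta>(1) L_sub_K quad_sub_L by auto
  note OL = number_ring.O_closed[OF number_ring_L] number_ring.O_power[OF number_ring_L]

  have "I \<subseteq> (\<lambda>x. \<alpha> * x) ` integers_of L" unfolding I_def \<alpha>(3)[symmetric] by (rule two_generated_quad_sub)
  hence "fpow I h \<subseteq> (\<lambda>x. \<alpha> ^ h * x) ` integers_of L"
    by (rule power_subset[OF _ OL(1,2) integers_quad_sub_L])
  then obtain z where z: "\<beta> = \<alpha> ^ h * z" "z \<in> integers_of L" using \<beta>I by blast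

  have "\<alpha> * 1 \<in> (\<lambda>x. \<alpha> * x) ` integers_of L" by (rule imageI) (rule OL(5))
  then obtain x y where xy: "\<alpha> = of_nat q * x + (r - 2) * y" "x \<in> integers_of L" "y \<in> integers_of L"
    unfolding \<alpha>(3)[symmetric] two_generated_def by auto
  \<comment> \<open>These are the monomials in the binomial expansion of
    \<open>\<alpha> ^ h\<close>; they lie in \<open>I ^ h\<close>, so \<open>\<beta>\<close> divides
    \<open>\<alpha> ^ h\<close>.\<close>
  have "\<exists>t\<in>integers_of L. of_nat q ^ i * (r - 2) ^ (h - i) = \<beta> * t" if "i \<le> h" for i
  proof -
    have "of_nat q ^ i * (r - 2) ^ (h - i) \<in> fpow I (i + (h - i))"
      by (rule power_mem[OF I]) (simp_all add: I_def two_generated_mem)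
    thus ?thesis using that integers_quad_sub_L unfolding le_add_diff_inverse[OF that] \<beta>(3) by blast
  qed
  then obtain t where t: "\<And>i. i \<le> h \<Longrightarrow> t i \<in> integers_of L"
    "\<And>i. i \<le> h \<Longrightarrow> of_nat q ^ i * (r - 2) ^ (h - i) = \<beta> * t i" by metis
  define w where "w = (\<Sum>i\<le>h. of_nat (h choose i) * t i * x ^ i * y ^ (h - i))"
  have "\<alpha> ^ h = (\<Sum>i\<le>h. of_nat (h choose i) * (of_nat q * x) ^ i * ((r - 2) * y) ^ (h - i))"
    unfolding xy(1) by (rule binomial_ring)
  also have "\<dots> = (\<Sum>i\<le>h. \<beta> * (of_nat (h choose i) * t i * x ^ i * y ^ (h - i)))"
  proof (rule sum.cong)
    fix i assume "i \<in> {..h}"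
    hence "\<beta> * t i = of_nat q ^ i * (r - 2) ^ (h - i)" using t(2) by simp
    hence "of_nat (h choose i) * (\<beta> * t i) * x ^ i * y ^ (h - i)
      = of_nat (h choose i) * (of_nat q ^ i * (r - 2) ^ (h - i)) * x ^ i * y ^ (h - i)" by (simp only:)
    thus "of_nat (h choose i) * (of_nat q * x) ^ i * ((r - 2) * y) ^ (h - i)
      = \<beta> * (of_nat (h choose i) * t i * x ^ i * y ^ (h - i))"
      by (simp only: power_mult_distrib mult.commute mult.left_commute mult.assoc)
  qed simp
  also have "\<dots> = \<beta> * w" by (simp only: w_def sum_distrib_left)
  finally have w: "\<alpha> ^ h = \<beta> * w" .
  have wint: "algebraic_int w" unfolding w_def using t(1) xy(2,3)
    by (intro algebraic_int_sum algebraic_int_mult algebraic_int_power) (auto simp: integers_of_def)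
  have "w = \<alpha> ^ h / \<beta>" using w \<beta>(2) by simp
  hence wK: "w \<in> K" using LK by simp
  have zK: "z \<in> K" "algebraic_int z" using z(2) L_sub_K by (auto simp: integers_of_def)

  define \<gamma> \<epsilon> \<epsilon>' where "\<gamma> = nrm \<alpha>" and "\<epsilon> = nrm w" and "\<epsilon>' = nrm z"
  have \<gamma>: "\<gamma> \<in> quad" "\<gamma> \<noteq> 0"
    unfolding \<gamma>_def using nrm_in_quad[OF \<alpha>(1)] nrm_nonzero[OF LK(1) \<alpha>(2)] by simp_all
  have \<beta>d: "nrm \<beta> = \<beta> ^ d" unfolding d_def by (rule nrm_quad[OF \<beta>(1)])
  have e1: "\<gamma> ^ h = \<beta> ^ d * \<epsilon>"
    unfolding \<gamma>_def \<epsilon>_def nrm_power[OF LK(1), symmetric] w \<beta>d[symmetric] by (rule nrm_mult[OF LK(2) wK])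
  have "nrm (\<alpha> ^ h * z) = nrm (\<alpha> ^ h) * nrm z"
    by (rule nrm_mult) (use LK(1) zK(1) in simp_all)
  hence "nrm \<beta> = \<gamma> ^ h * \<epsilon>'"
    by (simp only: z(1)[symmetric] nrm_power[OF LK(1)] \<gamma>_def \<epsilon>'_def)
  hence e2: "\<beta> ^ d = \<gamma> ^ h * \<epsilon>'" by (simp only: \<beta>d)
  have "\<beta> ^ d * (\<epsilon> * \<epsilon>') = \<gamma> ^ h * \<epsilon>'" by (simp only: e1 mult.assoc)
  also have "\<dots> = \<beta> ^ d" by (rule e2[symmetric])
  finally have "\<beta> ^ d * (\<epsilon> * \<epsilon>') = \<beta> ^ d" .
  hence ee: "\<epsilon> * \<epsilon>' = 1" using \<beta>(2) by simp
  have "\<epsilon> = \<gamma> ^ h * inverse (\<beta> ^ d)" unfolding e1 using \<beta>(2) by simp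
  hence "\<epsilon> \<in> quad" by (simp only: M_mult[OF M_power[OF \<gamma>(1)] M_inverse[OF M_power[OF \<beta>(1)]]])
  moreover have "algebraic_int \<epsilon>" unfolding \<epsilon>_def by (rule nrm_algebraic_int[OF wK wint])
  ultimately have \<epsilon>: "\<epsilon> \<in> \<O>" by (simp add: integers_of_def)
  have "\<epsilon>' = \<beta> ^ d * inverse (\<gamma> ^ h)" unfolding e2 using \<gamma>(2) by simp
  hence "\<epsilon>' \<in> quad" by (simp only: M_mult[OF M_power[OF \<beta>(1)] M_inverse[OF M_power[OF \<gamma>(1)]]])
  moreover have "algebraic_int \<epsilon>'" unfolding \<epsilon>'_def by (rule nrm_algebraic_int[OF zK])
  ultimately have \<epsilon>': "\<epsilon>' \<in> \<O>" by (simp add: integers_of_def)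

  have "coprime d h" unfolding d_def h_def by (rule coprime_divisors[OF card_H_half_dvd dvd_refl cop])
  then obtain u v where uv: "d * u = h * v + 1"
    using bezout_nat[of d h] card_H_half_pos by (auto simp: d_def)
  \<comment> \<open>By \<open>d * u = h * v + 1\<close>, the power \<open>\<delta> ^ h\<close> is
    \<open>\<beta>\<close> times the unit \<open>\<epsilon> ^ u\<close>.\<close>
  define \<delta> where "\<delta> = \<gamma> ^ u * inverse (\<beta> ^ v)"
  have \<delta>: "\<delta> \<in> quad" "\<delta> \<noteq> 0"
    unfolding \<delta>_def using M_mult[OF M_power[OF \<gamma>(1)] M_inverse[OF M_power[OF \<beta>(1)]]] \<gamma>(2) \<beta>(2) by simp_all
  have "\<delta> * \<beta> ^ v = \<gamma> ^ u" unfolding \<delta>_def using \<beta>(2) by simp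
  hence "\<delta> ^ h * (\<beta> ^ v) ^ h = (\<gamma> ^ u) ^ h" by (simp only: power_mult_distrib[symmetric])
  hence "\<delta> ^ h * \<beta> ^ (h * v) = (\<gamma> ^ h) ^ u" by (simp only: power_mult[symmetric] mult.commute)
  also have "\<dots> = \<beta> ^ (d * u) * \<epsilon> ^ u" unfolding e1 by (simp only: power_mult_distrib power_mult)
  also have "\<dots> = (\<beta> * \<epsilon> ^ u) * \<beta> ^ (h * v)" unfolding uv by simp
  finally have \<delta>h: "\<delta> ^ h = \<beta> * \<epsilon> ^ u" using \<beta>(2) by simp
  have eu: "\<epsilon> ^ u * \<epsilon>' ^ u = 1" using ee by (simp flip: power_mult_distrib)
  have "(\<lambda>x. \<beta> * x) ` \<O> = (\<lambda>x. \<delta> ^ h * x) ` \<O>"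
  proof (intro equalityI subsetI)
    fix c assume "c \<in> (\<lambda>x. \<beta> * x) ` \<O>"
    then obtain a where a: "c = \<beta> * a" "a \<in> \<O>" by blast
    have "c = \<beta> * (\<epsilon> ^ u * \<epsilon>' ^ u) * a" using a(1) eu by simp
    hence "c = \<delta> ^ h * (\<epsilon>' ^ u * a)" unfolding \<delta>h by (simp only: mult.assoc)
    moreover have "\<epsilon>' ^ u * a \<in> \<O>" by (rule O_closed(2)[OF O_power[OF \<epsilon>'] a(2)])
    ultimately show "c \<in> (\<lambda>x. \<delta> ^ h * x) ` \<O>" by blast
  next
    fix c assume "c \<in> (\<lambda>x. \<delta> ^ h * x) ` \<O>"
    then obtain a where a: "c = \<delta> ^ h * a" "a \<in> \<O>" by blast
    hence "c = \<beta> * (\<epsilon> ^ u * a)" unfolding \<delta>h by (simp only: mult.assoc)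
    moreover have "\<epsilon> ^ u * a \<in> \<O>" by (rule O_closed(2)[OF O_power[OF \<epsilon>] a(2)])
    ultimately show "c \<in> (\<lambda>x. \<beta> * x) ` \<O>" by blast
  qed
  hence "I = (\<lambda>x. \<delta> * x) ` \<O>"
    by (intro principal_if_power_eq[OF I h \<delta>]) (simp only: \<beta>(3))
  thus False unfolding I_def by (rule quad_ideal_nonprincipal)
qed

text \<open>Ramification: let \<open>B\<close> be the inverse of \<open>P\<close>. If
  \<open>q\<close> lay in \<open>P \<star> P\<close>, then \<open>q * b\<^sup>2\<close> would be
  integral for \<open>b \<in> B\<close>, so \<open>q\<close> would divide the square of
  \<open>q * b\<close> and hence \<open>q * b\<close>. Thus \<open>B\<close> would be integral, and
  1 would lie in \<open>P\<close>. Residue degree: if it were 1, then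
  \<open>\<omega> = \<zeta> + \<zeta>^-1\<close> would be congruent to some natural \<open>t\<close>
  modulo \<open>P\<close>, and Fermat's theorem with the freshman's dream would put
  \<open>\<eta>\<close> into \<open>P\<close>.\<close>

lemma
  assumes P: "number_ring.integral_ideal L P" "1 \<notin> P"
      "\<And>x y. x \<in> integers_of L \<Longrightarrow> y \<in> integers_of L \<Longrightarrow> x * y \<in> P \<Longrightarrow> x \<in> P \<or> y \<in> P"
      "of_nat q \<in> P"
  shows unramified_above_q: "class_number L > 0 \<Longrightarrow> ramification_index \<rat> L P = 1"
    and residue_degree_above_q: "residue_degree \<rat> L P \<noteq> 1"
proof -
  interpret number_ring L by (rule number_ring_L)
  show "ramification_index \<rat> L P = 1" if cl: "class_number L > 0"
  proof (rule ramification_index_eq_1[OF P(1,2,3) prime_q P(4)])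
    show "of_nat q \<notin> (P \<star> P)"
    proof
      assume qPP: "of_nat q \<in> P \<star> P"
      have fr: "frac P" using frac_integral_ideal[OF P(1,4)] q_ge_3 by simp
      obtain B where B: "frac B" "P \<star> B = \<O>" using frac_invertible[OF cl fr] .
      have PB: "p * b \<in> \<O>" if "p \<in> P" "b \<in> B" for p b using ideal_prodI[OF that] B(2) by simp
      have "B \<subseteq> \<O>"
      proof
        fix b assume b: "b \<in> B"
        have bL: "b \<in> L" using fracD(1)[OF B(1)] b by blast
        have "of_nat q * b \<in> \<O>" by (rule PB[OF P(4) b])
        hence qb: "algebraic_int (of_nat q * b)" by (simp add: integers_of_def)
        have "y * (b * b) \<in> \<O>" if "y \<in> P \<star> P" for y
          using that
        proof (induction rule: ideal_prod_induct)
          case (prod p p')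
          have "p * p' * (b * b) = (p * b) * (p' * b)" by simp
          thus ?case using O_closed(2)[OF PB[OF prod(1) b] PB[OF prod(2) b]] by (simp only:)
        next
          case (sum y y')
          thus ?case using O_closed(1) by (simp add: distrib_right)
        qed
        from this[OF qPP] have "algebraic_int (of_nat q * (b * b))" by (simp add: integers_of_def)
        moreover have "(of_nat q * b)\<^sup>2 / of_nat q = of_nat q * (b * b)"
          using q_ge_3 by (simp add: power2_eq_square)
        ultimately have sq: "algebraic_int ((of_nat q * b)\<^sup>2 / of_nat q)" by (simp only:)
        have "of_nat q * b \<in> K" using bL L_sub_K by auto
        from integers_mod_prime_reduced[OF prime_q coprime_n_q this qb sq]
        have "algebraic_int b" using q_ge_3 by simp
        thus "b \<in> \<O>" using bL by (simp add: integers_of_def)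
      qed
      have "P \<star> B \<subseteq> P"
      proof (rule ideal_prod_subset[OF _ integral_idealD(3)[OF P(1)]])
        fix p b assume "p \<in> P" "b \<in> B"
        thus "p * b \<in> P" using integral_idealD(4)[OF P(1), of b p] \<open>B \<subseteq> \<O>\<close> by (auto simp: mult.commute)
      qed
      thus False using B(2) P(2) O_closed(5) by blast
    qed
  qed
  show "residue_degree \<rat> L P \<noteq> 1"
  proof
    assume deg: "residue_degree \<rat> L P = 1"
    define z w where "z = \<zeta>" and "w = \<zeta> ^ (n - 1)"
    have w: "w = cnj z" by (simp add: w_def z_def cnj_\<zeta>)
    have zw: "z * w = 1" unfolding z_def w_def using n_gt_2 \<zeta>_power_n by (metis power_Suc Suc_diff_1 less_trans zero_less_numeral)
    have int: "algebraic_int z" "algebraic_int w" by (simp_all add: z_def w_def algebraic_int_\<zeta> algebraic_int_power)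
    have zK: "z \<in> K" "w \<in> K" by (simp_all add: z_def w_def)
    have sum_int: "z ^ k + w ^ k \<in> \<O>" for k
      using zK int by (simp add: integers_of_def L_iff w algebraic_int_add algebraic_int_power add.commute)
    define \<omega> where "\<omega> = z + w"
    have \<omega>: "\<omega> \<in> \<O>" using sum_int[of 1] by (simp add: \<omega>_def)
    obtain t0 where t0: "\<omega> - of_int t0 \<in> P" using residue_degree_prime(2)[OF P(1,2,3) prime_q P(4) deg \<omega>] by blast
    define t where "t = nat (t0 mod int q)"
    have q_pos: "int q > 0" using q_ge_3 by simp
    have t: "int t = t0 mod int q" using q_pos by (simp add: t_def)
    have "of_int (t0 - int t) \<in> P"
      by (subst integer_in_P_iff[OF P(1,2,3) prime_q P(4)]) (simp_all add: t mod_eq_dvd_iff[symmetric])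
    from integral_idealD(3)[OF P(1) t0 this] have \<omega>t: "\<omega> - of_nat t \<in> P" by simp
    have "\<omega> ^ k - of_nat t ^ k \<in> P" for k
    proof (induction k)
      case (Suc k)
      have "\<omega> ^ Suc k - of_nat t ^ Suc k = \<omega> * (\<omega> ^ k - of_nat t ^ k) + of_nat t ^ k * (\<omega> - of_nat t)"
        by (simp add: algebra_simps)
      also have "\<dots> \<in> P"
        by (rule integral_idealD(3)[OF P(1) integral_idealD(4)[OF P(1) \<omega> Suc]
              integral_idealD(4)[OF P(1) O_power[OF O_closed(6)] \<omega>t]])
      finally show ?case .
    qed (use integral_idealD(2)[OF P(1)] in simp)
    hence c1: "\<omega> ^ q - of_nat t ^ q \<in> P" .
    have "[t ^ q = t] (mod q)"
    proof (cases "q dvd t")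
      case True
      hence "q dvd t ^ q" using q_ge_3 by (simp add: dvd_power_le[of q t 1 q, simplified])
      thus ?thesis using True by (simp add: Cong.cong_def mod_eq_0_iff_dvd)
    next
      case False
      have "[t * t ^ (q - 1) = t * 1] (mod q)" by (intro cong_mult cong_refl fermat_theorem[OF prime_q False])
      moreover have "t * t ^ (q - 1) = t ^ q" using q_ge_3 by (simp flip: power_Suc)
      ultimately show ?thesis by simp
    qed
    hence "int q dvd int t ^ q - int t" by (simp add: cong_iff_dvd_diff flip: cong_int_iff)
    hence c2: "of_nat t ^ q - of_nat t \<in> P"
      using integer_in_P_iff[OF P(1,2,3) prime_q P(4), of "int t ^ q - int t"] by simp
    \<comment> \<open>The two summands \<open>z\<close> and \<open>w\<close> are indexed by the
      booleans.\<close>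
    have "algebraic_int (((\<Sum>b\<in>UNIV. if b then z else w) ^ q - (\<Sum>b\<in>UNIV. (if b then z else w) ^ q)) / of_nat q)"
      using int by (intro algebraic_int_freshman_dream[OF prime_q]) simp
    hence alg: "algebraic_int ((\<omega> ^ q - (z ^ q + w ^ q)) / of_nat q)"
      by (simp add: UNIV_bool \<omega>_def add.commute)
    have "\<omega> ^ q - (z ^ q + w ^ q) \<in> L" using O_diff[OF O_power[OF \<omega>] sum_int] O_M by blast
    hence "(\<omega> ^ q - (z ^ q + w ^ q)) / of_nat q \<in> L"
      unfolding divide_inverse by (rule M_mult[OF _ M_inverse[OF M_rat[OF Rats_of_nat]]])
    hence "(\<omega> ^ q - (z ^ q + w ^ q)) / of_nat q \<in> \<O>" using alg by (simp add: integers_of_def)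
    from integral_idealD(4)[OF P(1) this P(4)] have c3: "\<omega> ^ q - (z ^ q + w ^ q) \<in> P" using q_ge_3 by simp
    define \<eta> where "\<eta> = z ^ q + w ^ q - z - w"
    have "\<eta> = (\<omega> ^ q - of_nat t ^ q) + (of_nat t ^ q - of_nat t) - (\<omega> - of_nat t) - (\<omega> ^ q - (z ^ q + w ^ q))"
      by (simp add: \<eta>_def \<omega>_def)
    also have "\<dots> \<in> P"
      by (rule integral_idealD(5)[OF P(1) integral_idealD(5)[OF P(1) integral_idealD(3)[OF P(1) c1 c2] \<omega>t] c3])
    finally have \<eta>P: "\<eta> \<in> P" .
    define S where "S k = (\<Sum>i<n. of_nat i * (z ^ k) ^ i)" for k
    have S: "(z ^ k - 1) * S k = of_nat n" if "0 < k" "k < n" for k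
      unfolding S_def
    proof (rule root_of_unity_minus_one_dvd)
      show "(z ^ k) ^ n = 1" unfolding z_def by (rule power_n_root)
      show "z ^ k \<noteq> 1" using \<zeta>_power_eq_iff[of k 0] that by (simp add: z_def)
    qed
    \<comment> \<open>The cofactor of \<open>\<eta>\<close> in \<open>n * n\<close>: each
      \<open>S k\<close> completes one of the factors \<open>z ^ k - 1\<close> of
      \<open>z ^ q * \<eta>\<close> to \<open>n\<close>.\<close>
    define y where "y = z ^ q * S (q + 1) * S (q - 1)"
    have zwq: "z ^ q * w ^ q = 1" using zw by (simp flip: power_mult_distrib)
    have "z ^ q * \<eta> = z ^ q * z ^ q + z ^ q * w ^ q - z ^ q * z - z ^ q * w"
      by (simp only: \<eta>_def right_diff_distrib distrib_left)
    also have "z ^ q * w = z ^ (q - 1)"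
    proof -
      have "z ^ (q - 1) * z = z ^ q" using q_ge_3 by (intro power_minus_mult) simp
      hence "z ^ q * w = z ^ (q - 1) * (z * w)" by (simp only: mult.assoc[symmetric])
      thus ?thesis by (simp only: zw mult_1_right)
    qed
    also have "z ^ q * z ^ q + z ^ q * w ^ q - z ^ q * z - z ^ (q - 1) = (z ^ (q + 1) - 1) * (z ^ (q - 1) - 1)"
    proof -
      have "(q + 1) + (q - 1) = q + q" using q_ge_3 by simp
      hence prod: "z ^ (q + 1) * z ^ (q - 1) = z ^ q * z ^ q" by (simp only: power_add[symmetric])
      have "(z ^ (q + 1) - 1) * (z ^ (q - 1) - 1) = z ^ (q + 1) * z ^ (q - 1) - z ^ (q + 1) - z ^ (q - 1) + 1"
        by (simp only: left_diff_distrib right_diff_distrib mult_1 mult_1_right) simp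
      also have "\<dots> = z ^ q * z ^ q + z ^ q * w ^ q - z ^ q * z - z ^ (q - 1)"
        unfolding prod zwq by simp
      finally show ?thesis ..
    qed
    finally have "z ^ q * \<eta> * (S (q + 1) * S (q - 1)) = ((z ^ (q + 1) - 1) * S (q + 1)) * ((z ^ (q - 1) - 1) * S (q - 1))"
      by (simp only: mult.commute mult.left_commute mult.assoc)
    also have "\<dots> = of_nat n * of_nat n" using S[of "q + 1"] S[of "q - 1"] n_gt q_ge_3 by simp
    finally have y\<eta>: "y * \<eta> = of_nat n * of_nat n" unfolding y_def by (simp only: mult.commute mult.left_commute mult.assoc)
    \<comment> \<open>That \<open>y\<close> lies in \<open>L\<close> is not visible from its
      definition, but follows from \<open>y = n * n / \<eta>\<close>.\<close>
    have "\<eta> \<noteq> 0" using y\<eta> n_gt by auto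
    hence "y = (y * \<eta>) * inverse \<eta>" by simp
    hence "y = of_nat n * of_nat n * inverse \<eta>" by (simp only: y\<eta>)
    moreover have "\<eta> \<in> L" using integral_idealD(1)[OF P(1) \<eta>P] O_M by blast
    ultimately have "y \<in> L"
      by (simp only: M_mult[OF M_mult[OF M_rat[OF Rats_of_nat] M_rat[OF Rats_of_nat]] M_inverse])
    moreover have "algebraic_int y" unfolding y_def S_def using int
      by (intro algebraic_int_mult algebraic_int_sum algebraic_int_power algebraic_int_of_nat)
    ultimately have "y \<in> \<O>" by (simp add: integers_of_def)
    from integral_idealD(4)[OF P(1) this \<eta>P] have "of_int (int n * int n) \<in> P" unfolding y\<eta> by simp
    hence "int q dvd int n * int n" by (simp only: integer_in_P_iff[OF P(1,2,3) prime_q P(4)])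
    hence "q dvd n * n" by (metis int_dvd_int_iff of_nat_mult)
    hence "q dvd n" using prime_q prime_dvd_mult_nat by blast
    thus False using coprime_n_q q_ge_3 coprime_common_divisor[of n q q] by simp
  qed
qed

lemma residue_degree_set_nontrivial:
  assumes L: "Factorial_Ring.prime (class_number L)"
    and cop: "coprime (totient n div 4) (class_number quad)"
  shows "residue_degree_set \<rat> L \<noteq> {1}"
proof -
  interpret number_ring L by (rule number_ring_L)
  have cl: "class_number L > 0" using L by (rule prime_gt_0_nat)
  define I where "I = two_generated L (of_nat q) (r - 2)"
  have mem: "of_nat q \<in> \<O>" "r - 2 \<in> \<O>"
    by (rule subsetD[OF integers_quad_sub_L r_minus_2(3)]) (rule subsetD[OF integers_quad_sub_L r_minus_2(1)])
  have "0 \<in> I"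
    using two_generated_closed(2)[OF O_closed(4) two_generated_mem(1)] unfolding I_def by simp
  hence "integral_ideal I"
    unfolding I_def integral_ideal_def
    by (intro conjI ballI two_generated_integral[OF mem] two_generated_closed)
  moreover have "of_nat q \<in> I" unfolding I_def by (rule two_generated_mem)
  moreover have "q > 0" using q_ge_3 by simp
  moreover have "I \<notin> \<P>"
    unfolding principal_iff I_def
  proof
    assume "\<exists>c\<in>L. c \<noteq> 0 \<and> two_generated L (of_nat q) (r - 2) = (\<lambda>x. c * x) ` \<O>"
    then obtain c where "c \<in> L" "c \<noteq> 0" "two_generated L (of_nat q) (r - 2) = (\<lambda>x. c * x) ` \<O>" by blast
    thus False by (rule two_generated_L_nonprincipal[OF cop])
  qed
  ultimately obtain P where P: "integral_ideal P" "of_nat q \<in> P" "P \<notin> \<P>"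
    and max: "\<And>J. integral_ideal J \<Longrightarrow> P \<subset> J \<Longrightarrow> J \<in> \<P>"
    by (rule exists_maximal_nonprincipal) (rule that)
  have q0: "(of_nat q :: complex) \<noteq> 0" using q_ge_3 by simp
  have nz: "\<exists>x\<in>P. x \<noteq> 0" using P(2) q0 by blast
  have one: "1 \<notin> P"
    by (rule maximal_nonprincipal_prime(1)[OF P(1,3) nz]) (rule max)
  have prime: "x \<in> P \<or> y \<in> P" if "x \<in> \<O>" "y \<in> \<O>" "x * y \<in> P" for x y
    by (rule maximal_nonprincipal_prime(2)[OF P(1,3) nz _ that]) (rule max)
  define f where "f = residue_degree \<rat> L P"
  have f: "f \<ge> 1" "f \<noteq> 1"
  proof -
    show "f \<ge> 1" unfolding f_def by (rule residue_degree_prime(1)[OF P(1) one prime prime_q P(2)])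
    show "f \<noteq> 1" unfolding f_def by (rule residue_degree_above_q[OF P(1) one prime P(2)])
  qed
  have PT: "P \<in> unramified_primes_of_degree \<rat> L f"
    unfolding unramified_primes_of_degree_def
    unfolding mem_Collect_eq
  proof (intro conjI)
    show "primeideal P (ring_of_integers L)" by (rule primeideal_ring_of_integers[OF P(1) one prime])
    show "P \<noteq> {0}" using nz by blast
    show "ramification_index \<rat> L P = 1" by (rule unramified_above_q[OF P(1) one prime P(2) cl])
    show "residue_degree \<rat> L P = f" by (simp only: f_def)
  qed
  have "frac J" if "J \<in> unramified_primes_of_degree \<rat> L f" for J
  proof -
    have J: "primeideal J (ring_of_integers L)" "J \<noteq> {0}" using that by (simp_all add: unramified_primes_of_degree_def)
    have i: "integral_ideal J" using primeideal.axioms(1)[OF J(1)] by (simp only: ideal_iff)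
    then obtain x where "x \<in> J" "x \<noteq> 0" using integral_idealD(2)[OF i] J(2) by blast
    thus ?thesis by (rule frac_integral_ideal[OF i])
  qed
  from generate_class_group[OF L this PT P(3)] have "f \<in> residue_degree_set \<rat> L"
    unfolding residue_degree_set_def using f(1) by simp
  thus ?thesis using f(2) by blast
qed

end

theorem theorem1p5:
  fixes n m q :: nat
  assumes "n = ((2 * m + 1) * q)\<^sup>2 + 4"
    and "squarefree n"
    and "Factorial_Ring.prime q" and "odd q"
    and "m \<ge> 1"
    and "Factorial_Ring.prime (class_number (max_real_cyclotomic_field n))"
    and "coprime (totient n div 4) (class_number (adjoin_Q (complex_of_real (sqrt (real n)))))"
  shows "residue_degree_set \<rat> (max_real_cyclotomic_field n) \<noteq> {1}"
proof -
  have "q > 0" using assms(3) by (rule prime_gt_0_nat)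
  \<comment> \<open>This is the source of \<open>q < s\<close>, on which the descent rests.\<close>
  moreover have "1 < 2 * m + 1" using assms(5) by simp
  ultimately have "1 * q < (2 * m + 1) * q" by (rule mult_strict_right_mono[rotated])
  hence ts: "twisted_square n ((2 * m + 1) * q) q"
    using assms(4) by (intro twisted_square.intro assms(1-3)) simp_all
  show ?thesis
    by (rule twisted_square.residue_degree_set_nontrivial[OF ts,
          unfolded twisted_square.L_def[OF ts] twisted_square.quad_def[OF ts], OF assms(6,7)])
qed

end
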